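(* Let $H$ be a nontrivial $k$-uniform hypergraph with $k\ge 3$ odd. Then the Laplacian spectrum and the signless Laplacian spectrum of $H$ are not equal.
   Context: A hypergraph $H=(V,E)$ with $V=[n]=\{1,\dots,n\}$ is $k$-uniform if every edge contains exactly $k$ vertices; it is nontrivial if it has at least one edge. The adjacency tensor $\mathbb{A}=\mathbb{A}_H$ is the tensor of order $k$ and dimension $n$ with entries $a_{i_1\cdots i_k}=\frac{1}{(k-1)!}$ if $\{i_1,\dots,i_k\}\in E$ and $0$ otherwise. The degree tensor $\mathbb{D}=\mathbb{D}_H$ is the diagonal tensor of order $k$ and dimension $n$ whose entry with all indices equal to $i$ is the degree of vertex $i$ (the number of edges containing $i$), all other entries being $0$. The Laplacian tensor is $\mathbb{L}=\mathbb{D}-\mathbb{A}$ and the signless Laplacian tensor is $\mathbb{Q}=\mathbb{D}+\mathbb{A}$. The Laplacian spectrum and the signless Laplacian spectrum of $H$ are the spectra of $\mathbb{L}$ and $\mathbb{Q}$, respectively. For a tensor $\mathbb{T}=(t_{i_1\cdots i_m})$ of order $m\ge2$ and dimension $n$ over $\mathbb{C}$ and $x\in\mathbb{C}^n$, $\mathbb{T}x^{m-1}\in\mathbb{C}^n$ has $i$-th component $\sum_{i_2,\dots,i_m=1}^n t_{ii_2\cdots i_m}x_{i_2}\cdots x_{i_m}$. The determinant $Det(\mathbb{T})$ is the resultant of the $n$ homogeneous polynomials $(\mathbb{T}x^{m-1})_1,\dots,(\mathbb{T}x^{m-1})_n$ in $x_1,\dots,x_n$, normalized so that $Det(\mathbb{I})=1$,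 where the unit tensor $\mathbb{I}$ has entries $1$ when all indices are equal and $0$ otherwise. The characteristic polynomial is $\phi_{\mathbb{T}}(\lambda)=Det(\lambda\mathbb{I}-\mathbb{T})$, a monic polynomial of degree $n(m-1)^{n-1}$; the spectrum of $\mathbb{T}$ is the multi-set of its roots, counted with multiplicity. *)

theory Defs
  imports
    Complex_Main
    "HOL-Library.Poly_Mapping"
    "HOL-Computational_Algebra.Computational_Algebra"
begin

section \<open>Polynomials in several variables\<close>

text \<open>Monomials are finitely supported exponent functions; a polynomial maps monomials to
  coefficients. Sum and product are the (convolution) ring operations of
  \<^theory>\<open>HOL-Library.Poly_Mapping\<close>.\<close>

type_synonym 'v mpoly = "('v \<Rightarrow>\<^sub>0 nat) \<Rightarrow>\<^sub>0 complex"

definition mVar :: "'v \<Rightarrow> 'v mpoly" where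
  "mVar v = Poly_Mapping.single (Poly_Mapping.single v 1) 1"

definition mConst :: "complex \<Rightarrow> 'v mpoly" where
  "mConst c = Poly_Mapping.single 0 c"

definition mcoeff :: "'v mpoly \<Rightarrow> ('v \<Rightarrow>\<^sub>0 nat) \<Rightarrow> complex" where
  "mcoeff p \<alpha> = Poly_Mapping.lookup p \<alpha>"

definition mvars :: "'v mpoly \<Rightarrow> 'v set" where
  "mvars p = (\<Union>\<alpha>\<in>Poly_Mapping.keys p. Poly_Mapping.keys \<alpha>)"

definition meval :: "('v \<Rightarrow> complex) \<Rightarrow> 'v mpoly \<Rightarrow> complex" where
  "meval x p = (\<Sum>\<alpha>\<in>Poly_Mapping.keys p.
     mcoeff p \<alpha> * (\<Prod>v\<in>Poly_Mapping.keys \<alpha>. x v ^ Poly_Mapping.lookup \<alpha> v))"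

definition monomials :: "nat \<Rightarrow> nat \<Rightarrow> (nat \<Rightarrow>\<^sub>0 nat) set" where
  "monomials n d = {\<alpha>. Poly_Mapping.keys \<alpha> \<subseteq> {1..n} \<and>
     (\<Sum>i\<in>Poly_Mapping.keys \<alpha>. Poly_Mapping.lookup \<alpha> i) = d}"

definition form :: "nat \<Rightarrow> nat \<Rightarrow> nat mpoly \<Rightarrow> bool" where
  "form n d p \<longleftrightarrow> Poly_Mapping.keys p \<subseteq> monomials n d"


section \<open>The resultant of n forms of degree d in n variables\<close>

text \<open>The resultant is a polynomial in indeterminates (i, \<alpha>), one for the coefficient of the
  monomial \<alpha> in the i-th form. For n and d at least 1 it is the unique polynomial that is
  irreducible over the complex numbers, vanishes exactly at the systems with a nontrivial common
  zero, and takes the value 1 at the system of the d-th powers of the variables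
  (Cox, Little, O'Shea, Using Algebraic Geometry, Chapter 3, Theorem 2.3, with all degrees
  equal).\<close>

definition coeffs_of :: "(nat \<Rightarrow> nat mpoly) \<Rightarrow> nat \<times> (nat \<Rightarrow>\<^sub>0 nat) \<Rightarrow> complex" where
  "coeffs_of F = (\<lambda>(i, \<alpha>). mcoeff (F i) \<alpha>)"

definition is_resultant :: "nat \<Rightarrow> nat \<Rightarrow> (nat \<times> (nat \<Rightarrow>\<^sub>0 nat)) mpoly \<Rightarrow> bool" where
  "is_resultant n d R \<longleftrightarrow>
     mvars R \<subseteq> {1..n} \<times> monomials n d \<and>
     irreducible R \<and>
     (\<forall>F. (\<forall>i\<in>{1..n}. form n d (F i)) \<longrightarrow>
        (meval (coeffs_of F) R = 0 \<longleftrightarrow>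
         (\<exists>x. (\<exists>i\<in>{1..n}. x i \<noteq> 0) \<and> (\<forall>i\<in>{1..n}. meval x (F i) = 0)))) \<and>
     meval (coeffs_of (\<lambda>i. mVar i ^ d)) R = 1"

definition resultant_poly :: "nat \<Rightarrow> nat \<Rightarrow> (nat \<times> (nat \<Rightarrow>\<^sub>0 nat)) mpoly" where
  "resultant_poly n d = (THE R. is_resultant n d R)"

definition form_resultant :: "nat \<Rightarrow> nat \<Rightarrow> (nat \<Rightarrow> nat mpoly) \<Rightarrow> complex" where
  "form_resultant n d F = meval (coeffs_of F) (resultant_poly n d)"


section \<open>Tensors\<close>

text \<open>A tensor of order m and dimension n is given by its entries, indexed by lists of length m
  over {1..n}; values at other lists are never used.\<close>

type_synonym tensor = "nat list \<Rightarrow> complex"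

definition diag_tensor :: "(nat \<Rightarrow> complex) \<Rightarrow> tensor" where
  "diag_tensor c js = (if set js = {hd js} then c (hd js) else 0)"

definition unit_tensor :: tensor where
  "unit_tensor = diag_tensor (\<lambda>_. 1)"

definition tensor_form :: "nat \<Rightarrow> nat \<Rightarrow> tensor \<Rightarrow> nat \<Rightarrow> nat mpoly" where
  "tensor_form n m T i =
     (\<Sum>js\<in>{js. length js = m - 1 \<and> set js \<subseteq> {1..n}}.
        mConst (T (i # js)) * (\<Prod>j\<leftarrow>js. mVar j))"

definition tensor_det :: "nat \<Rightarrow> nat \<Rightarrow> tensor \<Rightarrow> complex" where
  "tensor_det n m T = form_resultant n (m - 1) (tensor_form n m T)"

definition tensor_charpoly :: "nat \<Rightarrow> nat \<Rightarrow> tensor \<Rightarrow> complex poly" where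
  "tensor_charpoly n m T =
     (THE p. \<forall>z. poly p z = tensor_det n m (\<lambda>js. z * unit_tensor js - T js))"

definition tensor_spectrum :: "nat \<Rightarrow> nat \<Rightarrow> tensor \<Rightarrow> complex multiset" where
  "tensor_spectrum n m T = proots (tensor_charpoly n m T)"


section \<open>Uniform hypergraphs\<close>

definition uniform_hypergraph :: "nat \<Rightarrow> nat \<Rightarrow> nat set set \<Rightarrow> bool" where
  "uniform_hypergraph n k E \<longleftrightarrow> (\<forall>e\<in>E. e \<subseteq> {1..n} \<and> card e = k)"

definition vertex_degree :: "nat set set \<Rightarrow> nat \<Rightarrow> nat" where
  "vertex_degree E i = card {e \<in> E. i \<in> e}"

definition adjacency_tensor :: "nat \<Rightarrow> nat set set \<Rightarrow> tensor" where
  "adjacency_tensor k E js = (if set js \<in> E then 1 / fact (k - 1) else 0)"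

definition degree_tensor :: "nat set set \<Rightarrow> tensor" where
  "degree_tensor E = diag_tensor (\<lambda>i. of_nat (vertex_degree E i))"

definition laplacian_tensor :: "nat \<Rightarrow> nat set set \<Rightarrow> tensor" where
  "laplacian_tensor k E js = degree_tensor E js - adjacency_tensor k E js"

definition signless_laplacian_tensor :: "nat \<Rightarrow> nat set set \<Rightarrow> tensor" where
  "signless_laplacian_tensor k E js = degree_tensor E js + adjacency_tensor k E js"

end

theory Submission
  imports
    Defs
    "HOL-Analysis.Analysis"
    "HOL-Combinatorics.Multiset_Permutations"
    "Jordan_Normal_Form.Determinant"
begin

text \<open>Already the sets of eigenvalues differ. Let \<rho> be the maximum of Q x^k over the nonnegative x with
  x_1^k + ... + x_n^k = 1. A maximizer satisfies the eigenvalue equation of Q for \<rho>, even at vertices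
  where it vanishes, and \<rho> exceeds every degree. If L z^(k-1) = \<rho> z^[k-1], then taking absolute values
  and summing forces equality in every triangle inequality, so on some edge e with z^e nonzero all the
  phases of z_i^k equal that of - z^e. Multiplying over the k vertices of e gives 1 = (-1)^k.

  To identify the roots of the characteristic polynomial with the eigenvalues, the resultant has to be
  shown to exist and to be unique. The polynomials P vanishing at all systems with a nontrivial zero
  form a prime ideal, since these systems are parametrized by an affine space up to closure. The ideal
  contains no nonzero polynomial free of the coefficient t of x_n^d in the last form, so by Gauss's
  lemma it is generated by an element R of least degree in t and then of least total degree. A system F
  without nontrivial zeros is not a zero of R, because by the Nullstellensatz all monomials of some
  degree lie in the ideal of F, and expressing this by a determinant gives an element of P that is
  nonzero at F.\<close>

section \<open>Substitution and degrees\<close>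

text \<open>At a zero coordinate a one-sided variation replaces the derivative test: changing it to
  a small t > 0 alters the power terms by order t^k but the edge terms by order t, so the edge terms
  must vanish there. That \<open>rho\<close> exceeds every degree is what lets complex eigenvectors
  be compared with real ones: \<open>rho - deg i\<close> is then a positive real factor, which
  survives taking norms and carries no phase.

  Spectra are multisets of roots, and the zero polynomial contributes the empty multiset. An
  eigenvalue is therefore known to lie in the spectrum only once some other number is known not to
  be an eigenvalue; for Q the number \<open>rho + 1\<close> serves. Multiplicities never enter, so
  all that is used of the determinant is when it vanishes.

  The coefficient t is singled out because with x_n = 1 the monomial x_n^d has the value 1: each
  equation can then be solved for its coefficient of x_n^d, and this gives the parametrization of
  the solvable systems.\<close>

definition monom_eval :: "('v \<Rightarrow> 'r::comm_ring_1) \<Rightarrow> ('v \<Rightarrow>\<^sub>0 nat) \<Rightarrow> 'r" where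
  "monom_eval f \<alpha> = (\<Prod>v\<in>Poly_Mapping.keys \<alpha>. f v ^ Poly_Mapping.lookup \<alpha> v)"

text \<open>The universal property of polynomial rings, with \<open>f\<close> for the variables and
  \<open>h\<close> for the coefficients. Evaluation, the view as a polynomial in one variable,
  homogenization and restriction to a line are all instances, so \<open>msubst_hom\<close> makes
  each of them a ring homomorphism.\<close>

definition msubst :: "('v \<Rightarrow> 'r::comm_ring_1) \<Rightarrow> (complex \<Rightarrow> 'r) \<Rightarrow> 'v mpoly \<Rightarrow> 'r" where
  "msubst f h p = (\<Sum>\<alpha>\<in>Poly_Mapping.keys p. h (Poly_Mapping.lookup p \<alpha>) * monom_eval f \<alpha>)"

lemma monom_eval_superset:
  assumes "finite A" "Poly_Mapping.keys \<alpha> \<subseteq> A"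
  shows "monom_eval f \<alpha> = (\<Prod>v\<in>A. f v ^ Poly_Mapping.lookup \<alpha> v)"
  unfolding monom_eval_def
  by (intro prod.mono_neutral_left) (use assms in \<open>auto simp: in_keys_iff\<close>)

lemma monom_eval_0 [simp]: "monom_eval f 0 = 1"
  by (simp add: monom_eval_def)

lemma monom_eval_single [simp]: "monom_eval f (Poly_Mapping.single v e) = f v ^ e"
  by (simp add: monom_eval_def)

lemma monom_eval_add: "monom_eval f (\<alpha> + \<beta>) = monom_eval f \<alpha> * monom_eval f \<beta>"
proof -
  let ?A = "Poly_Mapping.keys \<alpha> \<union> Poly_Mapping.keys \<beta>"
  have "monom_eval f (\<alpha> + \<beta>) = (\<Prod>v\<in>?A. f v ^ Poly_Mapping.lookup (\<alpha> + \<beta>) v)"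
    by (intro monom_eval_superset) (use Poly_Mapping.keys_add[of \<alpha> \<beta>] in auto)
  also have "\<dots> = (\<Prod>v\<in>?A. f v ^ Poly_Mapping.lookup \<alpha> v) * (\<Prod>v\<in>?A. f v ^ Poly_Mapping.lookup \<beta> v)"
    by (simp add: lookup_add power_add prod.distrib)
  also have "\<dots> = monom_eval f \<alpha> * monom_eval f \<beta>"
    by (subst (1 2) monom_eval_superset[of ?A]) auto
  finally show ?thesis .
qed

lemma poly_mapping_sum_single:
  "p = (\<Sum>\<alpha>\<in>Poly_Mapping.keys p. Poly_Mapping.single \<alpha> (Poly_Mapping.lookup p \<alpha>))"
proof (rule poly_mapping_eqI)
  fix \<beta>
  have "(\<Sum>\<alpha>\<in>Poly_Mapping.keys p. Poly_Mapping.lookup p \<alpha> when \<alpha> = \<beta>) = Poly_Mapping.lookup p \<beta>"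
    unfolding when_def by (subst sum.delta) (simp_all add: in_keys_iff)
  then show "Poly_Mapping.lookup p \<beta> = Poly_Mapping.lookup
      (\<Sum>\<alpha>\<in>Poly_Mapping.keys p. Poly_Mapping.single \<alpha> (Poly_Mapping.lookup p \<alpha>)) \<beta>"
    by (simp add: lookup_sum lookup_single)
qed

lemma comm_ring_hom_const_poly: "comm_ring_hom (\<lambda>c::'a::comm_ring_1. [:c:])"
  by unfold_locales (auto simp: one_pCons mult.commute)

lemma comm_ring_hom_poly: "comm_ring_hom (\<lambda>p::'a::comm_ring_1 poly. poly p a)"
  by unfold_locales auto

lemma comm_ring_hom_mConst: "comm_ring_hom mConst"
  by unfold_locales (auto simp: mConst_def single_add mult_single)

lemma comm_ring_hom_comp:
  assumes "comm_ring_hom g" "comm_ring_hom h"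
  shows "comm_ring_hom (\<lambda>x. g (h x))"
proof -
  interpret g: comm_ring_hom g by fact
  interpret h: comm_ring_hom h by fact
  show ?thesis by unfold_locales (simp_all add: g.hom_add h.hom_add g.hom_mult h.hom_mult)
qed

context comm_ring_hom begin

lemma hom_monom_eval: "hom (monom_eval f \<alpha>) = monom_eval (\<lambda>v. hom (f v)) \<alpha>"
  by (simp add: monom_eval_def hom_distribs)

end

lemma msubst_single: "h 0 = 0 \<Longrightarrow> msubst f h (Poly_Mapping.single \<alpha> c) = h c * monom_eval f \<alpha>"
  by (simp add: msubst_def)

lemma msubst_hom:
  assumes "comm_ring_hom h"
  shows "comm_ring_hom (msubst f h)"
proof -
  interpret h: comm_ring_hom h by fact
  have one: "msubst f h 1 = 1" by (simp add: msubst_def)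
  have add: "msubst f h (p + q) = msubst f h p + msubst f h q" for p q
    unfolding msubst_def by (rule setsum_keys_plus_distrib) (auto simp: h.hom_add algebra_simps)
  have zero: "msubst f h 0 = 0" by (simp add: msubst_def)
  have sum2: "msubst f h (sum g A) = (\<Sum>a\<in>A. msubst f h (g a))"
    for g and A :: "('b \<Rightarrow>\<^sub>0 nat) set"
    by (induction A rule: infinite_finite_induct) (auto simp: add zero)
  have mult: "msubst f h (p * q) = msubst f h p * msubst f h q" for p q
  proof -
    let ?s = "\<lambda>p \<alpha>. Poly_Mapping.single \<alpha> (Poly_Mapping.lookup p \<alpha>) :: 'b mpoly"
    have "p * q = (\<Sum>\<alpha>\<in>Poly_Mapping.keys p. \<Sum>\<beta>\<in>Poly_Mapping.keys q. ?s p \<alpha> * ?s q \<beta>)"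
      by (subst poly_mapping_sum_single[of p], subst poly_mapping_sum_single[of q]) (simp add: sum_product)
    also have "msubst f h \<dots> = (\<Sum>\<alpha>\<in>Poly_Mapping.keys p. \<Sum>\<beta>\<in>Poly_Mapping.keys q.
        msubst f h (?s p \<alpha>) * msubst f h (?s q \<beta>))"
      by (simp add: sum2 mult_single msubst_single h.hom_mult monom_eval_add algebra_simps)
    also have "\<dots> = msubst f h p * msubst f h q"
      by (simp add: sum_product msubst_single) (simp add: msubst_def sum_product)
    finally show ?thesis .
  qed
  show ?thesis
    by unfold_locales (simp_all add: add mult zero one)
qed

lemma msubst_mConst: "h 0 = 0 \<Longrightarrow> msubst f h (mConst c) = h c"
  by (simp add: mConst_def msubst_single)

lemma msubst_mVar:
  assumes "comm_ring_hom h"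
  shows "msubst f h (mVar v) = f v"
proof -
  interpret h: comm_ring_hom h by fact
  show ?thesis by (simp add: mVar_def msubst_single)
qed

text \<open>Composites collapse to a single substitution; together with \<open>msubst_id\<close>
  this recovers a polynomial from its transformed versions.\<close>

lemma hom_msubst:
  assumes "comm_ring_hom g"
  shows "g (msubst f h p) = msubst (\<lambda>v. g (f v)) (\<lambda>c. g (h c)) p"
proof -
  interpret g: comm_ring_hom g by fact
  show ?thesis by (simp add: msubst_def hom_distribs g.hom_monom_eval)
qed

lemma monom_eval_mVar: "monom_eval mVar \<alpha> = Poly_Mapping.single \<alpha> 1"
proof -
  have pw: "(mVar v :: 'a mpoly) ^ e = Poly_Mapping.single (Poly_Mapping.single v e) 1" for v e
    by (induction e) (auto simp: mVar_def mult_single simp flip: single_add)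
  have "(\<Prod>v\<in>A. (mVar v :: 'a mpoly) ^ Poly_Mapping.lookup \<alpha> v) =
      Poly_Mapping.single (\<Sum>v\<in>A. Poly_Mapping.single v (Poly_Mapping.lookup \<alpha> v)) 1" for A
    by (induction A rule: infinite_finite_induct) (auto simp: pw mult_single)
  then show ?thesis
    using poly_mapping_sum_single[of \<alpha>] by (simp add: monom_eval_def)
qed

lemma msubst_id: "msubst mVar mConst p = p"
  by (subst (2) poly_mapping_sum_single[of p])
    (simp add: msubst_def monom_eval_mVar mConst_def mult_single)

lemma meval_msubst: "meval x = msubst x (\<lambda>c. c)"
  by (rule ext) (simp add: meval_def msubst_def mcoeff_def monom_eval_def)

lemma comm_ring_hom_meval: "comm_ring_hom (meval x)"
  unfolding meval_msubst by (rule msubst_hom, unfold_locales) auto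

interpretation meval: comm_ring_hom "meval x" for x
  by (rule comm_ring_hom_meval)

lemma meval_mVar [simp]: "meval x (mVar v) = x v"
  unfolding meval_msubst by (rule msubst_mVar, unfold_locales) auto

lemma meval_mConst [simp]: "meval x (mConst c) = c"
  by (simp add: meval_msubst msubst_mConst)

lemma msubst_cong:
  assumes "\<And>v. v \<in> mvars p \<Longrightarrow> f v = g v"
  shows "msubst f h p = msubst g h p"
proof -
  have "monom_eval f \<alpha> = monom_eval g \<alpha>" if "\<alpha> \<in> Poly_Mapping.keys p" for \<alpha>
  proof -
    have "v \<in> mvars p" if "v \<in> Poly_Mapping.keys \<alpha>" for v
      using that \<open>\<alpha> \<in> _\<close> by (auto simp: mvars_def)
    then show ?thesis by (auto simp: monom_eval_def assms intro!: prod.cong)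
  qed
  then show ?thesis unfolding msubst_def by simp
qed

lemma meval_cong: "(\<And>v. v \<in> mvars p \<Longrightarrow> x v = y v) \<Longrightarrow> meval x p = meval y p"
  unfolding meval_msubst by (rule msubst_cong)

section \<open>Polynomials in a prescribed set of variables, and their view as polynomials in one
  variable\<close>

lemma finite_mvars [simp]: "finite (mvars p)"
  by (simp add: mvars_def)

text \<open>The type has a variable for every element of \<open>'v\<close>, so inductions on the
  number of variables run over the set \<open>W\<close>.\<close>

definition mpolys :: "'v set \<Rightarrow> 'v mpoly set" where
  "mpolys W = {p. mvars p \<subseteq> W}"

lemma mpolys_mono: "V \<subseteq> W \<Longrightarrow> mpolys V \<subseteq> mpolys W"
  by (auto simp: mpolys_def)

lemma mpolys_const [simp]: "mConst c \<in> mpolys W"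
  by (auto simp: mpolys_def mvars_def mConst_def)

lemma mpolys_mVar [simp]: "v \<in> W \<Longrightarrow> mVar v \<in> mpolys W"
  by (auto simp: mpolys_def mvars_def mVar_def)

lemma mConst_0 [simp]: "mConst 0 = 0" by (simp add: mConst_def)
lemma mConst_1 [simp]: "mConst 1 = 1" by (simp add: mConst_def)

lemma mpolys_0 [simp]: "0 \<in> mpolys W" using mpolys_const[of 0] by simp
lemma mpolys_1 [simp]: "1 \<in> mpolys W" using mpolys_const[of 1] by simp

lemma mpolys_add: "p \<in> mpolys W \<Longrightarrow> q \<in> mpolys W \<Longrightarrow> p + q \<in> mpolys W"
  using Poly_Mapping.keys_add[of p q] unfolding mpolys_def mvars_def by blast

lemma mpolys_mult: "p \<in> mpolys W \<Longrightarrow> q \<in> mpolys W \<Longrightarrow> p * q \<in> mpolys W"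
proof -
  assume *: "p \<in> mpolys W" "q \<in> mpolys W"
  show ?thesis unfolding mpolys_def mvars_def
  proof (safe)
    fix v \<alpha> assume "\<alpha> \<in> Poly_Mapping.keys (p * q)" and v: "v \<in> Poly_Mapping.keys \<alpha>"
    then obtain a b where "\<alpha> = a + b" "a \<in> Poly_Mapping.keys p" "b \<in> Poly_Mapping.keys q"
      using Poly_Mapping.keys_mult[of p q] by auto
    with v Poly_Mapping.keys_add[of a b] * show "v \<in> W"
      unfolding mpolys_def mvars_def by blast
  qed
qed

lemma mConst_uminus: "mConst (- c) = - mConst c"
  by (simp add: mConst_def single_uminus)

lemma mpolys_uminus: "p \<in> mpolys W \<Longrightarrow> - p \<in> mpolys W"
  using mpolys_mult[OF mpolys_const[of "-1"], of p W] by (simp add: mConst_uminus)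

lemma mpolys_minus: "p \<in> mpolys W \<Longrightarrow> q \<in> mpolys W \<Longrightarrow> p - q \<in> mpolys W"
  unfolding diff_conv_add_uminus by (intro mpolys_add mpolys_uminus)

lemma mpolys_sum: "(\<And>a. a \<in> A \<Longrightarrow> f a \<in> mpolys W) \<Longrightarrow> sum f A \<in> mpolys W"
  by (induction A rule: infinite_finite_induct) (auto intro: mpolys_add)

lemma mpolys_prod: "(\<And>a. a \<in> A \<Longrightarrow> f a \<in> mpolys W) \<Longrightarrow> prod f A \<in> mpolys W"
  by (induction A rule: infinite_finite_induct) (auto intro: mpolys_mult)

lemma mpolys_power: "p \<in> mpolys W \<Longrightarrow> p ^ n \<in> mpolys W"
  by (induction n) (auto intro: mpolys_mult)


lemma mpolys_empty: "p \<in> mpolys {} \<Longrightarrow> \<exists>c. p = mConst c"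
proof -
  assume "p \<in> mpolys {}"
  then have "msubst mVar mConst p = msubst (\<lambda>_. 0) mConst p"
    by (intro msubst_cong) (auto simp: mpolys_def)
  then have "p = msubst (\<lambda>v. mConst 0) (\<lambda>c. mConst c) p"
    by (simp add: msubst_id)
  also have "\<dots> = mConst (msubst (\<lambda>v. 0) (\<lambda>c. c) p)"
    by (subst hom_msubst[OF comm_ring_hom_mConst]) simp
  finally show ?thesis by blast
qed

text \<open>The coefficients keep the type of polynomials in all variables; that they no longer
  contain \<open>t\<close> is the content of \<open>coeff_to_poly_in_mpolys\<close>. Setting the
  outer variable to \<open>mVar t\<close> gives \<open>p\<close> back, so the map is
  injective.\<close>

definition to_poly :: "'v \<Rightarrow> 'v mpoly \<Rightarrow> 'v mpoly poly" where
  "to_poly t = msubst (\<lambda>v. if v = t then [:0, 1:] else [:mVar v:]) (\<lambda>c. [:mConst c:])"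

lemma comm_ring_hom_const_mConst: "comm_ring_hom (\<lambda>c. [:mConst c:])"
  by (rule comm_ring_hom_comp[OF comm_ring_hom_const_poly comm_ring_hom_mConst])

interpretation to_poly: comm_ring_hom "to_poly t" for t
  unfolding to_poly_def by (rule msubst_hom[OF comm_ring_hom_const_mConst])

lemma poly_to_poly: "poly (to_poly t p) (mVar t) = p"
proof -
  have "poly (to_poly t p) (mVar t) = msubst mVar mConst p"
    unfolding to_poly_def
    by (subst hom_msubst[OF comm_ring_hom_poly]) (auto intro!: arg_cong[where f = "\<lambda>f. msubst f mConst p"])
  then show ?thesis by (simp add: msubst_id)
qed

lemma to_poly_eq_0_iff [simp]: "to_poly t p = 0 \<longleftrightarrow> p = 0"
  by (metis poly_to_poly poly_0 to_poly.hom_zero)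

lemma to_poly_free:
  assumes "t \<notin> mvars p"
  shows "to_poly t p = [:p:]"
proof -
  have "to_poly t p = msubst (\<lambda>v. [:mVar v:]) (\<lambda>c. [:mConst c:]) p"
    unfolding to_poly_def by (rule msubst_cong) (use assms in auto)
  also have "\<dots> = [:msubst mVar mConst p:]"
    by (subst hom_msubst[OF comm_ring_hom_const_poly]) simp
  finally show ?thesis by (simp add: msubst_id)
qed

lemma to_poly_mVar [simp]: "to_poly t (mVar t) = [:0, 1:]"
  unfolding to_poly_def by (simp add: msubst_mVar[OF comm_ring_hom_const_mConst])

lemma coeff_to_poly_in_mpolys:
  assumes "p \<in> mpolys W"
  shows "coeff (to_poly t p) i \<in> mpolys (W - {t})"
proof -
  \<comment> \<open>\<open>S\<close> is closed under products and contains the images of the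
    constants and of all variables in \<open>W\<close>, hence every term of
    \<open>to_poly t p\<close>.\<close>
  define S where "S = {q. \<forall>i. coeff q i \<in> mpolys (W - {t})}"
  have S_mult: "a * b \<in> S" if "a \<in> S" "b \<in> S" for a b
    using that by (auto simp: S_def coeff_mult intro!: mpolys_sum mpolys_mult)
  have S_const: "[:c:] \<in> S" if "c \<in> mpolys (W - {t})" for c
    using that by (auto simp: S_def coeff_pCons split: nat.splits)
  have "[:0, 1:] \<in> S"
    by (auto simp: S_def coeff_pCons split: nat.splits)
  have S_power: "a ^ e \<in> S" if "a \<in> S" for a e
    using S_const[of 1] that by (induction e) (auto intro: S_mult simp: one_pCons)
  have pw: "(if v = t then [:0, 1:] else [:mVar v:]) ^ e \<in> S" if "v \<in> W" for v e
    using that \<open>[:0, 1:] \<in> S\<close> by (auto intro!: S_power S_const)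
  have "monom_eval (\<lambda>v. if v = t then [:0, 1:] else [:mVar v:]) \<alpha> \<in> S"
    if "\<alpha> \<in> Poly_Mapping.keys p" for \<alpha>
  proof -
    have "(\<Prod>v\<in>A. (if v = t then [:0, 1:] else [:mVar v:]) ^ e v) \<in> S" if "A \<subseteq> W" for A e
      using that
    proof (induction A rule: infinite_finite_induct)
      case (insert x A)
      then show ?case using S_mult[OF pw[of x] insert.IH] by simp
    qed (use S_const[of 1] in \<open>auto simp: one_pCons\<close>)
    moreover have "Poly_Mapping.keys \<alpha> \<subseteq> W"
      using assms that by (auto simp: mpolys_def mvars_def)
    ultimately show ?thesis by (simp add: monom_eval_def)
  qed
  then have "[:mConst (Poly_Mapping.lookup p \<alpha>):] *
      monom_eval (\<lambda>v. if v = t then [:0, 1:] else [:mVar v:]) \<alpha> \<in> S"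
    if "\<alpha> \<in> Poly_Mapping.keys p" for \<alpha>
    using that by (intro S_mult S_const) auto
  then have "to_poly t p \<in> S"
    unfolding to_poly_def msubst_def S_def by (auto simp: coeff_sum intro!: mpolys_sum)
  then show ?thesis by (simp add: S_def)
qed

text \<open>Induction on the variables: at a point where some coefficient with respect to
  \<open>t\<close> is nonzero, a nonzero univariate polynomial remains, and it has a
  non-root.\<close>

lemma meval_nonzero_witness:
  assumes "p \<noteq> 0"
  shows "\<exists>x. meval x p \<noteq> 0"
proof -
  have "\<forall>p \<in> mpolys W. p \<noteq> 0 \<longrightarrow> (\<exists>x. meval x p \<noteq> 0)" if "finite W" for W :: "'a set"
    using that
  proof (induction W)
    case empty
    then show ?case
    proof (intro ballI impI)
      fix p :: "'a mpoly" assume "p \<in> mpolys {}" "p \<noteq> 0"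
      with mpolys_empty obtain c where "p = mConst c" "c \<noteq> 0" by fastforce
      then show "\<exists>x. meval x p \<noteq> 0" by simp
    qed
  next
    case (insert t W)
    show ?case
    proof (intro ballI impI)
      fix p :: "'a mpoly" assume p: "p \<in> mpolys (insert t W)" "p \<noteq> 0"
      define q where "q = to_poly t p"
      have cW: "coeff q i \<in> mpolys W" for i
        using coeff_to_poly_in_mpolys[OF p(1), of t i] insert.hyps by (simp add: q_def)
      from p have "q \<noteq> 0" by (simp add: q_def)
      then obtain i where "coeff q i \<noteq> 0" by (metis leading_coeff_0_iff)
      with insert.IH cW obtain x where x: "meval x (coeff q i) \<noteq> 0" by blast
      have "map_poly (meval x) q \<noteq> 0"
        using x by (metis coeff_0 coeff_map_poly meval.hom_zero)
      then obtain z where z: "poly (map_poly (meval x) q) z \<noteq> 0"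
        using poly_all_0_iff_0 by blast
      have eq: "meval (x(t := z)) (coeff q i) = meval x (coeff q i)" for i
        by (rule meval_cong) (use cW[of i] insert.hyps in \<open>auto simp: mpolys_def\<close>)
      have "meval (x(t := z)) p = meval (x(t := z)) (poly q (mVar t))"
        by (simp add: q_def poly_to_poly)
      also have "\<dots> = (\<Sum>i\<le>degree q. meval x (coeff q i) * z ^ i)"
        by (simp add: poly_altdef meval.hom_sum meval.hom_mult meval.hom_power eq)
      \<comment> \<open>Evaluating the coefficients may lower the degree, so the ranges of the two
        sums differ.\<close>
      also have "\<dots> = poly (map_poly (meval x) q) z"
        unfolding poly_altdef
      proof (rule sum.mono_neutral_cong_right)
        show "\<forall>i\<in>{..degree q} - {..degree (map_poly (meval x) q)}. meval x (coeff q i) * z ^ i = 0"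
        proof
          fix i assume "i \<in> {..degree q} - {..degree (map_poly (meval x) q)}"
          then have "coeff (map_poly (meval x) q) i = 0" by (simp add: coeff_eq_0)
          then show "meval x (coeff q i) * z ^ i = 0" by (simp add: coeff_map_poly)
        qed
      qed (use map_poly_degree_leq[of "meval x" q] in \<open>auto simp: coeff_map_poly\<close>)
      finally show "\<exists>x. meval x p \<noteq> 0" using z by metis
    qed
  qed
  from this[OF finite_mvars[of p]] assms show ?thesis by (auto simp: mpolys_def)
qed

text \<open>Restriction to the line \<open>u + s w\<close>. It reduces the absence of zero divisors
  to one variable, and it shows that the determinant of \<open>z I - T\<close> is a polynomial in
  \<open>z\<close>.\<close>

definition line_poly :: "('v \<Rightarrow> complex) \<Rightarrow> ('v \<Rightarrow> complex) \<Rightarrow> 'v mpoly \<Rightarrow> complex poly" where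
  "line_poly u w = msubst (\<lambda>v. [:u v, w v:]) (\<lambda>c. [:c:])"

interpretation line_poly: comm_ring_hom "line_poly u w" for u w
  unfolding line_poly_def by (rule msubst_hom[OF comm_ring_hom_const_poly])

lemma poly_line_poly: "poly (line_poly u w p) s = meval (\<lambda>v. u v + s * w v) p"
  unfolding line_poly_def meval_msubst
  by (subst hom_msubst[OF comm_ring_hom_poly]) simp

text \<open>Join a non-zero of \<open>p\<close> to a non-zero of \<open>q\<close> by a line.
  Restricted to it, both are nonzero univariate polynomials, and so is their product.\<close>

lemma mpoly_mult_eq_0_iff [simp]: "(p::'v mpoly) * q = 0 \<longleftrightarrow> p = 0 \<or> q = 0"
proof
  assume pq: "p * q = 0"
  show "p = 0 \<or> q = 0"
  proof (rule ccontr)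
    assume "\<not> (p = 0 \<or> q = 0)"
    then obtain x y where x: "meval x p \<noteq> 0" and y: "meval y q \<noteq> 0"
      using meval_nonzero_witness by blast
    let ?h = "line_poly x (\<lambda>v. y v - x v)"
    from x have "poly (?h p) 0 \<noteq> 0" by (simp add: poly_line_poly)
    moreover from y have "poly (?h q) 1 \<noteq> 0" by (simp add: poly_line_poly)
    ultimately have "?h p * ?h q \<noteq> 0" by force
    then show False using pq by (metis line_poly.hom_mult line_poly.hom_zero)
  qed
qed auto

lemma mpoly_mult_left_cancel: "a \<noteq> 0 \<Longrightarrow> a * b = a * c \<longleftrightarrow> b = (c::'v mpoly)"
  using mpoly_mult_eq_0_iff[of a "b - c"] by (simp add: algebra_simps)

section \<open>Additivity of degrees, units and factors\<close>

lemma degree_mult_mpoly: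
  fixes P Q :: "'v mpoly poly"
  assumes "P \<noteq> 0" "Q \<noteq> 0"
  shows "degree (P * Q) = degree P + degree Q"
proof (rule antisym)
  show "degree (P * Q) \<le> degree P + degree Q" by (rule degree_mult_le)
  have "coeff (P * Q) (degree P + degree Q) \<noteq> 0"
    by (simp add: coeff_mult_degree_sum assms)
  then show "degree P + degree Q \<le> degree (P * Q)" by (rule le_degree)
qed

text \<open>\<open>vdeg t 0\<close> is 0, so zero remainders have to be listed separately
  below.\<close>

definition vdeg :: "'v \<Rightarrow> 'v mpoly \<Rightarrow> nat" where
  "vdeg t p = degree (to_poly t p)"

text \<open>The total degree is the degree in a new variable s after substituting s x_v for each x_v.\<close>

definition tdeg :: "'v mpoly \<Rightarrow> nat" where
  "tdeg p = degree (msubst (\<lambda>v. [:0, mVar v:]) (\<lambda>c. [:mConst c:]) p)"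

lemma vdeg_mult: "p \<noteq> 0 \<Longrightarrow> q \<noteq> 0 \<Longrightarrow> vdeg t (p * q) = vdeg t p + vdeg t q"
  by (simp add: vdeg_def to_poly.hom_mult degree_mult_mpoly)

lemma vdeg_0_iff: "vdeg t p = 0 \<longleftrightarrow> t \<notin> mvars p"
proof
  assume "vdeg t p = 0"
  then obtain q where q: "to_poly t p = [:q:]" unfolding vdeg_def by (auto elim: degree_eq_zeroE)
  then have "q \<in> mpolys (mvars p - {t})"
    using coeff_to_poly_in_mpolys[of p "mvars p" t 0] by (simp add: mpolys_def)
  moreover have "p = q" using poly_to_poly[of t p] q by simp
  ultimately show "t \<notin> mvars p" by (auto simp: mpolys_def)
qed (simp add: vdeg_def to_poly_free)

lemma homogenize_neq_0:
  assumes "p \<noteq> 0"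
  shows "msubst (\<lambda>v. [:0, mVar v:]) (\<lambda>c. [:mConst c:]) p \<noteq> 0" (is "?h p \<noteq> 0")
proof -
  have "poly (?h p) 1 = p"
    by (subst hom_msubst[OF comm_ring_hom_poly]) (simp add: msubst_id)
  with assms show ?thesis by force
qed

lemma tdeg_mult: "p \<noteq> 0 \<Longrightarrow> q \<noteq> 0 \<Longrightarrow> tdeg (p * q) = tdeg p + tdeg q"
proof -
  interpret h: comm_ring_hom "msubst (\<lambda>v. [:0, mVar v:]) (\<lambda>c. [:mConst c:])"
    by (rule msubst_hom[OF comm_ring_hom_const_mConst])
  show "p \<noteq> 0 \<Longrightarrow> q \<noteq> 0 \<Longrightarrow> tdeg (p * q) = tdeg p + tdeg q"
    by (simp add: tdeg_def h.hom_mult degree_mult_mpoly homogenize_neq_0)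
qed

text \<open>A polynomial constant in s takes the same value at s = 1, which is \<open>p\<close>, and
  at s = 0, which is the constant term of \<open>p\<close>.\<close>

lemma tdeg_0:
  assumes "tdeg p = 0"
  shows "\<exists>c. p = mConst c"
proof -
  let ?h = "msubst (\<lambda>v. [:0, mVar v:]) (\<lambda>c. [:mConst c:]) p"
  have "poly ?h 1 = p"
    by (subst hom_msubst[OF comm_ring_hom_poly]) (simp add: msubst_id)
  moreover have "poly ?h 0 = mConst (msubst (\<lambda>v. 0) (\<lambda>c. c) p)"
    by (subst hom_msubst[OF comm_ring_hom_poly], subst hom_msubst[OF comm_ring_hom_mConst]) simp
  moreover obtain q where "?h = [:q:]"
    using assms by (auto simp: tdeg_def elim: degree_eq_zeroE)
  ultimately show ?thesis by auto
qed

lemma mConst_dvd_1: "c \<noteq> 0 \<Longrightarrow> mConst c dvd (1 :: 'v mpoly)"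
proof
  assume "c \<noteq> 0"
  then show "(1 :: 'v mpoly) = mConst c * mConst (1 / c)"
    by (simp add: mConst_def mult_single)
qed

lemma mConst_eq_0_iff [simp]: "mConst c = 0 \<longleftrightarrow> c = 0"
  by (metis mConst_0 meval_mConst)

lemma tdeg_mConst [simp]: "tdeg (mConst c) = 0"
  by (simp add: tdeg_def msubst_mConst)

lemma mpoly_dvd_1_iff: "p dvd 1 \<longleftrightarrow> p \<noteq> 0 \<and> tdeg p = 0"
proof
  assume "p dvd 1"
  then obtain q where q: "p * q = 1" by (metis dvdE)
  then have "p \<noteq> 0" "q \<noteq> 0" by auto
  then show "p \<noteq> 0 \<and> tdeg p = 0"
    using tdeg_mult[of p q] tdeg_mConst[of 1] q by (metis add_is_0 mConst_1)
next
  assume "p \<noteq> 0 \<and> tdeg p = 0"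
  then show "p dvd 1" using tdeg_0[of p] mConst_dvd_1 by auto
qed

text \<open>Degrees in each single variable add up, so no variable of a factor can disappear from a
  nonzero product.\<close>

lemma mpolys_factor:
  assumes "a * b \<in> mpolys W" "a * b \<noteq> 0"
  shows "a \<in> mpolys W"
proof -
  have "t \<notin> mvars a" if "t \<notin> W" for t
  proof -
    have "vdeg t (a * b) = 0" using that assms by (auto simp: vdeg_0_iff mpolys_def)
    then show ?thesis using assms by (simp add: vdeg_mult flip: vdeg_0_iff)
  qed
  then show ?thesis by (auto simp: mpolys_def)
qed

section \<open>Gauss's lemma: irreducible polynomials are prime\<close>

text \<open>Divisibility refers to the whole ring and only the factors are confined to
  \<open>W\<close>, so that variables can be added one at a time.\<close>

definition prime_on :: "'v set \<Rightarrow> 'v mpoly \<Rightarrow> bool" where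
  "prime_on W p \<longleftrightarrow> (\<forall>f\<in>mpolys W. \<forall>g\<in>mpolys W. p dvd f * g \<longrightarrow> p dvd f \<or> p dvd g)"

lemma mpolys_diff_iff: "p \<in> mpolys (W - {t}) \<longleftrightarrow> p \<in> mpolys W \<and> vdeg t p = 0"
  by (auto simp: mpolys_def vdeg_0_iff)

lemma dvd_iff_dvd_coeffs:
  assumes "t \<notin> mvars d"
  shows "d dvd f \<longleftrightarrow> (\<forall>i. d dvd coeff (to_poly t f) i)"
proof
  assume "d dvd f"
  then obtain h where "f = d * h" by auto
  then have "to_poly t f = [:d:] * to_poly t h"
    by (simp add: to_poly.hom_mult to_poly_free assms)
  then show "\<forall>i. d dvd coeff (to_poly t f) i" by simp
next
  assume *: "\<forall>i. d dvd coeff (to_poly t f) i"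
  have "f = (\<Sum>i\<le>degree (to_poly t f). coeff (to_poly t f) i * mVar t ^ i)"
    by (metis poly_to_poly poly_altdef)
  with * show "d dvd f" by (metis (no_types, lifting) dvd_mult2 dvd_sum)
qed

text \<open>Gauss's argument on contents: let \<open>i\<close> and \<open>j\<close> be the first
  indices at which the coefficients of \<open>f\<close> and \<open>g\<close> are not divisible by
  \<open>p\<close>. In the coefficient of index \<open>i + j\<close> of the product, every other
  term is divisible by \<open>p\<close>.\<close>

lemma prime_on_extend:
  assumes "prime_on (W - {t}) p" "p \<in> mpolys (W - {t})"
  shows "prime_on W p"
  unfolding prime_on_def
proof (intro ballI impI, rule ccontr)
  fix f g assume fg: "f \<in> mpolys W" "g \<in> mpolys W" "p dvd f * g" and n: "\<not> (p dvd f \<or> p dvd g)"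
  let ?F = "coeff (to_poly t f)" and ?G = "coeff (to_poly t g)"
  have t: "t \<notin> mvars p" using assms by (auto simp: mpolys_def)
  from n have "\<exists>i. \<not> p dvd ?F i" "\<exists>j. \<not> p dvd ?G j"
    using dvd_iff_dvd_coeffs[OF t] by blast+
  define i where "i = (LEAST i. \<not> p dvd ?F i)"
  define j where "j = (LEAST j. \<not> p dvd ?G j)"
  have i: "\<not> p dvd ?F i" "\<And>k. k < i \<Longrightarrow> p dvd ?F k"
    unfolding i_def using LeastI_ex[OF \<open>\<exists>i. \<not> p dvd ?F i\<close>] not_less_Least by blast+
  have j: "\<not> p dvd ?G j" "\<And>k. k < j \<Longrightarrow> p dvd ?G k"
    unfolding j_def using LeastI_ex[OF \<open>\<exists>i. \<not> p dvd ?G i\<close>] not_less_Least by blast+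
  have "p dvd (\<Sum>k\<le>i + j. ?F k * ?G (i + j - k))"
    using iffD1[OF dvd_iff_dvd_coeffs[OF t] fg(3)] by (simp add: to_poly.hom_mult coeff_mult)
  also have "(\<Sum>k\<le>i + j. ?F k * ?G (i + j - k)) =
      ?F i * ?G j + (\<Sum>k\<in>{..i + j} - {i}. ?F k * ?G (i + j - k))"
    by (subst sum.remove[of _ i]) auto
  finally have "p dvd ?F i * ?G j + (\<Sum>k\<in>{..i + j} - {i}. ?F k * ?G (i + j - k))" .
  moreover have "p dvd (\<Sum>k\<in>{..i + j} - {i}. ?F k * ?G (i + j - k))"
  proof (rule dvd_sum)
    fix k assume "k \<in> {..i + j} - {i}"
    then consider "k < i" | "i + j - k < j" by fastforce
    then show "p dvd ?F k * ?G (i + j - k)"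
      by cases (use i j in auto)
  qed
  ultimately have "p dvd ?F i * ?G j"
    by (simp only: dvd_add_left_iff)
  moreover have "?F i \<in> mpolys (W - {t})" "?G j \<in> mpolys (W - {t})"
    using fg by (auto intro: coeff_to_poly_in_mpolys)
  ultimately show False using assms(1) i j by (auto simp: prime_on_def)
qed

text \<open>Units are exactly the nonzero constants, so both factors of a proper factorization have
  smaller total degree.\<close>

lemma irreducible_factor_exists:
  "p \<noteq> 0 \<Longrightarrow> tdeg p > 0 \<Longrightarrow> \<exists>q. irreducible (q :: 'v mpoly) \<and> q dvd p"
proof (induction "tdeg p" arbitrary: p rule: less_induct)
  case less
  show ?case
  proof (cases "irreducible p")
    case False
    then obtain x y where xy: "p = x * y" "\<not> x dvd 1" "\<not> y dvd 1"
      using less.prems by (auto simp: irreducible_def mpoly_dvd_1_iff)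
    then have "x \<noteq> 0" "y \<noteq> 0" using less.prems by auto
    then have "tdeg x < tdeg p" "tdeg x > 0"
      using xy by (auto simp: tdeg_mult mpoly_dvd_1_iff)
    then obtain q where "irreducible q" "q dvd x" using less.hyps \<open>x \<noteq> 0\<close> by blast
    then show ?thesis using xy by auto
  qed auto
qed

text \<open>Replaces the passage to the fraction field of the coefficients. The denominator
  \<open>b\<close> is cancelled one irreducible factor at a time: each is free of \<open>t\<close>,
  hence prime on \<open>W\<close> by \<open>IH\<close> and \<open>prime_on_extend\<close>, and so
  divides \<open>u\<close> or \<open>f\<close>. The cancelled factors are collected in
  \<open>b1\<close> and \<open>b2\<close>.\<close>

lemma split_factor:
  assumes IH: "\<And>q. irreducible q \<Longrightarrow> q \<in> mpolys (W - {t}) \<Longrightarrow> prime_on (W - {t}) q"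
  assumes "b \<in> mpolys (W - {t})" "b \<noteq> 0" "u \<in> mpolys W" "f \<in> mpolys W" "b * p = u * f"
  shows "\<exists>b1\<in>mpolys (W - {t}). \<exists>b2\<in>mpolys (W - {t}). \<exists>u' f'. u = b1 * u' \<and> f = b2 * f' \<and> p = u' * f'"
  using assms(2-)
proof (induction "tdeg b" arbitrary: b u f rule: less_induct)
  case less
  show ?case
  proof (cases "tdeg b = 0")
    case True
    then obtain b' where b': "1 = b * b'" using less.prems mpoly_dvd_1_iff[of b] by auto
    have "u = b * (b' * u)" by (simp add: b'[symmetric] flip: mult.assoc)
    moreover have "p = (b' * u) * f"
    proof -
      have "p = (b * b') * p" by (simp flip: b')
      also have "\<dots> = b' * (b * p)" by (simp only: mult_ac)
      finally show ?thesis by (simp only: less.prems(5) mult.assoc)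
    qed
    ultimately show ?thesis using less.prems(1)
      by (intro bexI[of _ b] bexI[of _ 1] exI[of _ "b' * u"] exI[of _ f]) auto
  next
    case False
    then obtain q where q: "irreducible q" "q dvd b"
      using irreducible_factor_exists[of b] less.prems by auto
    then obtain c where c: "b = q * c" by auto
    have "c \<noteq> 0" "q \<noteq> 0" using c less.prems by auto
    have mem: "q \<in> mpolys (W - {t})" "c \<in> mpolys (W - {t})"
      using mpolys_factor[of q c] mpolys_factor[of c q] c less.prems by (auto simp: mult.commute)
    have "tdeg c < tdeg b"
      using q \<open>c \<noteq> 0\<close> \<open>q \<noteq> 0\<close> by (auto simp: c tdeg_mult irreducible_def mpoly_dvd_1_iff)
    note IH' = less.hyps[OF this mem(2) \<open>c \<noteq> 0\<close>]
    have "prime_on W q" by (rule prime_on_extend[OF IH[OF q(1) mem(1)] mem(1)])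
    moreover have "q dvd u * f" using less.prems(5) c by (metis dvd_triv_left mult.assoc)
    ultimately consider "q dvd u" | "q dvd f" using less.prems by (auto simp: prime_on_def)
    then show ?thesis
    proof cases
      case 1
      then obtain u1 where u1: "u = q * u1" by auto
      have "q * (c * p) = q * (u1 * f)"
        using less.prems(5) unfolding c u1 by (simp only: mult.assoc)
      then have eq: "c * p = u1 * f" by (simp only: mpoly_mult_left_cancel[OF \<open>q \<noteq> 0\<close>])
      have "u1 \<in> mpolys W"
      proof (cases "u = 0")
        case True then show ?thesis using u1 \<open>q \<noteq> 0\<close> by auto
      next
        case False then show ?thesis using mpolys_factor[of u1 q W] less.prems u1 by (simp add: mult.commute)
      qed
      from IH'[OF this less.prems(4) eq] obtain b1 b2 u' f' where
        "b1 \<in> mpolys (W - {t})" "b2 \<in> mpolys (W - {t})" "u1 = b1 * u'" "f = b2 * f'" "p = u' * f'"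
        by blast
      moreover have "u = (q * b1) * u'" by (simp only: u1 \<open>u1 = b1 * u'\<close> mult.assoc)
      moreover have "q * b1 \<in> mpolys (W - {t})" by (rule mpolys_mult) fact+
      ultimately show ?thesis by blast
    next
      case 2
      then obtain f1 where f1: "f = q * f1" by auto
      have "q * (c * p) = q * (u * f1)"
        using less.prems(5) unfolding c f1 by (simp only: mult_ac)
      then have eq: "c * p = u * f1" by (simp only: mpoly_mult_left_cancel[OF \<open>q \<noteq> 0\<close>])
      have "f1 \<in> mpolys W"
      proof (cases "f = 0")
        case True then show ?thesis using f1 \<open>q \<noteq> 0\<close> by auto
      next
        case False then show ?thesis using mpolys_factor[of f1 q W] less.prems f1 by (simp add: mult.commute)
      qed
      from IH'[OF less.prems(3) this eq] obtain b1 b2 u' f' where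
        "b1 \<in> mpolys (W - {t})" "b2 \<in> mpolys (W - {t})" "u = b1 * u'" "f1 = b2 * f'" "p = u' * f'"
        by blast
      moreover have "f = (q * b2) * f'" by (simp only: f1 \<open>f1 = b2 * f'\<close> mult.assoc)
      moreover have "q * b2 \<in> mpolys (W - {t})" by (rule mpolys_mult) fact+
      ultimately show ?thesis by blast
    qed
  qed
qed

lemma unit_vdeg: "p dvd 1 \<Longrightarrow> vdeg t p = 0"
proof -
  assume "p dvd 1"
  then obtain c where "p = mConst c" using tdeg_0 by (auto simp: mpoly_dvd_1_iff)
  then show ?thesis using mpolys_const[of c "{}"] by (auto simp: vdeg_0_iff mpolys_def)
qed

text \<open>Cancelling \<open>a\<close> splits \<open>p\<close> as \<open>b1 * p'\<close> with
  \<open>b1\<close> free of \<open>t\<close> and \<open>p'\<close> dividing \<open>h\<close>. As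
  \<open>p'\<close> carries the whole degree in \<open>t\<close>, it is no unit; so
  \<open>b1\<close> is one.\<close>

lemma cancel_free_factor:
  assumes IH: "\<And>q. irreducible q \<Longrightarrow> q \<in> mpolys (W - {t}) \<Longrightarrow> prime_on (W - {t}) q"
  assumes "a \<in> mpolys (W - {t})" "a \<noteq> 0" "p \<in> mpolys W" "w \<in> mpolys W" "a * h = p * w"
    and p: "irreducible p" "vdeg t p > 0"
  shows "p dvd h"
proof -
  obtain b1 b2 p' w' where *: "b1 \<in> mpolys (W - {t})" "p = b1 * p'" "h = p' * w'"
    using split_factor[OF IH assms(2-6)] by blast
  have "p \<noteq> 0" using p by (auto simp: irreducible_def)
  then have "vdeg t p' > 0" using p(2) * by (auto simp: vdeg_mult mpolys_diff_iff)
  then have "\<not> p' dvd 1" using unit_vdeg[of p' t] by auto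
  then have "b1 dvd 1" using p * by (auto simp: irreducible_def)
  then have "p dvd p'" using * by (simp add: mult_unit_dvd_iff')
  then show ?thesis using * by simp
qed

text \<open>Division with remainder in \<open>t\<close> with the denominators cleared; the
  multiplier \<open>a\<close> is built as a power of the leading coefficient of
  \<open>p\<close>.\<close>

lemma pseudo_division:
  assumes "p \<in> mpolys W" "p \<noteq> 0" "f \<in> mpolys W"
  shows "\<exists>a\<in>mpolys (W - {t}). \<exists>q\<in>mpolys W. \<exists>r\<in>mpolys W.
    a \<noteq> 0 \<and> a * f = q * p + r \<and> (r = 0 \<or> vdeg t r < vdeg t p)"
  using assms(3)
proof (induction "vdeg t f" arbitrary: f rule: less_induct)
  case less
  show ?case
  proof (cases "f = 0 \<or> vdeg t f < vdeg t p")
    case True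
    then show ?thesis using less.prems by (intro bexI[of _ 1] bexI[of _ 0] bexI[of _ f]) auto
  next
    case False
    define m where "m = vdeg t f"
    define k where "k = vdeg t p"
    define lf where "lf = coeff (to_poly t f) m"
    define lp where "lp = coeff (to_poly t p) k"
    have l: "lf \<in> mpolys (W - {t})" "lp \<in> mpolys (W - {t})"
      unfolding lf_def lp_def using less.prems assms by (auto intro: coeff_to_poly_in_mpolys)
    then have l': "lf \<in> mpolys W" "lp \<in> mpolys W" using mpolys_mono[of "W - {t}" W] by auto
    \<comment> \<open>\<open>t\<close> need not be in \<open>W\<close>; a positive degree in
      \<open>t\<close> puts it there, and otherwise the power below is 1.\<close>
    have "t \<in> W" if "m > k"
      using that less.prems vdeg_0_iff[of t f] by (auto simp: m_def mpolys_def)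
    then have T: "mVar t ^ (m - k) \<in> mpolys W"
      by (cases "m > k") (auto intro: mpolys_power)
    have "lp \<noteq> 0" using assms by (simp add: lp_def k_def vdeg_def)
    have km: "k \<le> m" using False by (simp add: k_def m_def)
    \<comment> \<open>Cross-multiplied so that the leading terms in \<open>t\<close> cancel.\<close>
    define f1 where "f1 = lp * f - lf * mVar t ^ (m - k) * p"
    have f1W: "f1 \<in> mpolys W"
      unfolding f1_def by (intro mpolys_minus mpolys_mult T l' assms less.prems)
    have free: "to_poly t lf = [:lf:]" "to_poly t lp = [:lp:]"
      using l by (auto simp: mpolys_def intro!: to_poly_free)
    have tf1: "to_poly t f1 = Polynomial.smult lp (to_poly t f) - Polynomial.smult lf (monom 1 (m - k) * to_poly t p)"
      by (simp add: f1_def to_poly.hom_minus to_poly.hom_mult to_poly.hom_power free monom_altdef)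
    have c0: "coeff (to_poly t f1) i = 0" if "i \<ge> m" for i
    proof (cases "i = m")
      case True
      then show ?thesis using km
        by (simp add: tf1 coeff_monom_mult lf_def[symmetric] lp_def[symmetric])
    next
      case False
      with that have "degree (to_poly t f) < i" "degree (to_poly t p) < i - (m - k)"
        using km by (auto simp: m_def k_def vdeg_def)
      then show ?thesis using km that by (simp add: tf1 coeff_monom_mult coeff_eq_0)
    qed
    have "f1 = 0 \<or> vdeg t f1 < m"
      using c0[of "degree (to_poly t f1)"] unfolding vdeg_def
      by (metis leading_coeff_0_iff not_le to_poly_eq_0_iff)
    then show ?thesis
    proof
      assume "f1 = 0"
      then show ?thesis using \<open>lp \<noteq> 0\<close> l
        by (intro bexI[of _ lp] bexI[of _ "lf * mVar t ^ (m - k)"] bexI[of _ 0])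
          (auto simp: f1_def intro: mpolys_mult T l')
    next
      assume "vdeg t f1 < m"
      from less.hyps[OF this[unfolded m_def] f1W] obtain a q r where
        *: "a \<in> mpolys (W - {t})" "q \<in> mpolys W" "r \<in> mpolys W" "a \<noteq> 0" "a * f1 = q * p + r"
        "r = 0 \<or> vdeg t r < vdeg t p" by blast
      have "a * lp * f = (q + a * lf * mVar t ^ (m - k)) * p + r"
        using *(5) by (simp add: f1_def algebra_simps)
      moreover have "a \<in> mpolys W" using *(1) mpolys_mono[of "W - {t}" W] by auto
      ultimately show ?thesis using * \<open>lp \<noteq> 0\<close> l l' T
        by (intro bexI[of _ "a * lp"] bexI[of _ "q + a * lf * mVar t ^ (m - k)"] bexI[of _ r])
          (auto intro!: mpolys_mult mpolys_add)
    qed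
  qed
qed

text \<open>Among the h that p does not divide although p divides h g, take one of least degree in t. Dividing
  p by h leaves no remainder, so h would yield a proper factor of p.\<close>

lemma prime_on_step:
  assumes IH: "\<And>q. irreducible q \<Longrightarrow> q \<in> mpolys (W - {t}) \<Longrightarrow> prime_on (W - {t}) q"
    and p: "irreducible p" "p \<in> mpolys W" "vdeg t p > 0"
  shows "prime_on W p"
  unfolding prime_on_def
proof (intro ballI impI, rule ccontr)
  fix f g assume fg: "f \<in> mpolys W" "g \<in> mpolys W" "p dvd f * g" and n: "\<not> (p dvd f \<or> p dvd g)"
  have "p \<noteq> 0" using p by (auto simp: irreducible_def)
  have cancel: "p dvd h" if "a \<in> mpolys (W - {t})" "a \<noteq> 0" "h \<in> mpolys W" "p dvd a * h" for a h
  proof (cases "h = 0")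
    case False
    from that obtain w where w: "a * h = p * w" by auto
    moreover have "a * h \<in> mpolys W" using that mpolys_mono[of "W - {t}" W] by (auto intro: mpolys_mult)
    ultimately have "w \<in> mpolys W"
      using mpolys_factor[of w p W] that False w by (metis mpoly_mult_eq_0_iff mult.commute)
    then show ?thesis using cancel_free_factor[OF IH that(1,2) p(2) _ w p(1,3)] by blast
  qed auto
  define S where "S = {h \<in> mpolys W. \<not> p dvd h \<and> p dvd h * g}"
  have "f \<in> S" using fg n by (auto simp: S_def)
  then obtain h where h: "h \<in> S" "\<And>y. y \<in> S \<Longrightarrow> vdeg t h \<le> vdeg t y"
    using ex_has_least_nat[of "\<lambda>x. x \<in> S" f "vdeg t"] by auto
  then have hW: "h \<in> mpolys W" "\<not> p dvd h" "p dvd h * g" by (auto simp: S_def)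
  then have "h \<noteq> 0" by auto
  \<comment> \<open>The remainder of \<open>h\<close> modulo \<open>p\<close> stays in
    \<open>S\<close>, because \<open>cancel\<close> disposes of the multiplier \<open>a\<close>;
    minimality of \<open>h\<close> then gives the bound.\<close>
  have lt: "vdeg t h < vdeg t p"
  proof -
    obtain a q r where *: "a \<in> mpolys (W - {t})" "q \<in> mpolys W" "r \<in> mpolys W" "a \<noteq> 0"
      "a * h = q * p + r" "r = 0 \<or> vdeg t r < vdeg t p"
      using pseudo_division[OF p(2) \<open>p \<noteq> 0\<close> hW(1), of t] by blast
    have "\<not> p dvd r"
    proof
      assume "p dvd r"
      then have "p dvd a * h" unfolding *(5) by simp
      then show False using cancel[OF *(1,4) hW(1)] hW by simp
    qed
    moreover have "r * g = a * (h * g) - q * g * p"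
    proof -
      have r: "r = a * h - q * p" using *(5) by simp
      show ?thesis unfolding r by (simp add: algebra_simps)
    qed
    then have "p dvd r * g" using hW(3) by (metis dvd_diff dvd_mult dvd_triv_right)
    ultimately have "r \<in> S" using * by (simp add: S_def)
    moreover have "r \<noteq> 0" using \<open>\<not> p dvd r\<close> by auto
    ultimately show ?thesis using h(2)[of r] * by auto
  qed
  obtain a q r where *: "a \<in> mpolys (W - {t})" "q \<in> mpolys W" "r \<in> mpolys W" "a \<noteq> 0"
    "a * p = q * h + r" "r = 0 \<or> vdeg t r < vdeg t h"
    using pseudo_division[OF hW(1) \<open>h \<noteq> 0\<close> p(2), of t] by blast
  \<comment> \<open>A nonzero remainder has smaller degree than \<open>h\<close>, so it is outside
    \<open>S\<close> and hence divisible by \<open>p\<close>; but its degree is below that of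
    \<open>p\<close>.\<close>
  have "r = 0"
  proof (rule ccontr)
    assume "r \<noteq> 0"
    have r: "r = a * p - q * h" using *(5) by simp
    have "p dvd r * g"
    proof -
      have "r * g = a * g * p - q * (h * g)" unfolding r by (simp add: algebra_simps)
      then show ?thesis using hW(3) by (metis dvd_diff dvd_mult dvd_triv_right)
    qed
    moreover have "r \<notin> S" using h(2)[of r] * \<open>r \<noteq> 0\<close> by auto
    ultimately have "p dvd r" using * by (auto simp: S_def)
    then obtain s where s: "r = p * s" by auto
    then have "vdeg t p \<le> vdeg t r" using \<open>r \<noteq> 0\<close> by (simp add: vdeg_mult)
    then show False using lt * \<open>r \<noteq> 0\<close> by auto
  qed
  \<comment> \<open>One factor of \<open>p = q' * h'\<close> is a unit. If it is \<open>q'\<close>,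
    then \<open>p\<close> has the degree of \<open>h\<close>, against \<open>lt\<close>. If it is
    \<open>h'\<close>, then \<open>h\<close> is free of \<open>t\<close> and can be cancelled from
    \<open>h * g\<close>.\<close>
  then obtain b1 b2 q' h' where b: "b1 \<in> mpolys (W - {t})" "b2 \<in> mpolys (W - {t})"
    "q = b1 * q'" "h = b2 * h'" "p = q' * h'"
    using split_factor[OF IH *(1) *(4) *(2) hW(1), of p] *(5) by auto
  have "vdeg t h = vdeg t h'" using b \<open>h \<noteq> 0\<close> by (auto simp: vdeg_mult mpolys_diff_iff)
  from b(5) p(1) consider "q' dvd 1" | "h' dvd 1" by (auto simp: irreducible_def)
  then show False
  proof cases
    case 1
    then have "vdeg t p = vdeg t h'" using b(5) \<open>p \<noteq> 0\<close> unit_vdeg[OF 1, of t] by (auto simp: vdeg_mult)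
    then show False using lt \<open>vdeg t h = vdeg t h'\<close> by simp
  next
    case 2
    then have "h \<in> mpolys (W - {t})"
      using hW \<open>vdeg t h = vdeg t h'\<close> unit_vdeg[OF 2, of t] by (simp add: mpolys_diff_iff)
    then show False using cancel[OF _ \<open>h \<noteq> 0\<close> fg(2) hW(3)] n by simp
  qed
qed

theorem irreducible_prime_on:
  assumes "finite W" "irreducible p" "p \<in> mpolys W"
  shows "prime_on W p"
  using assms
proof (induction W arbitrary: p)
  case empty
  then obtain c where "p = mConst c" using mpolys_empty by blast
  then show ?case using empty by (auto simp: irreducible_def mpoly_dvd_1_iff)
next
  case (insert t W)
  then have W: "W = insert t W - {t}" by auto
  show ?case
  proof (cases "vdeg t p = 0")
    case True
    then have "p \<in> mpolys W" using insert.prems W mpolys_diff_iff by metis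
    then show ?thesis using insert.IH insert.prems W prime_on_extend by metis
  next
    case False
    show ?thesis
      by (rule prime_on_step[of _ t]) (use insert W False in auto)
  qed
qed

section \<open>A homogeneous Nullstellensatz\<close>

text \<open>Gaussian elimination: a pivot \<open>i0\<close> clears coordinate \<open>k\<close> from
  all other vectors, and these are still more numerous than the remaining coordinates.\<close>

lemma linear_dependence:
  fixes g :: "'i \<Rightarrow> 'k \<Rightarrow> complex"
  assumes "finite K" "finite I" "card K < card I"
  shows "\<exists>l. (\<exists>i\<in>I. l i \<noteq> 0) \<and> (\<forall>k\<in>K. (\<Sum>i\<in>I. l i * g i k) = 0)"
  using assms
proof (induction K arbitrary: I g)
  case empty
  then obtain i where "i \<in> I" by fastforce
  then show ?case by (intro exI[of _ "\<lambda>_. 1"]) auto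
next
  case (insert k K)
  show ?case
  proof (cases "\<forall>i\<in>I. g i k = 0")
    case True
    from insert.IH[of I g] insert.prems insert.hyps obtain l where
      "\<exists>i\<in>I. l i \<noteq> 0" "\<forall>k\<in>K. (\<Sum>i\<in>I. l i * g i k) = 0" by auto
    then show ?thesis using True by (intro exI[of _ l]) auto
  next
    case False
    then obtain i0 where i0: "i0 \<in> I" "g i0 k \<noteq> 0" by auto
    define J where "J = I - {i0}"
    define h where "h = (\<lambda>i k'. g i k' - g i k / g i0 k * g i0 k')"
    have "finite J" "card K < card J" using insert.prems insert.hyps i0 by (auto simp: J_def)
    from insert.IH[OF this, of h] obtain l where
      l: "\<exists>i\<in>J. l i \<noteq> 0" "\<forall>k\<in>K. (\<Sum>i\<in>J. l i * h i k) = 0" by auto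
    \<comment> \<open>The weight at the pivot makes up for the subtracted multiples of vector
      \<open>i0\<close>.\<close>
    define l' where "l' = l(i0 := - (\<Sum>i\<in>J. l i * (g i k / g i0 k)))"
    have *: "(\<Sum>i\<in>I. l' i * g i k') = (\<Sum>i\<in>J. l i * h i k')" for k'
    proof -
      have "(\<Sum>i\<in>I. l' i * g i k') = l' i0 * g i0 k' + (\<Sum>i\<in>J. l' i * g i k')"
        unfolding J_def using insert.prems i0 by (subst sum.remove[of I i0]) auto
      also have "(\<Sum>i\<in>J. l' i * g i k') = (\<Sum>i\<in>J. l i * g i k')"
        by (rule sum.cong) (auto simp: l'_def J_def)
      also have "l' i0 * g i0 k' + \<dots> = (\<Sum>i\<in>J. l i * h i k')"
        by (simp add: l'_def h_def algebra_simps sum_distrib_left sum_distrib_right sum_subtractf sum_negf)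
      finally show ?thesis .
    qed
    have "h i k = 0" for i using i0 by (simp add: h_def)
    with * l(2) have "\<forall>k'\<in>insert k K. (\<Sum>i\<in>I. l' i * g i k') = 0" by auto
    moreover from l(1) have "\<exists>i\<in>I. l' i \<noteq> 0" by (auto simp: l'_def J_def)
    ultimately show ?thesis by blast
  qed
qed

section \<open>Ideals maximal among those that avoid all powers of an element\<close>

definition is_ideal :: "'a::comm_ring_1 set \<Rightarrow> bool" where
  "is_ideal M \<longleftrightarrow> 0 \<in> M \<and> (\<forall>x\<in>M. \<forall>y\<in>M. x + y \<in> M) \<and> (\<forall>r. \<forall>x\<in>M. r * x \<in> M)"

lemma is_ideal_add_principal:
  assumes "is_ideal M"
  shows "is_ideal {m + u * f | m u. m \<in> M}"
  unfolding is_ideal_def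
proof (intro conjI ballI allI)
  have "0 = 0 + 0 * f" by simp
  then show "0 \<in> {m + u * f | m u. m \<in> M}" using assms unfolding is_ideal_def by blast
next
  fix x y assume "x \<in> {m + u * f | m u. m \<in> M}" "y \<in> {m + u * f | m u. m \<in> M}"
  then obtain m u m' u' where "x = m + u * f" "m \<in> M" "y = m' + u' * f" "m' \<in> M" by blast
  then have "x + y = (m + m') + (u + u') * f" "m + m' \<in> M"
    using assms by (auto simp: algebra_simps is_ideal_def)
  then show "x + y \<in> {m + u * f | m u. m \<in> M}" by blast
next
  fix r x assume "x \<in> {m + u * f | m u. m \<in> M}"
  then obtain m u where "x = m + u * f" "m \<in> M" by blast
  then have "r * x = r * m + (r * u) * f" by (simp add: algebra_simps)
  moreover have "r * m \<in> M" using assms \<open>m \<in> M\<close> by (simp add: is_ideal_def)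
  ultimately show "r * x \<in> {m + u * f | m u. m \<in> M}" by blast
qed

lemma is_ideal_Union_chain:
  assumes "\<And>M. M \<in> C \<Longrightarrow> is_ideal M" "C \<noteq> {}" "\<And>M N. M \<in> C \<Longrightarrow> N \<in> C \<Longrightarrow> M \<subseteq> N \<or> N \<subseteq> M"
  shows "is_ideal (\<Union>C)"
  unfolding is_ideal_def
proof (intro conjI ballI allI)
  show "0 \<in> \<Union>C" using assms(1,2) unfolding is_ideal_def by blast
next
  fix x y assume "x \<in> \<Union>C" "y \<in> \<Union>C"
  then obtain M N where "M \<in> C" "x \<in> M" "N \<in> C" "y \<in> N" by blast
  then show "x + y \<in> \<Union>C"
    using assms(1)[of M] assms(1)[of N] assms(3)[of M N] unfolding is_ideal_def by blast
next
  fix r x assume "x \<in> \<Union>C"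
  then show "r * x \<in> \<Union>C" using assms(1) unfolding is_ideal_def by blast
qed

text \<open>By Zorn's lemma. For \<open>f\<close> outside a maximal such \<open>M\<close>, the ideal
  generated by \<open>M\<close> and \<open>f\<close> contains a power of \<open>s\<close>; so
  \<open>f\<close> becomes invertible modulo \<open>M\<close> as soon as \<open>s\<close> is
  inverted.\<close>

lemma maximal_ideal_avoiding_powers:
  fixes s :: "'a::comm_ring_1"
  assumes I: "is_ideal I" "\<And>N. s ^ N \<notin> I"
  obtains M where "is_ideal M" "I \<subseteq> M" "\<And>N. s ^ N \<notin> M"
    "\<And>f. f \<notin> M \<Longrightarrow> \<exists>u N. s ^ N - u * f \<in> M"
proof -
  define A where "A = {M. is_ideal M \<and> I \<subseteq> M \<and> (\<forall>N. s ^ N \<notin> M)}"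
  have "I \<in> A" using I by (auto simp: A_def)
  have "\<exists>M\<in>A. \<forall>X\<in>A. M \<subseteq> X \<longrightarrow> X = M"
  proof (rule subset_Zorn_nonempty)
    show "A \<noteq> {}" using \<open>I \<in> A\<close> by auto
    fix C assume C: "C \<noteq> {}" "subset.chain A C"
    then have CA: "C \<subseteq> A" and "\<And>M N. M \<in> C \<Longrightarrow> N \<in> C \<Longrightarrow> M \<subseteq> N \<or> N \<subseteq> M"
      unfolding subset.chain_def by blast+
    then have "is_ideal (\<Union>C)"
      using C by (intro is_ideal_Union_chain) (auto simp: A_def)
    then show "\<Union>C \<in> A" using CA C unfolding A_def by blast
  qed
  then obtain M where M: "M \<in> A" "\<And>X. X \<in> A \<Longrightarrow> M \<subseteq> X \<Longrightarrow> X = M" by blast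
  show ?thesis
  proof (rule that[of M])
    show "is_ideal M" "I \<subseteq> M" "\<And>N. s ^ N \<notin> M" using M(1) by (auto simp: A_def)
    fix f assume f: "f \<notin> M"
    define X where "X = {m + u * f | m u. m \<in> M}"
    have "is_ideal X" unfolding X_def by (rule is_ideal_add_principal[OF \<open>is_ideal M\<close>])
    have "M \<subseteq> X"
    proof
      fix m assume "m \<in> M"
      moreover have "m = m + 0 * f" by simp
      ultimately show "m \<in> X" unfolding X_def by blast
    qed
    have "f = 0 + 1 * f" by simp
    then have "f \<in> X" unfolding X_def using \<open>is_ideal M\<close> unfolding is_ideal_def by blast
    with f M(2) \<open>M \<subseteq> X\<close> have "X \<notin> A" by blast
    with \<open>is_ideal X\<close> \<open>M \<subseteq> X\<close> \<open>I \<subseteq> M\<close> obtain N where "s ^ N \<in> X" by (auto simp: A_def)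
    then obtain m u where "s ^ N = m + u * f" "m \<in> M" by (auto simp: X_def)
    then have "s ^ N - u * f \<in> M" by simp
    then show "\<exists>u N. s ^ N - u * f \<in> M" by blast
  qed
qed

locale avoiding_ideal =
  fixes M :: "'v mpoly set" and s :: "'v mpoly"
  assumes ideal: "is_ideal M" and avoid: "\<And>N. s ^ N \<notin> M"
    and maximal: "\<And>f. f \<notin> M \<Longrightarrow> \<exists>u N. s ^ N - u * f \<in> M"
begin

lemma M_0: "0 \<in> M" and M_add: "x \<in> M \<Longrightarrow> y \<in> M \<Longrightarrow> x + y \<in> M" and M_mult: "x \<in> M \<Longrightarrow> r * x \<in> M"
  using ideal by (auto simp: is_ideal_def)

lemma M_mult': "x \<in> M \<Longrightarrow> x * r \<in> M"
  using M_mult[of x r] by (simp add: mult.commute)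

lemma M_uminus: "x \<in> M \<Longrightarrow> - x \<in> M"
  using M_mult[of x "-1"] by simp

lemma M_diff: "x \<in> M \<Longrightarrow> y \<in> M \<Longrightarrow> x - y \<in> M"
  using M_add[OF _ M_uminus, of x y] by simp

lemma M_sum: "(\<And>a. a \<in> A \<Longrightarrow> f a \<in> M) \<Longrightarrow> sum f A \<in> M"
  by (induction A rule: infinite_finite_induct) (auto intro: M_add M_0)

text \<open>Multiplying the two relations for \<open>f\<close> and \<open>g\<close> would write a
  power of \<open>s\<close> as an element of \<open>M\<close>.\<close>

lemma M_prime:
  assumes "f * g \<in> M"
  shows "f \<in> M \<or> g \<in> M"
proof (rule ccontr)
  assume "\<not> (f \<in> M \<or> g \<in> M)"
  then obtain u N v K where u: "s ^ N - u * f \<in> M" and v: "s ^ K - v * g \<in> M"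
    using maximal by blast
  have "s ^ (N + K) = (s ^ N - u * f) * s ^ K + (s ^ K - v * g) * (u * f) + (u * v) * (f * g)"
    by (simp add: algebra_simps power_add)
  also have "\<dots> \<in> M" by (intro M_add M_mult' u v M_mult assms)
  finally show False using avoid by blast
qed

lemma mConst_mult_M: "mConst c * f \<in> M \<Longrightarrow> c \<noteq> 0 \<Longrightarrow> f \<in> M"
proof -
  assume *: "mConst c * f \<in> M" "c \<noteq> 0"
  have "mConst (1 / c) * mConst c = (1 :: 'v mpoly)" using * by (simp add: mConst_def mult_single)
  then have "mConst (1 / c) * (mConst c * f) = f" by (simp flip: mult.assoc)
  with M_mult[OF *(1), of "mConst (1 / c)"] show "f \<in> M" by simp
qed

lemma msubst_congruent:
  assumes "\<And>v. v \<in> mvars p \<Longrightarrow> f v - g v \<in> M"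
  shows "msubst f mConst p - msubst g mConst p \<in> M"
proof -
  have prod: "a * b - a' * b' \<in> M" if "a - a' \<in> M" "b - b' \<in> M" for a a' b b'
  proof -
    have "a * b - a' * b' = (a - a') * b + (b - b') * a'" by (simp add: algebra_simps)
    also have "\<dots> \<in> M" using that by (intro M_add M_mult')
    finally show ?thesis .
  qed
  have pw: "a ^ e - a' ^ e \<in> M" if "a - a' \<in> M" for a a' and e :: nat
    by (induction e) (auto intro: M_0 prod that)
  have mon: "monom_eval f \<alpha> - monom_eval g \<alpha> \<in> M" if "\<alpha> \<in> Poly_Mapping.keys p" for \<alpha>
  proof -
    have "(\<Prod>v\<in>A. f v ^ e v) - (\<Prod>v\<in>A. g v ^ e v) \<in> M" if "A \<subseteq> mvars p" for A e
      using that
      by (induction A rule: infinite_finite_induct) (auto intro!: M_0 prod pw assms)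
    moreover have "Poly_Mapping.keys \<alpha> \<subseteq> mvars p" using that by (auto simp: mvars_def)
    ultimately show ?thesis by (simp add: monom_eval_def)
  qed
  have "msubst f mConst p - msubst g mConst p =
     (\<Sum>\<alpha>\<in>Poly_Mapping.keys p. mConst (Poly_Mapping.lookup p \<alpha>) * (monom_eval f \<alpha> - monom_eval g \<alpha>))"
    by (simp add: msubst_def sum_subtractf algebra_simps)
  also have "\<dots> \<in> M" by (intro M_sum M_mult mon)
  finally show ?thesis .
qed

end

text \<open>The homogenization s^m f(x / s), written without division because \<open>s\<close> has
  no inverse in the ring; \<open>m\<close> may exceed the degree of \<open>f\<close>.\<close>

definition binary_form :: "'v mpoly \<Rightarrow> 'v mpoly \<Rightarrow> nat \<Rightarrow> complex poly \<Rightarrow> 'v mpoly" where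
  "binary_form x s m f = (\<Sum>k\<le>m. mConst (coeff f k) * x ^ k * s ^ (m - k))"

interpretation mConst: comm_ring_hom mConst
  by (rule comm_ring_hom_mConst)

lemma binary_form_linear_factor:
  assumes "degree g \<le> m"
  shows "binary_form x s (Suc m) ([:- r, 1:] * g) = (x - mConst r * s) * binary_form x s m g"
proof -
  have c: "coeff ([:- r, 1:] * g) k = (case k of 0 \<Rightarrow> 0 | Suc j \<Rightarrow> coeff g j) - r * coeff g k" for k
    by (simp add: coeff_pCons split: nat.split)
  have g: "coeff g (Suc m) = 0" using assms by (simp add: coeff_eq_0)
  have "binary_form x s (Suc m) ([:- r, 1:] * g) =
     (\<Sum>k\<le>Suc m. mConst (case k of 0 \<Rightarrow> 0 | Suc j \<Rightarrow> coeff g j) * x ^ k * s ^ (Suc m - k)) -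
     (\<Sum>k\<le>Suc m. mConst r * mConst (coeff g k) * x ^ k * s ^ (Suc m - k))"
    unfolding binary_form_def c by (simp add: mConst.hom_minus mConst.hom_mult left_diff_distrib sum_subtractf)
  also have "(\<Sum>k\<le>Suc m. mConst (case k of 0 \<Rightarrow> 0 | Suc j \<Rightarrow> coeff g j) * x ^ k * s ^ (Suc m - k)) =
     x * binary_form x s m g"
    unfolding binary_form_def by (subst sum.atMost_Suc_shift) (simp add: sum_distrib_left mult_ac)
  also have "(\<Sum>k\<le>Suc m. mConst r * mConst (coeff g k) * x ^ k * s ^ (Suc m - k)) =
     mConst r * s * binary_form x s m g"
    unfolding binary_form_def using g by (auto simp: sum_distrib_left mult_ac Suc_diff_le intro!: sum.cong)
  finally show ?thesis by (simp add: algebra_simps)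
qed

lemma binary_form_prod:
  "finite J \<Longrightarrow> binary_form x s (card J) (\<Prod>b\<in>J. [:- b, 1:]) = (\<Prod>b\<in>J. x - mConst b * s)"
proof (induction J rule: finite_induct)
  case empty
  then show ?case by (simp add: binary_form_def)
next
  case (insert b J)
  have "degree (\<Prod>b\<in>J. [:- b, 1:]) \<le> card J"
    using degree_prod_sum_le[OF insert.hyps(1), of "\<lambda>b. [:- b, 1:]"] by simp
  from binary_form_linear_factor[OF this, of x s b] show ?case
    using insert by (simp del: mult_pCons_left)
qed

lemma binary_form_sum:
  "binary_form x s m (\<Sum>a\<in>A. Polynomial.smult (l a) (f a)) = (\<Sum>a\<in>A. mConst (l a) * binary_form x s m (f a))"
proof -
  have "binary_form x s m (\<Sum>a\<in>A. Polynomial.smult (l a) (f a)) =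
    (\<Sum>k\<le>m. \<Sum>a\<in>A. mConst (l a) * (mConst (coeff (f a) k) * x ^ k * s ^ (m - k)))"
    by (simp add: binary_form_def coeff_sum mConst.hom_sum mConst.hom_mult
        sum_distrib_right sum_distrib_left mult_ac)
  also have "\<dots> = (\<Sum>a\<in>A. mConst (l a) * binary_form x s m (f a))"
    by (subst sum.swap) (simp add: binary_form_def sum_distrib_left)
  finally show ?thesis .
qed

text \<open>By the fundamental theorem of algebra the form is a product of a nonzero constant, a
  power of \<open>s\<close> and factors \<open>x - mConst r * s\<close>. None of these lies in the
  prime ideal \<open>M\<close>.\<close>

lemma (in avoiding_ideal) binary_form_notin:
  assumes "\<And>r. x - mConst r * s \<notin> M" "f \<noteq> 0" "degree f \<le> m"
  shows "binary_form x s m f \<notin> M"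
  using assms(2,3)
proof (induction m arbitrary: f)
  case 0
  then obtain c where "f = [:c:]" "c \<noteq> 0" by (auto elim: degree_eq_zeroE)
  then show ?case using mConst_mult_M[of c 1] avoid[of 0] by (auto simp: binary_form_def)
next
  case (Suc m)
  show ?case
  proof (cases "degree f = 0")
    case True
    then obtain c where c: "f = [:c:]" "c \<noteq> 0" using Suc.prems by (auto elim: degree_eq_zeroE)
    have "binary_form x s (Suc m) f = mConst c * s ^ Suc m"
      unfolding binary_form_def c by (subst sum.atMost_Suc_shift) simp
    then show ?thesis using mConst_mult_M[of c "s ^ Suc m"] avoid[of "Suc m"] c by auto
  next
    case False
    then have "\<not> constant (poly f)" by (simp add: constant_degree)
    then obtain r where "poly f r = 0" using fundamental_theorem_of_algebra by blast
    then obtain g where g: "f = [:- r, 1:] * g" by (auto simp: poly_eq_0_iff_dvd)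
    then have "g \<noteq> 0" using Suc.prems by auto
    then have "degree f = degree [:- r, 1:] + degree g"
      unfolding g by (intro degree_mult_eq) auto
    then have "degree g \<le> m" using Suc.prems by simp
    then have "binary_form x s m g \<notin> M" by (rule Suc.IH[OF \<open>g \<noteq> 0\<close>])
    moreover have "binary_form x s (Suc m) f = (x - mConst r * s) * binary_form x s m g"
      unfolding g by (rule binary_form_linear_factor) fact
    ultimately show ?thesis using M_prime assms(1) by auto
  qed
qed

section \<open>Exhausting the monomials by countably many finite sets\<close>

lemma finite_monomials_bounded:
  assumes "finite A"
  shows "finite {\<alpha>::'v \<Rightarrow>\<^sub>0 nat. Poly_Mapping.keys \<alpha> \<subseteq> A \<and> (\<forall>v. Poly_Mapping.lookup \<alpha> v \<le> D)}"
    (is "finite ?S")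
proof -
  let ?f = "\<lambda>\<alpha>::'v \<Rightarrow>\<^sub>0 nat. restrict (Poly_Mapping.lookup \<alpha>) A"
  have "?f ` ?S \<subseteq> PiE A (\<lambda>_. {..D})" by auto
  then have "finite (?f ` ?S)" by (rule finite_subset) (use assms in \<open>auto intro: finite_PiE\<close>)
  moreover have "inj_on ?f ?S"
  proof (rule inj_onI, rule poly_mapping_eqI)
    fix \<alpha> \<beta> v assume *: "\<alpha> \<in> ?S" "\<beta> \<in> ?S" "?f \<alpha> = ?f \<beta>"
    show "Poly_Mapping.lookup \<alpha> v = Poly_Mapping.lookup \<beta> v"
    proof (cases "v \<in> A")
      case True
      then show ?thesis using fun_cong[OF *(3), of v] by simp
    next
      case False
      then have "v \<notin> Poly_Mapping.keys \<alpha>" "v \<notin> Poly_Mapping.keys \<beta>" using * by auto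
      then show ?thesis by (simp add: in_keys_iff)
    qed
  qed
  ultimately show ?thesis by (rule finite_imageD)
qed

text \<open>One natural number bounds both the variables and the exponents, so a countable
  pigeonhole can place infinitely many polynomials in one finite-dimensional space.\<close>

definition bounded_monomials :: "nat \<Rightarrow> (nat \<Rightarrow>\<^sub>0 nat) set" where
  "bounded_monomials D = {\<alpha>. Poly_Mapping.keys \<alpha> \<subseteq> {..D} \<and> (\<forall>v. Poly_Mapping.lookup \<alpha> v \<le> D)}"

lemma finite_bounded_monomials: "finite (bounded_monomials D)"
  unfolding bounded_monomials_def by (rule finite_monomials_bounded) simp

lemma in_some_bounded_monomials: "\<exists>D. \<alpha> \<in> bounded_monomials D"
proof -
  let ?D = "Max (insert 0 (Poly_Mapping.keys \<alpha> \<union> Poly_Mapping.lookup \<alpha> ` Poly_Mapping.keys \<alpha>))"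
  have "Poly_Mapping.lookup \<alpha> v \<le> ?D" for v
  proof (cases "v \<in> Poly_Mapping.keys \<alpha>")
    case False
    then show ?thesis by (simp add: in_keys_iff)
  qed (auto intro: Max_ge)
  then have "\<alpha> \<in> bounded_monomials ?D"
    by (auto simp: bounded_monomials_def intro!: Max_ge)
  then show ?thesis by blast
qed

lemma bounded_monomials_mono: "D \<le> E \<Longrightarrow> bounded_monomials D \<subseteq> bounded_monomials E"
  unfolding bounded_monomials_def by (auto intro: order.trans)

lemma subset_some_bounded_monomials: "finite K \<Longrightarrow> \<exists>D. K \<subseteq> bounded_monomials D"
proof (induction K rule: finite_induct)
  case (insert \<alpha> K)
  then obtain D E where "K \<subseteq> bounded_monomials D" "\<alpha> \<in> bounded_monomials E"
    using in_some_bounded_monomials by blast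
  then have "insert \<alpha> K \<subseteq> bounded_monomials (max D E)"
    using bounded_monomials_mono[of D "max D E"] bounded_monomials_mono[of E "max D E"] by auto
  then show ?case by blast
qed auto

lemma lookup_mConst_mult: "Poly_Mapping.lookup (mConst c * p) \<alpha> = c * Poly_Mapping.lookup p \<alpha>"
proof -
  have "mConst c * p = Poly_Mapping.map ((*) c) p"
    by (simp add: mConst_def mult_map_scale_conv_mult)
  then show ?thesis by (simp add: Poly_Mapping.map.rep_eq when_def)
qed

text \<open>The complex numbers are uncountable whereas the polynomial ring has countable dimension, so
  the inverses of x - a s modulo M, for a running through the complex numbers, satisfy a linear
  relation; clearing denominators it becomes a binary form in x and s lying in M.\<close>

lemma proportional_mod:
  fixes x s :: "nat mpoly"
  assumes "avoiding_ideal M s"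
  shows "\<exists>a. x - mConst a * s \<in> M"
proof (rule ccontr)
  interpret avoiding_ideal M s by fact
  assume n: "\<nexists>a. x - mConst a * s \<in> M"
  then have "\<forall>a. \<exists>u N. s ^ N - u * (x - mConst a * s) \<in> M" using maximal by blast
  then obtain u N where u: "\<And>a. s ^ N a - u a * (x - mConst a * s) \<in> M" by metis
  have "\<forall>a. \<exists>D. Poly_Mapping.keys (u a) \<subseteq> bounded_monomials D"
    using subset_some_bounded_monomials by simp
  then obtain D where D: "\<And>a. Poly_Mapping.keys (u a) \<subseteq> bounded_monomials (D a)" by metis
  \<comment> \<open>There are only countably many pairs of an exponent and a bound, but uncountably
    many \<open>a\<close>.\<close>
  obtain N0 D0 where inf: "infinite {a. N a = N0 \<and> D a = D0}"
  proof (rule ccontr)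
    assume "\<not> thesis"
    then have "finite {a. N a = N0 \<and> D a = D0}" for N0 D0 using that by blast
    then have "countable (\<Union>(i, j)\<in>UNIV. {a. N a = i \<and> D a = j})"
      by (intro countable_UN) (auto intro: countable_finite)
    also have "(\<Union>(i, j)\<in>UNIV. {a. N a = i \<and> D a = j}) = UNIV" by auto
    finally show False using uncountable_UNIV_complex by simp
  qed
  define K where "K = bounded_monomials D0"
  obtain I where I: "I \<subseteq> {a. N a = N0 \<and> D a = D0}" "finite I" "card I = Suc (card K)"
    using infinite_arbitrarily_large[OF inf] by metis
  obtain l where l: "\<exists>a\<in>I. l a \<noteq> 0"
    "\<forall>\<alpha>\<in>K. (\<Sum>a\<in>I. l a * Poly_Mapping.lookup (u a) \<alpha>) = 0"
    using linear_dependence[of K I "\<lambda>a. Poly_Mapping.lookup (u a)"] I finite_bounded_monomials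
    by (auto simp: K_def)
  have u0: "(\<Sum>a\<in>I. mConst (l a) * u a) = 0"
  proof (rule poly_mapping_eqI)
    fix \<alpha>
    have "(\<Sum>a\<in>I. l a * Poly_Mapping.lookup (u a) \<alpha>) = 0"
    proof (cases "\<alpha> \<in> K")
      case False
      then have "\<alpha> \<notin> Poly_Mapping.keys (u a)" if "a \<in> I" for a
        using that D[of a] I by (auto simp: K_def)
      then show ?thesis by (intro sum.neutral) (auto simp: in_keys_iff)
    qed (use l in auto)
    then show "Poly_Mapping.lookup (\<Sum>a\<in>I. mConst (l a) * u a) \<alpha> = Poly_Mapping.lookup 0 \<alpha>"
      by (simp add: lookup_sum lookup_mConst_mult)
  qed
  define P where "P a = (\<Prod>b\<in>I - {a}. x - mConst b * s)" for a
  define Q where "Q = (\<Prod>b\<in>I. x - mConst b * s)"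
  have Q: "Q = (x - mConst a * s) * P a" if "a \<in> I" for a
    unfolding Q_def P_def using that I by (subst prod.remove[of I a]) auto
  \<comment> \<open>Each \<open>(x - mConst a * s) * P a\<close> is the common product
    \<open>Q\<close>, so the terms containing \<open>u a\<close> add up to \<open>Q\<close> times
    the sum in \<open>u0\<close>, which is 0.\<close>
  have eq: "s ^ N0 * (\<Sum>a\<in>I. mConst (l a) * P a) =
     (\<Sum>a\<in>I. (s ^ N a - u a * (x - mConst a * s)) * (mConst (l a) * P a))"
  proof -
    have "s ^ N0 * (\<Sum>a\<in>I. mConst (l a) * P a) =
       (\<Sum>a\<in>I. s ^ N a * (mConst (l a) * P a)) - (\<Sum>a\<in>I. mConst (l a) * u a) * Q"
      unfolding u0 using I by (auto simp: sum_distrib_left intro!: sum.cong)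
    also have "\<dots> = (\<Sum>a\<in>I. s ^ N a * (mConst (l a) * P a) - mConst (l a) * u a * ((x - mConst a * s) * P a))"
      by (simp add: sum_subtractf sum_distrib_right Q[symmetric] cong: sum.cong)
    also have "\<dots> = (\<Sum>a\<in>I. (s ^ N a - u a * (x - mConst a * s)) * (mConst (l a) * P a))"
      by (intro sum.cong refl) (simp add: algebra_simps)
    finally show ?thesis .
  qed
  have "s ^ N0 * (\<Sum>a\<in>I. mConst (l a) * P a) \<in> M"
    unfolding eq by (intro M_sum M_mult' u)
  then have inM: "(\<Sum>a\<in>I. mConst (l a) * P a) \<in> M" using M_prime avoid by blast
  define f where "f = (\<Sum>a\<in>I. Polynomial.smult (l a) (\<Prod>b\<in>I - {a}. [:- b, 1:]))"
  have card: "card (I - {a}) = card K" if "a \<in> I" for a using that I by simp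
  have "binary_form x s (card K) (\<Prod>b\<in>I - {a}. [:- b, 1:]) = P a" if "a \<in> I" for a
    using binary_form_prod[of "I - {a}" x s] card[OF that] I by (simp add: P_def)
  then have "binary_form x s (card K) f = (\<Sum>a\<in>I. mConst (l a) * P a)"
    unfolding f_def binary_form_sum by simp
  moreover have "degree f \<le> card K"
    unfolding f_def
  proof (rule degree_sum_le)
    fix a assume "a \<in> I"
    have "degree (\<Prod>b\<in>I - {a}. [:- b, 1:]) \<le> card (I - {a})"
      using degree_prod_sum_le[of "I - {a}" "\<lambda>b. [:- b, 1:]"] I by simp
    then show "degree (Polynomial.smult (l a) (\<Prod>b\<in>I - {a}. [:- b, 1:])) \<le> card K"
      using card[OF \<open>a \<in> I\<close>] degree_smult_le order.trans by metis
  qed (use I in auto)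
  \<comment> \<open>The products are Lagrange polynomials up to scaling: at a point \<open>c\<close>
    of \<open>I\<close> only the term of \<open>c\<close> survives.\<close>
  moreover have "f \<noteq> 0"
  proof
    assume "f = 0"
    obtain c where c: "c \<in> I" "l c \<noteq> 0" using l by auto
    have "poly f c = (\<Sum>a\<in>I. l a * (\<Prod>b\<in>I - {a}. c - b))"
      by (simp add: f_def poly_sum poly_prod)
    also have "\<dots> = (\<Sum>a\<in>I. if a = c then l c * (\<Prod>b\<in>I - {c}. c - b) else 0)"
    proof (rule sum.cong)
      fix a assume "a \<in> I"
      have "(\<Prod>b\<in>I - {a}. c - b) = 0" if "a \<noteq> c"
        by (rule prod_zero) (use that c I in auto)
      then show "l a * (\<Prod>b\<in>I - {a}. c - b) = (if a = c then l c * (\<Prod>b\<in>I - {c}. c - b) else 0)" by auto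
    qed auto
    also have "\<dots> = l c * (\<Prod>b\<in>I - {c}. c - b)" using c I by simp
    also have "\<dots> \<noteq> 0" using c I by auto
    finally show False using \<open>f = 0\<close> by simp
  qed
  ultimately show False using binary_form_notin[of x f "card K"] n inM by auto
qed

section \<open>Degrees of monomials, and forms\<close>

definition mdeg :: "('v \<Rightarrow>\<^sub>0 nat) \<Rightarrow> nat" where
  "mdeg \<alpha> = (\<Sum>v\<in>Poly_Mapping.keys \<alpha>. Poly_Mapping.lookup \<alpha> v)"

lemma mdeg_superset:
  assumes "finite A" "Poly_Mapping.keys \<alpha> \<subseteq> A"
  shows "mdeg \<alpha> = (\<Sum>v\<in>A. Poly_Mapping.lookup \<alpha> v)"
  unfolding mdeg_def by (intro sum.mono_neutral_left) (use assms in \<open>auto simp: in_keys_iff\<close>)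

lemma mdeg_add: "mdeg (\<alpha> + \<beta>) = mdeg \<alpha> + mdeg \<beta>"
proof -
  let ?A = "Poly_Mapping.keys \<alpha> \<union> Poly_Mapping.keys \<beta>"
  have "mdeg (\<alpha> + \<beta>) = (\<Sum>v\<in>?A. Poly_Mapping.lookup (\<alpha> + \<beta>) v)"
    by (rule mdeg_superset) (use Poly_Mapping.keys_add[of \<alpha> \<beta>] in auto)
  also have "\<dots> = (\<Sum>v\<in>?A. Poly_Mapping.lookup \<alpha> v) + (\<Sum>v\<in>?A. Poly_Mapping.lookup \<beta> v)"
    by (simp add: lookup_add sum.distrib)
  also have "\<dots> = mdeg \<alpha> + mdeg \<beta>"
    by (subst (1 2) mdeg_superset[of ?A]) auto
  finally show ?thesis .
qed

lemma keys_add_nat: "Poly_Mapping.keys (\<alpha> + \<beta>) = Poly_Mapping.keys \<alpha> \<union> Poly_Mapping.keys (\<beta> :: 'v \<Rightarrow>\<^sub>0 nat)"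
  by (auto simp: in_keys_iff lookup_add)

lemma monomials_iff: "\<alpha> \<in> monomials n d \<longleftrightarrow> Poly_Mapping.keys \<alpha> \<subseteq> {1..n} \<and> mdeg \<alpha> = d"
  by (simp add: monomials_def mdeg_def)

lemma mdeg_single [simp]: "mdeg (Poly_Mapping.single v e) = e"
  by (simp add: mdeg_def)

lemma lookup_le_mdeg: "Poly_Mapping.lookup \<alpha> v \<le> mdeg \<alpha>"
proof (cases "v \<in> Poly_Mapping.keys \<alpha>")
  case True
  then show ?thesis unfolding mdeg_def by (intro member_le_sum) auto
next
  case False
  then show ?thesis by (simp add: in_keys_iff)
qed

lemma finite_monomials [simp]: "finite (monomials n d)"
proof (rule finite_subset)
  show "monomials n d \<subseteq> {\<alpha>. Poly_Mapping.keys \<alpha> \<subseteq> {1..n} \<and> (\<forall>v. Poly_Mapping.lookup \<alpha> v \<le> d)}"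
    using lookup_le_mdeg by (fastforce simp: monomials_iff simp del: atLeastAtMost_iff)
qed (simp add: finite_monomials_bounded)

lemma meval_form:
  assumes "form n d p"
  shows "meval x p = (\<Sum>\<alpha>\<in>monomials n d. mcoeff p \<alpha> * monom_eval x \<alpha>)"
  unfolding meval_def monom_eval_def[symmetric]
  by (rule sum.mono_neutral_left) (use assms in \<open>auto simp: form_def mcoeff_def in_keys_iff\<close>)

lemma msubst_scaled_form:
  assumes "form n d p"
  shows "msubst (\<lambda>v. mConst (a v) * s) mConst p = mConst (meval a p) * s ^ d"
proof -
  have "monom_eval (\<lambda>v. mConst (a v) * s) \<alpha> = mConst (monom_eval a \<alpha>) * s ^ d"
    if "\<alpha> \<in> Poly_Mapping.keys p" for \<alpha>
  proof -
    have "mdeg \<alpha> = d" using that assms by (auto simp: form_def monomials_iff)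
    then have "(\<Prod>v\<in>Poly_Mapping.keys \<alpha>. s ^ Poly_Mapping.lookup \<alpha> v) = s ^ d"
      by (simp add: mdeg_def flip: power_sum)
    then show ?thesis
      by (simp add: monom_eval_def mConst.hom_prod mConst.hom_power power_mult_distrib prod.distrib)
  qed
  then have "msubst (\<lambda>v. mConst (a v) * s) mConst p =
    (\<Sum>\<alpha>\<in>Poly_Mapping.keys p. mConst (Poly_Mapping.lookup p \<alpha>) * (mConst (monom_eval a \<alpha>) * s ^ d))"
    by (simp add: msubst_def)
  also have "\<dots> = mConst (meval a p) * s ^ d"
    by (simp add: meval_def mcoeff_def monom_eval_def mConst.hom_sum mConst.hom_mult sum_distrib_left mult_ac)
  finally show ?thesis .
qed

text \<open>If no power of x_j is in the ideal, enlarge it to \<open>M\<close> maximal with this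
  property. Modulo \<open>M\<close> every variable x_v is a multiple a_v x_j by
  \<open>proportional_mod\<close>, with a_j = 1, so each form is congruent to its value at
  \<open>a\<close> times x_j^d. As x_j^d is not in \<open>M\<close>, all these values vanish,
  against \<open>nz\<close>.\<close>

lemma nullstellensatz_forms:
  fixes F :: "'i \<Rightarrow> nat mpoly"
  assumes "finite S"
    and form: "\<And>i. i \<in> S \<Longrightarrow> form n d (F i)"
    and nz: "\<And>x. x j \<noteq> 0 \<Longrightarrow> \<exists>i\<in>S. meval x (F i) \<noteq> 0"
  shows "\<exists>N G. mVar j ^ N = (\<Sum>i\<in>S. G i * F i)"
proof (rule ccontr)
  assume n: "\<nexists>N G. mVar j ^ N = (\<Sum>i\<in>S. G i * F i)"
  define I where "I = {\<Sum>i\<in>S. G i * F i | G. True}"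
  have I: "(\<Sum>i\<in>S. G i * F i) \<in> I" for G by (auto simp: I_def)
  have "is_ideal I"
    unfolding is_ideal_def
  proof (intro conjI ballI allI)
    show "0 \<in> I" using I[of "\<lambda>_. 0"] by simp
  next
    fix x y assume "x \<in> I" "y \<in> I"
    then obtain G H where "x = (\<Sum>i\<in>S. G i * F i)" "y = (\<Sum>i\<in>S. H i * F i)" by (auto simp: I_def)
    then have "x + y = (\<Sum>i\<in>S. (G i + H i) * F i)" by (simp add: sum.distrib algebra_simps)
    then show "x + y \<in> I" using I[of "\<lambda>i. G i + H i"] by simp
  next
    fix r x assume "x \<in> I"
    then obtain G where "x = (\<Sum>i\<in>S. G i * F i)" by (auto simp: I_def)
    then have "r * x = (\<Sum>i\<in>S. (r * G i) * F i)" by (simp add: sum_distrib_left mult.assoc)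
    then show "r * x \<in> I" using I[of "\<lambda>i. r * G i"] by simp
  qed
  moreover have "mVar j ^ N \<notin> I" for N using n by (auto simp: I_def)
  ultimately have "\<exists>M. is_ideal M \<and> I \<subseteq> M \<and> (\<forall>N. mVar j ^ N \<notin> M) \<and>
      (\<forall>f. f \<notin> M \<longrightarrow> (\<exists>u N. mVar j ^ N - u * f \<in> M))"
    using maximal_ideal_avoiding_powers[of I "mVar j"] by metis
  then obtain M where M: "is_ideal M" "I \<subseteq> M" "\<And>N. mVar j ^ N \<notin> M"
    "\<And>f. f \<notin> M \<Longrightarrow> \<exists>u N. mVar j ^ N - u * f \<in> M"
    by blast
  interpret avoiding_ideal M "mVar j" by unfold_locales (use M in auto)
  have "\<forall>v. \<exists>a. mVar v - mConst a * mVar j \<in> M"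
    using proportional_mod avoiding_ideal_axioms by blast
  then obtain a where a: "\<And>v. mVar v - mConst (a v) * mVar j \<in> M" by metis
  have "a j = 1"
  proof (rule ccontr)
    assume "a j \<noteq> 1"
    moreover have "mConst (1 - a j) * mVar j \<in> M"
      using a[of j] by (simp add: mConst.hom_minus algebra_simps)
    ultimately show False using mConst_mult_M[of "1 - a j" "mVar j"] avoid[of 1] by simp
  qed
  then obtain i where i: "i \<in> S" "meval a (F i) \<noteq> 0" using nz[of a] by auto
  have "F i \<in> M"
  proof -
    have "(\<Sum>k\<in>S. (if k = i then 1 else 0) * F k) = F i"
      using i \<open>finite S\<close> by (simp add: if_distrib[of "\<lambda>c. c * _"] cong: if_cong)
    then show ?thesis using I[of "\<lambda>k. if k = i then 1 else 0"] M(2) by auto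
  qed
  moreover have "F i - mConst (meval a (F i)) * mVar j ^ d \<in> M"
    using msubst_congruent[of "F i" mVar "\<lambda>v. mConst (a v) * mVar j"] a
    by (simp add: msubst_id msubst_scaled_form[OF form[OF i(1)]])
  ultimately have "mConst (meval a (F i)) * mVar j ^ d \<in> M"
    using M_diff[of "F i" "F i - mConst (meval a (F i)) * mVar j ^ d"] by simp
  then show False using mConst_mult_M i avoid by blast
qed

section \<open>From the Nullstellensatz to a polynomial that certifies unsolvability\<close>

lemma lookup_mult_form:
  assumes "form n d p"
  shows "Poly_Mapping.lookup (g * p) \<gamma> = (\<Sum>\<beta>\<in>Poly_Mapping.keys g. \<Sum>\<alpha>\<in>monomials n d.
    if \<beta> + \<alpha> = \<gamma> then mcoeff g \<beta> * mcoeff p \<alpha> else 0)"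
proof -
  have p: "p = (\<Sum>\<alpha>\<in>monomials n d. Poly_Mapping.single \<alpha> (mcoeff p \<alpha>))"
    using assms by (subst poly_mapping_sum_single[of p], unfold mcoeff_def, intro sum.mono_neutral_left)
      (auto simp: form_def in_keys_iff)
  have "g * p = (\<Sum>\<beta>\<in>Poly_Mapping.keys g. \<Sum>\<alpha>\<in>monomials n d.
     Poly_Mapping.single (\<beta> + \<alpha>) (mcoeff g \<beta> * mcoeff p \<alpha>))"
    by (subst p, subst poly_mapping_sum_single[of g]) (simp add: sum_product mult_single mcoeff_def)
  then show ?thesis by (simp add: lookup_sum lookup_single when_def)
qed

lemma pigeonhole_monomial:
  assumes "\<gamma> \<in> monomials n (n * D)" "n \<ge> 1"
  shows "\<exists>j\<in>{1..n}. D \<le> Poly_Mapping.lookup \<gamma> j"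
proof (rule ccontr)
  assume "\<not> ?thesis"
  then have "(\<Sum>v\<in>{1..n}. Poly_Mapping.lookup \<gamma> v) < (\<Sum>v\<in>{1..n}. D)"
    using assms by (intro sum_strict_mono) (auto simp: not_le)
  then show False using assms mdeg_superset[of "{1..n}" \<gamma>] by (auto simp: monomials_iff)
qed

lemma add_in_monomials_iff:
  assumes "\<alpha> \<in> monomials n d"
  shows "\<beta> + \<alpha> \<in> monomials n N \<longleftrightarrow> Poly_Mapping.keys \<beta> \<subseteq> {1..n} \<and> mdeg \<beta> + d = N"
  using assms by (auto simp: monomials_iff keys_add_nat mdeg_add)

definition systems :: "nat \<Rightarrow> nat \<Rightarrow> (nat \<Rightarrow> nat mpoly) set" where
  "systems n d = {F. \<forall>i\<in>{1..n}. form n d (F i)}"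

definition has_zero :: "nat \<Rightarrow> (nat \<Rightarrow> nat mpoly) \<Rightarrow> bool" where
  "has_zero n F \<longleftrightarrow> (\<exists>x. (\<exists>i\<in>{1..n}. x i \<noteq> 0) \<and> (\<forall>i\<in>{1..n}. meval x (F i) = 0))"

text \<open>A monomial of degree n D has exponent at least D in some x_j, and is thus a multiple of
  the power of x_j that lies in the ideal.\<close>

lemma monomial_in_ideal:
  assumes F: "F \<in> systems n d" "\<not> has_zero n F" and "n \<ge> 1"
  shows "\<exists>N. \<forall>\<gamma>\<in>monomials n N. \<exists>G. Poly_Mapping.single \<gamma> 1 = (\<Sum>i\<in>{1..n}. G i * F i)"
proof -
  have "\<forall>j\<in>{1..n}. \<exists>N G. mVar j ^ N = (\<Sum>i\<in>{1..n}. G i * F i)"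
  proof
    fix j assume "j \<in> {1..n}"
    then have "\<exists>i\<in>{1..n}. meval x (F i) \<noteq> 0" if "x j \<noteq> 0" for x
      using F(2) that unfolding has_zero_def by blast
    then show "\<exists>N G. mVar j ^ N = (\<Sum>i\<in>{1..n}. G i * F i)"
      using F(1) by (intro nullstellensatz_forms[where d = d and n = n]) (auto simp: systems_def)
  qed
  then obtain N G where NG: "\<And>j. j \<in> {1..n} \<Longrightarrow> mVar j ^ N j = (\<Sum>i\<in>{1..n}. G j i * F i)"
    by metis
  define D where "D = Max (N ` {1..n})"
  have D: "N j \<le> D" if "j \<in> {1..n}" for j unfolding D_def using that by (intro Max_ge) auto
  have "\<exists>G. Poly_Mapping.single \<gamma> 1 = (\<Sum>i\<in>{1..n}. G i * F i)" if \<gamma>: "\<gamma> \<in> monomials n (n * D)" for \<gamma>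
  proof -
    obtain j where j: "j \<in> {1..n}" "D \<le> Poly_Mapping.lookup \<gamma> j"
      using pigeonhole_monomial[OF \<gamma> \<open>n \<ge> 1\<close>] by blast
    define \<delta> where "\<delta> = \<gamma> - Poly_Mapping.single j (N j)"
    have "\<gamma> = \<delta> + Poly_Mapping.single j (N j)"
      unfolding \<delta>_def using order.trans[OF D[OF j(1)] j(2)]
      by (intro poly_mapping_eqI) (auto simp: lookup_add lookup_minus lookup_single when_def)
    then have "Poly_Mapping.single \<gamma> 1 = Poly_Mapping.single \<delta> 1 * (mVar j ^ N j)"
      by (metis monom_eval_add monom_eval_mVar monom_eval_single)
    also have "\<dots> = (\<Sum>i\<in>{1..n}. (Poly_Mapping.single \<delta> 1 * G j i) * F i)"
      by (simp add: NG[OF j(1)] sum_distrib_left mult.assoc)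
    finally show ?thesis by (intro exI[of _ "\<lambda>i. Poly_Mapping.single \<delta> 1 * G j i"])
  qed
  then show ?thesis by blast
qed

lemma mpolys_of_int [simp]: "of_int k \<in> mpolys W"
  using mpolys_const[of "of_int k" W] by (metis mConst.hom_of_int)

lemma det_in_mpolys:
  assumes "A \<in> carrier_mat L L" "\<And>p q. p < L \<Longrightarrow> q < L \<Longrightarrow> A $$ (p, q) \<in> mpolys W"
  shows "Determinant.det A \<in> mpolys W"
proof -
  have "of_int (sign \<sigma>) * (\<Prod>i = 0..<L. A $$ (i, \<sigma> i)) \<in> mpolys W" if "\<sigma> permutes {0..<L}" for \<sigma>
    using assms that permutes_in_image[OF that] by (intro mpolys_mult mpolys_prod) auto
  then show ?thesis
    using assms(1) unfolding Determinant.det_def by (auto intro!: mpolys_sum)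
qed

text \<open>Write each monomial of some degree N as a combination of the forms of F with multipliers G. The same
  multipliers applied to another system F' give a square matrix that is the identity for F' = F and
  that annihilates the vector of monomials at any common zero of F'.\<close>

theorem inertia_form_exists:
  assumes F: "F \<in> systems n d" "\<not> has_zero n F" and "n \<ge> 1"
  shows "\<exists>\<Delta> \<in> mpolys ({1..n} \<times> monomials n d). meval (coeffs_of F) \<Delta> = 1 \<and>
    (\<forall>F'\<in>systems n d. has_zero n F' \<longrightarrow> meval (coeffs_of F') \<Delta> = 0)"
proof -
  obtain N where "\<forall>\<gamma>\<in>monomials n N. \<exists>G. Poly_Mapping.single \<gamma> 1 = (\<Sum>i\<in>{1..n}. G i * F i)"
    using monomial_in_ideal[OF assms] by blast
  then obtain G where G: "\<And>\<gamma>. \<gamma> \<in> monomials n N \<Longrightarrow> Poly_Mapping.single \<gamma> 1 = (\<Sum>i\<in>{1..n}. G \<gamma> i * F i)"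
    by metis
  \<comment> \<open>Only multiplier terms in x_1, ..., x_n of degree N - d can produce monomials of
    degree N. Dropping the others leaves the coefficients for \<open>F\<close> unchanged, and keeps
    every product for another system within the columns of the matrix.\<close>
  define B where "B \<gamma> i = {\<beta> \<in> Poly_Mapping.keys (G \<gamma> i). Poly_Mapping.keys \<beta> \<subseteq> {1..n} \<and> mdeg \<beta> + d = N}" for \<gamma> i
  define ent where "ent \<gamma> \<delta> = (\<Sum>i\<in>{1..n}. \<Sum>\<beta>\<in>B \<gamma> i. \<Sum>\<alpha>\<in>monomials n d.
    if \<beta> + \<alpha> = \<delta> then mConst (mcoeff (G \<gamma> i) \<beta>) * mVar (i, \<alpha>) else 0)" for \<gamma> \<delta>
  have ent_mem: "ent \<gamma> \<delta> \<in> mpolys ({1..n} \<times> monomials n d)" for \<gamma> \<delta>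
    unfolding ent_def by (intro mpolys_sum) (auto intro!: mpolys_mult)
  have ent_eval: "meval (coeffs_of F') (ent \<gamma> \<delta>) = (\<Sum>i\<in>{1..n}. \<Sum>\<beta>\<in>B \<gamma> i. \<Sum>\<alpha>\<in>monomials n d.
    if \<beta> + \<alpha> = \<delta> then mcoeff (G \<gamma> i) \<beta> * mcoeff (F' i) \<alpha> else 0)" for F' \<gamma> \<delta>
    unfolding ent_def meval.hom_sum
    by (intro sum.cong refl) (simp add: meval.hom_mult coeffs_of_def)
  have at_F: "meval (coeffs_of F) (ent \<gamma> \<delta>) = (if \<gamma> = \<delta> then 1 else 0)"
    if "\<gamma> \<in> monomials n N" "\<delta> \<in> monomials n N" for \<gamma> \<delta>
  proof -
    have "meval (coeffs_of F) (ent \<gamma> \<delta>) = (\<Sum>i\<in>{1..n}. Poly_Mapping.lookup (G \<gamma> i * F i) \<delta>)"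
      unfolding ent_eval
    proof (intro sum.cong refl)
      fix i assume i: "i \<in> {1..n}"
      have "form n d (F i)" using F i by (auto simp: systems_def)
      show "(\<Sum>\<beta>\<in>B \<gamma> i. \<Sum>\<alpha>\<in>monomials n d.
          if \<beta> + \<alpha> = \<delta> then mcoeff (G \<gamma> i) \<beta> * mcoeff (F i) \<alpha> else 0) =
          Poly_Mapping.lookup (G \<gamma> i * F i) \<delta>"
        unfolding lookup_mult_form[OF \<open>form n d (F i)\<close>]
      proof (rule sum.mono_neutral_left)
        show "\<forall>\<beta>\<in>Poly_Mapping.keys (G \<gamma> i) - B \<gamma> i. (\<Sum>\<alpha>\<in>monomials n d.
          if \<beta> + \<alpha> = \<delta> then mcoeff (G \<gamma> i) \<beta> * mcoeff (F i) \<alpha> else 0) = 0"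
        proof (intro ballI sum.neutral)
          fix \<beta> \<alpha> assume "\<beta> \<in> Poly_Mapping.keys (G \<gamma> i) - B \<gamma> i" "\<alpha> \<in> monomials n d"
          then have "\<beta> + \<alpha> \<noteq> \<delta>"
            using that(2) add_in_monomials_iff[of \<alpha> n d \<beta> N] by (auto simp: B_def)
          then show "(if \<beta> + \<alpha> = \<delta> then mcoeff (G \<gamma> i) \<beta> * mcoeff (F i) \<alpha> else 0) = 0" by simp
        qed
      qed (auto simp: B_def)
    qed
    also have "\<dots> = Poly_Mapping.lookup (Poly_Mapping.single \<gamma> (1::complex)) \<delta>"
      by (simp add: G[OF that(1)] lookup_sum)
    finally show ?thesis by (simp add: lookup_single when_def)
  qed
  have at_zero: "(\<Sum>\<delta>\<in>monomials n N. meval (coeffs_of F') (ent \<gamma> \<delta>) * monom_eval x \<delta>) = 0"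
    if "F' \<in> systems n d" "\<forall>i\<in>{1..n}. meval x (F' i) = 0" for F' \<gamma> x
  proof -
    have "(\<Sum>\<delta>\<in>monomials n N. meval (coeffs_of F') (ent \<gamma> \<delta>) * monom_eval x \<delta>) =
      (\<Sum>i\<in>{1..n}. \<Sum>\<beta>\<in>B \<gamma> i. \<Sum>\<alpha>\<in>monomials n d. \<Sum>\<delta>\<in>monomials n N.
        (if \<beta> + \<alpha> = \<delta> then mcoeff (G \<gamma> i) \<beta> * mcoeff (F' i) \<alpha> else 0) * monom_eval x \<delta>)"
      unfolding ent_eval sum_distrib_right
      by (subst sum.swap, rule sum.cong[OF refl], subst sum.swap, rule sum.cong[OF refl], rule sum.swap)
    also have "\<dots> = (\<Sum>i\<in>{1..n}. \<Sum>\<beta>\<in>B \<gamma> i. \<Sum>\<alpha>\<in>monomials n d.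
        mcoeff (G \<gamma> i) \<beta> * monom_eval x \<beta> * (mcoeff (F' i) \<alpha> * monom_eval x \<alpha>))"
    proof (intro sum.cong refl)
      fix i \<beta> \<alpha> assume *: "\<beta> \<in> B \<gamma> i" "\<alpha> \<in> monomials n d"
      then have "\<beta> + \<alpha> \<in> monomials n N" using add_in_monomials_iff[of \<alpha> n d \<beta> N] by (auto simp: B_def)
      have "(\<Sum>\<delta>\<in>monomials n N. (if \<beta> + \<alpha> = \<delta> then mcoeff (G \<gamma> i) \<beta> * mcoeff (F' i) \<alpha> else 0) * monom_eval x \<delta>) =
        (\<Sum>\<delta>\<in>monomials n N. if \<delta> = \<beta> + \<alpha> then mcoeff (G \<gamma> i) \<beta> * mcoeff (F' i) \<alpha> * monom_eval x (\<beta> + \<alpha>) else 0)"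
        by (intro sum.cong) auto
      also have "\<dots> = mcoeff (G \<gamma> i) \<beta> * mcoeff (F' i) \<alpha> * monom_eval x (\<beta> + \<alpha>)"
        using \<open>\<beta> + \<alpha> \<in> monomials n N\<close> by simp
      finally show "(\<Sum>\<delta>\<in>monomials n N. (if \<beta> + \<alpha> = \<delta> then mcoeff (G \<gamma> i) \<beta> * mcoeff (F' i) \<alpha> else 0) * monom_eval x \<delta>) =
        mcoeff (G \<gamma> i) \<beta> * monom_eval x \<beta> * (mcoeff (F' i) \<alpha> * monom_eval x \<alpha>)"
        by (simp add: monom_eval_add mult_ac)
    qed
    also have "\<dots> = (\<Sum>i\<in>{1..n}. \<Sum>\<beta>\<in>B \<gamma> i. mcoeff (G \<gamma> i) \<beta> * monom_eval x \<beta> * meval x (F' i))"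
    proof (intro sum.cong refl)
      fix i \<beta> assume "i \<in> {1..n}"
      then have "form n d (F' i)" using that(1) by (simp add: systems_def)
      then show "(\<Sum>\<alpha>\<in>monomials n d. mcoeff (G \<gamma> i) \<beta> * monom_eval x \<beta> * (mcoeff (F' i) \<alpha> * monom_eval x \<alpha>)) =
          mcoeff (G \<gamma> i) \<beta> * monom_eval x \<beta> * meval x (F' i)"
        by (simp add: meval_form sum_distrib_left)
    qed
    also have "\<dots> = 0" using that(2) by (intro sum.neutral ballI) auto
    finally show ?thesis .
  qed
  obtain gs where gs: "set gs = monomials n N" "distinct gs"
    using finite_distinct_list[OF finite_monomials] by blast
  define L where "L = length gs"
  define A where "A = Matrix.mat L L (\<lambda>(p, q). ent (gs ! p) (gs ! q))"
  have gs_mem: "gs ! p \<in> monomials n N" if "p < L" for p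
    using nth_mem[of p gs] that unfolding L_def gs(1) .
  have "Determinant.det A \<in> mpolys ({1..n} \<times> monomials n d)"
    by (rule det_in_mpolys[of _ L]) (simp_all add: A_def ent_mem del: One_nat_def)
  moreover have "map_mat (meval (coeffs_of F)) A = 1\<^sub>m L"
    by (rule eq_matI) (use gs in \<open>auto simp: A_def at_F gs_mem L_def nth_eq_iff_index_eq\<close>)
  then have "meval (coeffs_of F) (Determinant.det A) = 1"
    by (metis meval.hom_det det_one)
  moreover have "meval (coeffs_of F') (Determinant.det A) = 0" if F': "F' \<in> systems n d" "has_zero n F'" for F'
  proof -
    from F'(2) obtain x j where x: "j \<in> {1..n}" "x j \<noteq> 0" "\<forall>i\<in>{1..n}. meval x (F' i) = 0"
      unfolding has_zero_def by blast
    define v where "v = Matrix.vec L (\<lambda>q. monom_eval x (gs ! q))"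
    let ?A = "map_mat (meval (coeffs_of F')) A"
    have "?A *\<^sub>v v = 0\<^sub>v L"
    proof (rule eq_vecI)
      fix p assume "p < dim_vec (0\<^sub>v L :: complex Matrix.vec)"
      then have p: "p < L" by simp
      have "vec_index (?A *\<^sub>v v) p = (\<Sum>q<L. meval (coeffs_of F') (ent (gs ! p) (gs ! q)) * monom_eval x (gs ! q))"
        using p by (simp add: A_def v_def scalar_prod_def atLeast0LessThan)
      also have "\<dots> = (\<Sum>\<delta>\<in>monomials n N. meval (coeffs_of F') (ent (gs ! p) \<delta>) * monom_eval x \<delta>)"
        by (rule sum.reindex_bij_betw) (use bij_betw_nth[OF gs(2), of "{..<L}" "set gs"] gs L_def in auto)
      also have "\<dots> = 0" by (rule at_zero[OF F'(1) x(3)])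
      finally show "vec_index (?A *\<^sub>v v) p = vec_index (0\<^sub>v L) p" using p by simp
    qed (simp add: A_def)
    moreover have "v \<noteq> 0\<^sub>v L"
    proof -
      have "Poly_Mapping.single j N \<in> monomials n N" using x by (auto simp: monomials_iff)
      then obtain q where q: "q < L" "gs ! q = Poly_Mapping.single j N"
        using gs by (metis in_set_conv_nth L_def)
      then have "vec_index v q \<noteq> 0" using x by (simp add: v_def)
      then show ?thesis using q by auto
    qed
    moreover have "?A \<in> carrier_mat L L" "v \<in> carrier_vec L" by (auto simp: A_def v_def)
    ultimately have "Determinant.det ?A = 0"
      using det_0_iff_vec_prod_zero[of ?A L] by blast
    then show ?thesis by (metis meval.hom_det)
  qed
  ultimately show ?thesis by blast
qed

section \<open>The ideal of solvable systems\<close>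

lemma poly_msubst: "poly (msubst K (\<lambda>c. [:c:]) p) s = meval (\<lambda>v. poly (K v) s) p"
  unfolding meval_msubst by (subst hom_msubst[OF comm_ring_hom_poly]) simp

lemma poly_monom_eval: "poly (monom_eval f \<alpha>) s = monom_eval (\<lambda>v. poly (f v) s) \<alpha>"
  using comm_ring_hom.hom_monom_eval[OF comm_ring_hom_poly] by fast

type_synonym coeff_index = "nat \<times> (nat \<Rightarrow>\<^sub>0 nat)"

text \<open>Systems are replaced by coefficient vectors \<open>w\<close>, the points at which the
  resultant is evaluated; their values outside the index set of the forms are arbitrary.\<close>

definition form_at :: "nat \<Rightarrow> nat \<Rightarrow> (coeff_index \<Rightarrow> complex) \<Rightarrow> nat \<Rightarrow> (nat \<Rightarrow> complex) \<Rightarrow> complex" where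
  "form_at n d w i x = (\<Sum>\<alpha>\<in>monomials n d. w (i, \<alpha>) * monom_eval x \<alpha>)"

definition common_zero :: "nat \<Rightarrow> nat \<Rightarrow> (coeff_index \<Rightarrow> complex) \<Rightarrow> (nat \<Rightarrow> complex) \<Rightarrow> bool" where
  "common_zero n d w x \<longleftrightarrow> (\<exists>j\<in>{1..n}. x j \<noteq> 0) \<and> (\<forall>i\<in>{1..n}. form_at n d w i x = 0)"

definition system_of :: "nat \<Rightarrow> nat \<Rightarrow> (coeff_index \<Rightarrow> complex) \<Rightarrow> nat \<Rightarrow> nat mpoly" where
  "system_of n d w i = (\<Sum>\<alpha>\<in>monomials n d. Poly_Mapping.single \<alpha> (w (i, \<alpha>)))"

lemma mcoeff_system_of: "mcoeff (system_of n d w i) \<alpha> = (if \<alpha> \<in> monomials n d then w (i, \<alpha>) else 0)"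
  by (simp add: mcoeff_def system_of_def lookup_sum lookup_single when_def)

lemma system_of_in_systems: "system_of n d w \<in> systems n d"
proof -
  have "\<alpha> \<in> monomials n d" if "\<alpha> \<in> Poly_Mapping.keys (system_of n d w i)" for \<alpha> i
  proof (rule ccontr)
    assume "\<alpha> \<notin> monomials n d"
    then have "mcoeff (system_of n d w i) \<alpha> = 0" by (simp add: mcoeff_system_of)
    with that show False by (simp add: in_keys_iff mcoeff_def)
  qed
  then show ?thesis by (auto simp: systems_def form_def)
qed

lemma has_zero_iff:
  assumes "F \<in> systems n d"
  shows "has_zero n F \<longleftrightarrow> (\<exists>x. common_zero n d (coeffs_of F) x)"
proof -
  have "meval x (F i) = form_at n d (coeffs_of F) i x" if "i \<in> {1..n}" for x i
    using assms that by (subst meval_form[of n d]) (auto simp: systems_def form_at_def coeffs_of_def)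
  then show ?thesis unfolding has_zero_def common_zero_def by (simp cong: conj_cong)
qed

lemma form_at_cong:
  "(\<And>\<alpha>. \<alpha> \<in> monomials n d \<Longrightarrow> w (i, \<alpha>) = w' (i, \<alpha>)) \<Longrightarrow> form_at n d w i x = form_at n d w' i x"
  by (simp add: form_at_def)

lemma form_at_scale:
  "form_at n d w i (\<lambda>v. a * x v) = a ^ d * form_at n d w i x"
proof -
  have "monom_eval (\<lambda>v. a * x v) \<alpha> = a ^ d * monom_eval x \<alpha>" if "\<alpha> \<in> monomials n d" for \<alpha>
    using that by (auto simp: monom_eval_def power_mult_distrib prod.distrib monomials_iff mdeg_def
        simp flip: power_sum)
  then show ?thesis by (simp add: form_at_def sum_distrib_left mult_ac)
qed

text \<open>Algebraic substitute for letting s tend to 0.\<close>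

lemma poly_eq_0_off_0: "(\<And>s. s \<noteq> 0 \<Longrightarrow> poly q s = 0) \<Longrightarrow> q = (0 :: complex poly)"
proof (rule ccontr)
  assume *: "\<And>s. s \<noteq> 0 \<Longrightarrow> poly q s = 0" and "q \<noteq> 0"
  then have "finite {s. poly q s = 0}" by (simp add: poly_roots_finite)
  moreover have "- {0} \<subseteq> {s. poly q s = 0}" using * by auto
  ultimately have "finite (- {0 :: complex})" by (rule rev_finite_subset)
  then show False using infinite_UNIV_char_0[where 'a = complex] by (simp add: Compl_eq_Diff_UNIV)
qed

lemma mVar_power: "mVar v ^ e = Poly_Mapping.single (Poly_Mapping.single v e) 1"
  using monom_eval_mVar[of "Poly_Mapping.single v e"] by simp

lemma order_at_0:
  fixes H :: "'a::comm_ring_1 poly"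
  assumes "H \<noteq> 0"
  shows "\<exists>e H'. H = [:0, 1:] ^ e * H' \<and> coeff H' 0 \<noteq> 0"
  using assms
proof (induction H)
  case (pCons a q)
  show ?case
  proof (cases "a = 0")
    case False
    then show ?thesis by (intro exI[of _ 0] exI[of _ "pCons a q"]) simp
  next
    case True
    with pCons obtain e H' where "q = [:0, 1:] ^ e * H'" "coeff H' 0 \<noteq> 0" by auto
    then have "pCons a q = [:0, 1:] ^ Suc e * H'" using True by simp
    with \<open>coeff H' 0 \<noteq> 0\<close> show ?thesis by blast
  qed
qed simp

section \<open>The vanishing ideal of the parametrized solvable systems\<close>

locale generic_system =
  fixes n d :: nat
  assumes n: "n \<ge> 1" and d: "d \<ge> 1"
begin

definition X :: "coeff_index set" where
  "X = {1..n} \<times> monomials n d"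

definition top_mon :: "nat \<Rightarrow>\<^sub>0 nat" where
  "top_mon = Poly_Mapping.single n d"

definition tvar :: coeff_index where
  "tvar = (n, top_mon)"

lemma top_mon_in [simp]: "top_mon \<in> monomials n d"
  using n by (auto simp: top_mon_def monomials_iff)

lemma finite_X: "finite X"
  by (simp add: X_def)

text \<open>With x_n = 1, the i-th form vanishes at \<open>x\<close> exactly when its coefficient of
  x_n^d is minus the sum of its other terms. So \<open>x\<close> and the remaining coefficients in
  \<open>c\<close> are free parameters.\<close>

definition point :: "(coeff_index \<Rightarrow> complex) \<Rightarrow> (nat \<Rightarrow> complex) \<Rightarrow> coeff_index \<Rightarrow> complex" where
  "point c x = (\<lambda>(i, \<alpha>). if \<alpha> = top_mon
     then - (\<Sum>\<beta>\<in>monomials n d - {top_mon}. c (i, \<beta>) * monom_eval x \<beta>) else c (i, \<alpha>))"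

text \<open>Only zeros normalized by \<open>x n = 1\<close> are tested here;
  \<open>P_vanishes\<close> extends this to all nontrivial zeros.\<close>

definition P :: "coeff_index mpoly set" where
  "P = {p \<in> mpolys X. \<forall>c x. x n = 1 \<longrightarrow> meval (point c x) p = 0}"

lemma form_at_split:
  assumes "x n = 1"
  shows "form_at n d w i x = w (i, top_mon) + (\<Sum>\<beta>\<in>monomials n d - {top_mon}. w (i, \<beta>) * monom_eval x \<beta>)"
proof -
  have "monom_eval x top_mon = 1" using assms by (simp add: top_mon_def)
  then show ?thesis unfolding form_at_def by (subst sum.remove[of _ top_mon]) auto
qed

lemma common_zero_point:
  assumes "x n = 1"
  shows "common_zero n d (point c x) x"
proof -
  have "form_at n d (point c x) i x = 0" for i
    unfolding form_at_split[where x = x, OF assms] by (simp add: point_def)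
  then show ?thesis unfolding common_zero_def using assms n by force
qed

lemma meval_cong_X: "p \<in> mpolys X \<Longrightarrow> (\<And>v. v \<in> X \<Longrightarrow> w v = w' v) \<Longrightarrow> meval w p = meval w' p"
  by (rule meval_cong) (auto simp: mpolys_def)

lemma P_mpolys: "p \<in> P \<Longrightarrow> p \<in> mpolys X"
  by (simp add: P_def)

lemma P_diff: "p \<in> P \<Longrightarrow> q \<in> P \<Longrightarrow> p - q \<in> P"
  by (simp add: P_def mpolys_minus meval.hom_minus)

lemma P_mult: "p \<in> mpolys X \<Longrightarrow> q \<in> P \<Longrightarrow> p * q \<in> P"
  by (simp add: P_def mpolys_mult meval.hom_mult)

text \<open>Join the parameters of a point where \<open>p\<close> is nonzero to those of a point
  where \<open>q\<close> is nonzero by a line, along which x_n stays 1. Along it \<open>p\<close>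
  and \<open>q\<close> become nonzero univariate polynomials, whose product cannot vanish
  identically.\<close>

lemma P_prime:
  assumes "p \<in> mpolys X" "q \<in> mpolys X" "p * q \<in> P"
  shows "p \<in> P \<or> q \<in> P"
proof (rule ccontr)
  assume "\<not> (p \<in> P \<or> q \<in> P)"
  then obtain c x c' x' where x: "x n = 1" "x' n = 1"
    and p: "meval (point c x) p \<noteq> 0" and q: "meval (point c' x') q \<noteq> 0"
    using assms by (auto simp: P_def)
  define C where "C = (\<lambda>v. [:c v, c' v - c v:])"
  define Y where "Y = (\<lambda>v. [:x v, x' v - x v:])"
  define K where "K = (\<lambda>(i, \<alpha>). if \<alpha> = top_mon
     then - (\<Sum>\<beta>\<in>monomials n d - {top_mon}. C (i, \<beta>) * monom_eval Y \<beta>) else C (i, \<alpha>))"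
  have K: "(\<lambda>v. poly (K v) s) = point (\<lambda>v. poly (C v) s) (\<lambda>v. poly (Y v) s)" for s
    by (auto simp: K_def point_def fun_eq_iff poly_sum poly_monom_eval)
  define h where "h = msubst K (\<lambda>c. [:c:])"
  have h: "poly (h r) s = meval (point (\<lambda>v. poly (C v) s) (\<lambda>v. poly (Y v) s)) r" for r s
    unfolding h_def poly_msubst K ..
  interpret h: comm_ring_hom h unfolding h_def by (rule msubst_hom[OF comm_ring_hom_const_poly])
  have "poly (h p) 0 \<noteq> 0" using p by (simp add: h C_def Y_def)
  moreover have "poly (h q) 1 \<noteq> 0" using q by (simp add: h C_def Y_def)
  ultimately have "h p * h q \<noteq> 0" by force
  moreover have "poly (h (p * q)) s = 0" for s
    using assms(3) x unfolding h by (auto simp: P_def Y_def)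
  then have "h (p * q) = 0" using poly_all_0_iff_0 by blast
  ultimately show False by (simp add: h.hom_mult)
qed

lemma P_vanishes_aux:
  assumes "p \<in> P" "common_zero n d w x" "x n \<noteq> 0"
  shows "meval w p = 0"
proof -
  define y where "y = (\<lambda>v. (1 / x n) * x v)"
  have y: "y n = 1" using assms by (simp add: y_def)
  have "w v = point w y v" if "v \<in> X" for v
  proof -
    obtain i \<alpha> where v: "v = (i, \<alpha>)" "i \<in> {1..n}" using \<open>v \<in> X\<close> by (auto simp: X_def)
    have "form_at n d w i y = 0"
      unfolding y_def form_at_scale using assms v by (simp add: common_zero_def)
    then show ?thesis unfolding form_at_split[where x = y, OF y] v by (auto simp: point_def add_eq_0_iff2)
  qed
  then have "meval w p = meval (point w y) p" by (rule meval_cong_X[OF P_mpolys[OF assms(1)]])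
  then show ?thesis using assms(1) y by (simp add: P_def)
qed

text \<open>Common zeros with last coordinate 0 are limits of zeros of perturbed systems.\<close>

lemma P_vanishes:
  assumes "p \<in> P" "common_zero n d w x"
  shows "meval w p = 0"
proof (cases "x n = 0")
  case False
  then show ?thesis using P_vanishes_aux assms by blast
next
  case True
  obtain j where j: "j \<in> {1..n}" "x j \<noteq> 0" using assms(2) by (auto simp: common_zero_def)
  then have "j \<noteq> n" using True by auto
  define Y where "Y = (\<lambda>v. if v = n then [:0, 1:] else [:x v:])"
  define jm where "jm = Poly_Mapping.single j d"
  define f where "f = (\<lambda>i. \<Sum>\<alpha>\<in>monomials n d. [:w (i, \<alpha>):] * monom_eval Y \<alpha>)"
  \<comment> \<open>Moving the last coordinate from 0 to s leaves the error \<open>f i\<close> in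
    the i-th equation. Correcting the coefficient of x_j^d removes it, since this monomial keeps its
    nonzero value; at s = 0 there is no error and no correction.\<close>
  define K where "K = (\<lambda>(i, \<alpha>). [:w (i, \<alpha>):] - (if \<alpha> = jm then Polynomial.smult (1 / x j ^ d) (f i) else 0))"
  define y where "y s = (\<lambda>v. poly (Y v) s)" for s
  have f: "poly (f i) s = form_at n d w i (y s)" for i s
    by (simp add: f_def form_at_def poly_sum poly_monom_eval y_def)
  have jm: "jm \<in> monomials n d" using j by (auto simp: jm_def monomials_iff)
  have yj: "monom_eval (y s) jm = x j ^ d" for s using \<open>j \<noteq> n\<close> by (simp add: jm_def y_def Y_def)
  have zero: "form_at n d (\<lambda>v. poly (K v) s) i (y s) = 0" for i s
  proof -
    have "form_at n d (\<lambda>v. poly (K v) s) i (y s) =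
      (\<Sum>\<alpha>\<in>monomials n d. w (i, \<alpha>) * monom_eval (y s) \<alpha> -
        (if \<alpha> = jm then form_at n d w i (y s) / x j ^ d * monom_eval (y s) jm else 0))"
      unfolding form_at_def[of n d "\<lambda>v. poly (K v) s"]
      by (intro sum.cong refl) (auto simp: K_def f algebra_simps)
    also have "\<dots> = form_at n d w i (y s) - form_at n d w i (y s) / x j ^ d * monom_eval (y s) jm"
      using jm by (simp add: sum_subtractf form_at_def[symmetric])
    also have "\<dots> = 0" using j by (simp add: yj)
    finally show ?thesis .
  qed
  define q where "q = msubst K (\<lambda>c. [:c:]) p"
  have q: "poly q s = meval (\<lambda>v. poly (K v) s) p" for s unfolding q_def poly_msubst ..
  have "poly q s = 0" if "s \<noteq> 0" for s
  proof -
    have "y s j \<noteq> 0" using j \<open>j \<noteq> n\<close> by (simp add: y_def Y_def)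
    then have "common_zero n d (\<lambda>v. poly (K v) s) (y s)"
      unfolding common_zero_def using zero j by blast
    moreover have "y s n \<noteq> 0" using that by (simp add: y_def Y_def)
    ultimately show ?thesis unfolding q by (rule P_vanishes_aux[OF assms(1)])
  qed
  then have "q = 0" by (rule poly_eq_0_off_0)
  have "y 0 = x" using True by (auto simp: y_def Y_def)
  have "poly (K v) 0 = w v" if "v \<in> X" for v
  proof -
    obtain i \<alpha> where v: "v = (i, \<alpha>)" "i \<in> {1..n}" using \<open>v \<in> X\<close> by (auto simp: X_def)
    have "poly (f i) 0 = 0" using assms(2) v unfolding f \<open>y 0 = x\<close> by (simp add: common_zero_def)
    then show ?thesis by (simp add: v K_def)
  qed
  then have "meval (\<lambda>v. poly (K v) 0) p = meval w p"
    by (rule meval_cong_X[OF P_mpolys[OF assms(1)]])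
  then show ?thesis using q[of 0] \<open>q = 0\<close> by simp
qed

lemma inertia_form:
  assumes "\<nexists>x. common_zero n d w x"
  shows "\<exists>\<Delta>\<in>P. meval w \<Delta> = 1"
proof -
  let ?F = "\<lambda>w. system_of n d w"
  have F: "?F w \<in> systems n d" for w by (rule system_of_in_systems)
  have c: "coeffs_of (?F w) v = w v" if "v \<in> X" for w v
    using that by (auto simp: coeffs_of_def X_def mcoeff_system_of)
  have hz: "has_zero n (?F w) \<longleftrightarrow> (\<exists>x. common_zero n d w x)" for w
  proof -
    have "form_at n d (coeffs_of (?F w)) i x = form_at n d w i x" if "i \<in> {1..n}" for i x
      using that c by (intro form_at_cong) (auto simp: X_def)
    then show ?thesis unfolding has_zero_iff[OF F] common_zero_def by (simp cong: conj_cong)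
  qed
  obtain \<Delta> where \<Delta>: "\<Delta> \<in> mpolys X" "meval (coeffs_of (?F w)) \<Delta> = 1"
    "\<And>F'. F' \<in> systems n d \<Longrightarrow> has_zero n F' \<Longrightarrow> meval (coeffs_of F') \<Delta> = 0"
    using inertia_form_exists[OF F _ n, of w] hz[of w] assms unfolding X_def by blast
  have "meval (point c x) \<Delta> = 0" if "x n = 1" for c x
  proof -
    have "meval (coeffs_of (?F (point c x))) \<Delta> = 0"
      using \<Delta>(3)[OF F] hz common_zero_point[where x = x, OF that] by blast
    then show ?thesis using meval_cong_X[OF \<Delta>(1), of "coeffs_of (?F (point c x))" "point c x"] c by simp
  qed
  then have "\<Delta> \<in> P" using \<Delta> by (simp add: P_def)
  moreover have "meval w \<Delta> = 1"
    using meval_cong_X[OF \<Delta>(1), of "coeffs_of (?F w)" w] c \<Delta>(2) by simp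
  ultimately show ?thesis by blast
qed

definition pure_powers :: "coeff_index \<Rightarrow> complex" where
  "pure_powers = coeffs_of (\<lambda>i. mVar i ^ d)"

lemma pure_powers_eq: "pure_powers (i, \<alpha>) = (if \<alpha> = Poly_Mapping.single i d then 1 else 0)"
  by (auto simp: pure_powers_def coeffs_of_def mcoeff_def mVar_power lookup_single when_def)

lemma form_at_pure_powers:
  assumes "i \<in> {1..n}"
  shows "form_at n d pure_powers i x = x i ^ d"
proof -
  have "Poly_Mapping.single i d \<in> monomials n d" using assms by (auto simp: monomials_iff)
  then show ?thesis unfolding form_at_def pure_powers_eq
    by (subst sum.remove[of _ "Poly_Mapping.single i d"]) auto
qed

lemma no_common_zero_pure_powers: "\<not> common_zero n d pure_powers x"
  using d by (auto simp: common_zero_def form_at_pure_powers)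

lemma exists_normalized_vector: "\<exists>x::nat \<Rightarrow> complex. x n = 1"
  by (rule exI[of _ "\<lambda>_. 1"]) simp

lemma P_const: "mConst c \<in> P \<Longrightarrow> c = 0"
  using exists_normalized_vector by (auto simp: P_def)

lemma P_nontrivial: "\<exists>p\<in>P. p \<noteq> 0"
proof -
  obtain \<Delta> where "\<Delta> \<in> P" "meval pure_powers \<Delta> = 1"
    using inertia_form[of pure_powers] no_common_zero_pure_powers by blast
  then show ?thesis by (intro bexI[of _ \<Delta>]) auto
qed

text \<open>Eliminating the last coefficient of the last form loses nothing: otherwise, moving from the
  system of the forms x_i^d + v_i x_n^d to an arbitrary one, the lowest order term of a polynomial
  in P free of this coefficient would vanish for all v, since - v_i can be any d-th power.\<close>

lemma P_free_of_tvar: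
  assumes p: "p \<in> P" and t: "tvar \<notin> mvars p"
  shows "p = 0"
proof (rule ccontr)
  assume "p \<noteq> 0"
  then obtain w where w: "meval w p \<noteq> 0" using meval_nonzero_witness by blast
  define c0 :: "coeff_index \<Rightarrow> complex" where "c0 = (\<lambda>(i, \<alpha>). if \<alpha> = Poly_Mapping.single i d then 1 else 0)"
  define free where "free = (\<lambda>(i, \<alpha>). i \<in> {1..<n} \<and> \<alpha> = top_mon)"
  \<comment> \<open>The coefficients of x_n^d in the first n - 1 forms stay indeterminates v_i,
    while all others move along a line in s from the pure powers to the point \<open>w\<close>,
    where \<open>p\<close> is nonzero.\<close>
  define K where "K = (\<lambda>v. if free v then [:mVar (fst v) :: nat mpoly:] else [:mConst (c0 v), mConst (w v - c0 v):])"
  define H where "H = msubst K (\<lambda>c. [:mConst c:]) p"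
  define pt where "pt s v = (\<lambda>u. if free u then v (fst u) else c0 u + s * (w u - c0 u))" for s and v :: "nat \<Rightarrow> complex"
  have hom: "comm_ring_hom (\<lambda>Q. meval v (poly Q (mConst s)))" for v :: "nat \<Rightarrow> complex" and s
    by (rule comm_ring_hom_comp[OF comm_ring_hom_meval comm_ring_hom_poly])
  have H: "meval v (poly H (mConst s)) = meval (pt s v) p" for v s
  proof -
    have "meval v (poly (K u) (mConst s)) = pt s v u" for u
      by (simp add: K_def pt_def meval.hom_add meval.hom_mult)
    then show ?thesis unfolding H_def hom_msubst[OF hom] by (simp add: meval_msubst[of "pt s v"])
  qed
  have "pt 1 (\<lambda>i. w (i, top_mon)) = w"
    by (auto simp: pt_def free_def fun_eq_iff)
  then have "H \<noteq> 0" using w H[of "\<lambda>i. w (i, top_mon)" 1] by auto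
  then obtain e H' where H': "H = [:0, 1:] ^ e * H'" "coeff H' 0 \<noteq> 0" using order_at_0 by blast
  then obtain v0 where v0: "meval v0 (coeff H' 0) \<noteq> 0" using meval_nonzero_witness by blast
  have "\<exists>z. - (z ^ d) = v0 i" for i
  proof -
    obtain z where "z ^ d = - v0 i"
    proof (cases "v0 i = 0")
      case True
      then show ?thesis using that[of 0] d by (simp add: zero_power)
    next
      case False
      then have "card {z. z ^ d = - v0 i} \<noteq> 0" using d by (subst card_nth_roots) auto
      then show ?thesis using that by force
    qed
    then show ?thesis by (intro exI[of _ z]) simp
  qed
  then obtain r where r: "\<And>i. - (r i ^ d) = v0 i" by metis
  define x where "x = (\<lambda>i. if i = n then 1 else r i)"
  define c where "c s = (\<lambda>u. c0 u + s * (w u - c0 u))" for s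
  \<comment> \<open>Solves the first n - 1 equations at \<open>x\<close> for their coefficients of
    x_n^d. The last equation is solved by the coefficient \<open>tvar\<close>, which
    \<open>p\<close> does not see. At s = 0 the values are \<open>v0\<close>.\<close>
  define V where "V = (\<lambda>i. if i \<in> {1..<n} then
     - (\<Sum>\<beta>\<in>monomials n d - {top_mon}. [:c0 (i, \<beta>), w (i, \<beta>) - c0 (i, \<beta>):] * [:monom_eval x \<beta>:]) else [:v0 i:])"
  have V: "poly (V i) s = point (c s) x (i, top_mon)" if "i \<in> {1..<n}" for i s
    using that by (auto simp: V_def point_def poly_sum c_def algebra_simps)
  have V0: "poly (V i) 0 = v0 i" for i
  proof (cases "i \<in> {1..<n}")
    case True
    have "Poly_Mapping.single i d \<noteq> top_mon"
      using True d by (metis atLeastLessThan_iff keys_single less_irrefl not_one_le_zero singleton_inject top_mon_def)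
    then have mem: "Poly_Mapping.single i d \<in> monomials n d - {top_mon}"
      using True by (auto simp: monomials_iff)
    have "poly (V i) 0 = - (\<Sum>\<beta>\<in>monomials n d - {top_mon}. c0 (i, \<beta>) * monom_eval x \<beta>)"
      using True by (simp add: V_def poly_sum mult.commute)
    also have "(\<Sum>\<beta>\<in>monomials n d - {top_mon}. c0 (i, \<beta>) * monom_eval x \<beta>) = x i ^ d"
      using mem by (subst sum.remove[of _ "Poly_Mapping.single i d"]) (auto simp: c0_def)
    also have "- (x i ^ d) = v0 i" using True r by (simp add: x_def)
    finally show ?thesis .
  next
    case False
    then show ?thesis by (simp add: V_def del: atLeastLessThan_iff)
  qed
  have van: "meval (\<lambda>i. poly (V i) s) (poly H (mConst s)) = 0" for s
  proof -
    have "meval (pt s (\<lambda>i. poly (V i) s)) p = meval (point (c s) x) p"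
    proof (rule meval_cong)
      fix u assume "u \<in> mvars p"
      then have "u \<in> X" "u \<noteq> tvar" using p t by (auto simp: P_def mpolys_def)
      then obtain i \<alpha> where u: "u = (i, \<alpha>)" "i \<in> {1..n}" "i = n \<longrightarrow> \<alpha> \<noteq> top_mon"
        by (cases u) (auto simp: X_def tvar_def)
      show "pt s (\<lambda>i. poly (V i) s) u = point (c s) x u"
      proof (cases "\<alpha> = top_mon")
        case True
        then have "i \<in> {1..<n}" using u by auto
        then show ?thesis using True V[of i s] by (simp add: pt_def free_def u(1))
      next
        case False
        then show ?thesis by (simp add: pt_def free_def u(1) point_def c_def)
      qed
    qed
    also have "\<dots> = 0" using p by (simp add: P_def x_def)
    finally show ?thesis by (simp add: H)
  qed
  \<comment> \<open>\<open>H'\<close> along the curve \<open>V\<close>: for nonzero s the factor s^e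
    can be divided out, and the resulting identity extends to s = 0, where the curve passes through
    \<open>v0\<close>.\<close>
  define G where "G = (\<Sum>j\<le>degree H'. msubst V (\<lambda>c. [:c:]) (coeff H' j) * [:0, 1:] ^ j)"
  have G: "poly G s = meval (\<lambda>i. poly (V i) s) (poly H' (mConst s))" for s
    by (simp add: G_def poly_sum poly_msubst poly_altdef[of H'] meval.hom_sum meval.hom_mult meval.hom_power)
  have "poly G s = 0" if "s \<noteq> 0" for s
  proof -
    have "s ^ e * poly G s = 0"
      using van[of s] unfolding H'(1) by (simp add: G meval.hom_mult meval.hom_power)
    then show ?thesis using that by simp
  qed
  then have "G = 0" by (rule poly_eq_0_off_0)
  have "meval v0 (coeff H' 0) = 0"
    using G[of 0] V0 by (simp add: \<open>G = 0\<close> poly_0_coeff_0)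
  with v0 show False by simp
qed

end

section \<open>Existence and uniqueness of the resultant\<close>

context generic_system begin

text \<open>Least degree in \<open>tvar\<close> alone would admit \<open>R\<close> times any nonzero
  polynomial free of \<open>tvar\<close>; the total degree excludes these. Pseudo-division by
  \<open>R\<close> leaves a remainder in \<open>P\<close> of smaller degree, hence 0, and
  \<open>split_factor\<close> disposes of the multiplier.\<close>

lemma P_principal:
  "\<exists>R\<in>P. irreducible R \<and> (\<forall>p\<in>P. R dvd p)"
proof -
  obtain p0 where p0: "p0 \<in> P" "p0 \<noteq> 0" using P_nontrivial by blast
  define v0 where "v0 = (LEAST v. \<exists>p\<in>P. p \<noteq> 0 \<and> vdeg tvar p = v)"
  have v0_ex: "\<exists>p\<in>P. p \<noteq> 0 \<and> vdeg tvar p = v0"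
    unfolding v0_def by (rule LeastI_ex) (use p0 in blast)
  have v0_le: "v0 \<le> vdeg tvar p" if "p \<in> P" "p \<noteq> 0" for p
    unfolding v0_def by (rule Least_le) (use that in blast)
  define t0 where "t0 = (LEAST k. \<exists>p\<in>P. p \<noteq> 0 \<and> vdeg tvar p = v0 \<and> tdeg p = k)"
  have "\<exists>p\<in>P. p \<noteq> 0 \<and> vdeg tvar p = v0 \<and> tdeg p = t0"
    unfolding t0_def by (rule LeastI_ex) (use v0_ex in blast)
  then obtain R where R: "R \<in> P" "R \<noteq> 0" "vdeg tvar R = v0" "tdeg R = t0" by blast
  have t0_le: "t0 \<le> tdeg p" if "p \<in> P" "p \<noteq> 0" "vdeg tvar p = v0" for p
    unfolding t0_def by (rule Least_le) (use that in blast)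
  have RX: "R \<in> mpolys X" using R P_mpolys by blast
  \<comment> \<open>\<open>a\<close> attains the least degree in \<open>tvar\<close> as well, so its
    total degree is at least that of \<open>R\<close>, and only a constant is left for
    \<open>b\<close>.\<close>
  have factor: "b dvd 1" if "a \<in> P" "R = b * a" for a b
  proof -
    have nz: "a \<noteq> 0" "b \<noteq> 0" using that R by auto
    then have "vdeg tvar a = v0"
      using v0_le[OF that(1)] R(3) that(2) by (simp add: vdeg_mult)
    then have "tdeg b = 0"
      using t0_le[OF that(1)] nz R(4) that(2) by (simp add: tdeg_mult)
    then show ?thesis using nz by (simp add: mpoly_dvd_1_iff)
  qed
  have "\<not> R dvd 1"
  proof
    assume "R dvd 1"
    then obtain c where "R = mConst c" using tdeg_0 by (auto simp: mpoly_dvd_1_iff)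
    then show False using R P_const by auto
  qed
  moreover have "a dvd 1 \<or> b dvd 1" if "R = a * b" for a b
  proof -
    have "a \<in> mpolys X" "b \<in> mpolys X"
      using mpolys_factor[of a b X] mpolys_factor[of b a X] that RX R by (auto simp: mult.commute)
    then have "a \<in> P \<or> b \<in> P" using P_prime R that by blast
    then show ?thesis using factor[of a b] factor[of b a] that by (auto simp: mult.commute)
  qed
  ultimately have irr: "irreducible R" using R by (auto simp: irreducible_def)
  have "R dvd p" if p: "p \<in> P" for p
  proof (cases "p = 0")
    case False
    have IH: "\<And>q. irreducible q \<Longrightarrow> q \<in> mpolys (X - {tvar}) \<Longrightarrow> prime_on (X - {tvar}) q"
      by (rule irreducible_prime_on) (use finite_X in auto)
    obtain a q r where *: "a \<in> mpolys (X - {tvar})" "q \<in> mpolys X" "r \<in> mpolys X" "a \<noteq> 0"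
      "a * p = q * R + r" "r = 0 \<or> vdeg tvar r < vdeg tvar R"
      using pseudo_division[OF RX R(2) P_mpolys[OF p], of tvar] by blast
    have "a \<in> mpolys X" using *(1) mpolys_mono[of "X - {tvar}" X] by auto
    have "r = a * p - q * R" using *(5) by simp
    also have "\<dots> \<in> P" by (intro P_diff P_mult p R *(2) \<open>a \<in> mpolys X\<close>)
    finally have "r \<in> P" .
    then have "r = 0" using *(6) v0_le[of r] R(3) by linarith
    then have "a * p = q * R" using *(5) by simp
    from split_factor[OF IH *(1) *(4) *(2) RX this] obtain b1 b2 u' f' where
      b: "b2 \<in> mpolys (X - {tvar})" "R = b2 * f'" "p = u' * f'" by blast
    have "b2 \<noteq> 0" using b R by auto
    \<comment> \<open>\<open>b2\<close> is nonzero and free of \<open>tvar\<close>. Primality then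
      puts the cofactor \<open>f'\<close> into \<open>P\<close>, and \<open>factor\<close> makes
      \<open>b2\<close> a unit.\<close>
    have "b2 \<notin> P" using P_free_of_tvar[of b2] b \<open>b2 \<noteq> 0\<close> by (auto simp: mpolys_def)
    moreover have "b2 \<in> mpolys X" "f' \<in> mpolys X"
      using mpolys_factor[of b2 f' X] mpolys_factor[of f' b2 X] b RX R by (auto simp: mult.commute)
    ultimately have "f' \<in> P" using P_prime[of b2 f'] b R by auto
    then have "b2 dvd 1" using factor b by blast
    then have "R dvd f'" unfolding b by (simp add: mult_unit_dvd_iff')
    then show ?thesis using b by simp
  qed auto
  with irr R show ?thesis by blast
qed

lemma is_resultant_iff:
  "is_resultant n d R \<longleftrightarrow> R \<in> mpolys X \<and> irreducible R \<and>
     (\<forall>w. meval w R = 0 \<longleftrightarrow> (\<exists>x. common_zero n d w x)) \<and> meval pure_powers R = 1"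
proof -
  have "(\<forall>F. (\<forall>i\<in>{1..n}. form n d (F i)) \<longrightarrow> (meval (coeffs_of F) R = 0 \<longleftrightarrow>
         (\<exists>x. (\<exists>i\<in>{1..n}. x i \<noteq> 0) \<and> (\<forall>i\<in>{1..n}. meval x (F i) = 0)))) \<longleftrightarrow>
     (\<forall>w. meval w R = 0 \<longleftrightarrow> (\<exists>x. common_zero n d w x))" (is "?A \<longleftrightarrow> ?B") if R: "R \<in> mpolys X"
  proof -
    have A: "?A \<longleftrightarrow> (\<forall>F\<in>systems n d. meval (coeffs_of F) R = 0 \<longleftrightarrow> (\<exists>x. common_zero n d (coeffs_of F) x))"
      using has_zero_iff unfolding systems_def has_zero_def by blast
    show ?thesis
    proof
      assume ?A
      show ?B
      proof
        fix w
        let ?F = "system_of n d w"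
        have c: "coeffs_of ?F v = w v" if "v \<in> X" for v
          using that by (auto simp: coeffs_of_def X_def mcoeff_system_of)
        have "form_at n d (coeffs_of ?F) i x = form_at n d w i x" if "i \<in> {1..n}" for i x
          using that c by (intro form_at_cong) (auto simp: X_def)
        then have "common_zero n d (coeffs_of ?F) x \<longleftrightarrow> common_zero n d w x" for x
          by (simp add: common_zero_def cong: conj_cong)
        moreover have "meval (coeffs_of ?F) R = meval w R"
          by (rule meval_cong_X[OF R]) (rule c)
        ultimately show "meval w R = 0 \<longleftrightarrow> (\<exists>x. common_zero n d w x)"
          using \<open>?A\<close> system_of_in_systems[of n d w] unfolding A by metis
      qed
    qed (use A in blast)
  qed
  then show ?thesis
    unfolding is_resultant_def pure_powers_def mpolys_def X_def by blast
qed

text \<open>Any candidate vanishes on the parametrized systems, so it is in \<open>P\<close> and a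
  multiple of \<open>R\<close>. Irreducibility makes the cofactor constant, and the value at the
  pure powers fixes the constant.\<close>

theorem resultant_exists_unique: "\<exists>!R. is_resultant n d R"
proof -
  obtain R where R: "R \<in> P" "irreducible R" "\<And>p. p \<in> P \<Longrightarrow> R dvd p" using P_principal by blast
  have zero: "meval w R = 0 \<longleftrightarrow> (\<exists>x. common_zero n d w x)" for w
  proof
    assume *: "meval w R = 0"
    show "\<exists>x. common_zero n d w x"
    proof (rule ccontr)
      assume "\<nexists>x. common_zero n d w x"
      then obtain \<Delta> where "\<Delta> \<in> P" "meval w \<Delta> = 1" using inertia_form by blast
      moreover from R(3)[OF this(1)] obtain q where "\<Delta> = R * q" by auto
      ultimately show False using * by (simp add: meval.hom_mult)
    qed
  qed (use P_vanishes R in blast)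
  define r where "r = meval pure_powers R"
  have "r \<noteq> 0" unfolding r_def zero using no_common_zero_pure_powers by blast
  define R0 where "R0 = mConst (1 / r) * R"
  have "mConst r * mConst (1 / r) = (1 :: coeff_index mpoly)"
    using \<open>r \<noteq> 0\<close> by (simp flip: mConst.hom_mult)
  then have R_eq: "R = mConst r * R0" unfolding R0_def by (simp flip: mult.assoc)
  have "irreducible R0"
    unfolding irreducible_def
  proof (intro conjI allI impI)
    show "R0 \<noteq> 0" using R(2) R_eq by (auto simp: irreducible_def)
    show "\<not> R0 dvd 1"
    proof
      assume "R0 dvd 1"
      then have "mConst r * R0 dvd 1 * 1" by (rule mult_dvd_mono[OF mConst_dvd_1[OF \<open>r \<noteq> 0\<close>]])
      then show False using R(2) R_eq by (simp add: irreducible_def)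
    qed
    fix a b assume "R0 = a * b"
    then have "R = (mConst r * a) * b" by (simp add: R_eq mult.assoc)
    then have "mConst r * a dvd 1 \<or> b dvd 1" using R(2) unfolding irreducible_def by blast
    then show "a dvd 1 \<or> b dvd 1" by (metis dvd_mult_right)
  qed
  then have R0: "is_resultant n d R0"
    unfolding is_resultant_iff using \<open>r \<noteq> 0\<close> zero P_mpolys[OF R(1)]
    by (simp add: R0_def meval.hom_mult r_def mpolys_mult)
  moreover have "R' = R0" if R': "is_resultant n d R'" for R'
  proof -
    have "meval (point c x) R' = 0" if "x n = 1" for c x
      using R' common_zero_point[where x = x, OF that] unfolding is_resultant_iff by blast
    then have "R' \<in> P" using R' unfolding is_resultant_iff P_def by blast
    then obtain u where u: "R' = R * u" using R(3) by blast
    have "u dvd 1" using R' R(2) u unfolding is_resultant_iff irreducible_def by blast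
    then obtain c where c: "u = mConst c" using tdeg_0 by (auto simp: mpoly_dvd_1_iff)
    have "1 = r * c" using R' unfolding is_resultant_iff u c by (simp add: meval.hom_mult r_def)
    then have "c = 1 / r" using \<open>r \<noteq> 0\<close> by (simp add: field_simps)
    then show ?thesis by (simp add: u c R0_def mult.commute)
  qed
  ultimately show ?thesis by blast
qed

lemma is_resultant_resultant_poly: "is_resultant n d (resultant_poly n d)"
  unfolding resultant_poly_def by (rule theI'[OF resultant_exists_unique])

end

theorem form_resultant_eq_0_iff:
  assumes "n \<ge> 1" "d \<ge> 1" "\<And>i. i \<in> {1..n} \<Longrightarrow> form n d (F i)"
  shows "form_resultant n d F = 0 \<longleftrightarrow>
    (\<exists>x. (\<exists>i\<in>{1..n}. x i \<noteq> 0) \<and> (\<forall>i\<in>{1..n}. meval x (F i) = 0))"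
proof -
  interpret generic_system n d by unfold_locales fact+
  show ?thesis
    using is_resultant_resultant_poly assms(3) unfolding is_resultant_def form_resultant_def by blast
qed

section \<open>Eigenvalues of tensors\<close>

lemma form_0 [simp]: "form n d 0" by (simp add: form_def)

lemma form_add: "form n d p \<Longrightarrow> form n d q \<Longrightarrow> form n d (p + q)"
  using Poly_Mapping.keys_add[of p q] unfolding form_def by blast

lemma form_sum: "(\<And>a. a \<in> A \<Longrightarrow> form n d (f a)) \<Longrightarrow> form n d (sum f A)"
  by (induction A rule: infinite_finite_induct) (auto intro: form_add)

lemma prod_list_mVar:
  "(\<Prod>j\<leftarrow>js. mVar j) = Poly_Mapping.single (\<Sum>j\<leftarrow>js. Poly_Mapping.single j 1) 1"
  by (induction js) (auto simp: mVar_def mult_single)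

lemma sum_list_single_in_monomials:
  "set js \<subseteq> {1..n} \<Longrightarrow> (\<Sum>j\<leftarrow>js. Poly_Mapping.single j 1) \<in> monomials n (length js)"
proof (induction js)
  case Nil
  then show ?case by (simp add: monomials_iff mdeg_def)
next
  case (Cons j js)
  then show ?case by (auto simp: monomials_iff mdeg_add keys_add_nat)
qed

lemma form_tensor_form: "form n (m - 1) (tensor_form n m T i)"
  unfolding tensor_form_def
proof (rule form_sum)
  fix js assume js: "js \<in> {js. length js = m - 1 \<and> set js \<subseteq> {1..n}}"
  have "mConst (T (i # js)) * (\<Prod>j\<leftarrow>js. mVar j) =
    Poly_Mapping.single (\<Sum>j\<leftarrow>js. Poly_Mapping.single j 1) (T (i # js))"
    by (simp add: prod_list_mVar mConst_def mult_single)
  then show "form n (m - 1) (mConst (T (i # js)) * (\<Prod>j\<leftarrow>js. mVar j))"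
    using sum_list_single_in_monomials[of js n] js by (auto simp: form_def)
qed

lemma meval_tensor_form:
  "meval x (tensor_form n m T i) =
    (\<Sum>js\<in>{js. length js = m - 1 \<and> set js \<subseteq> {1..n}}. T (i # js) * (\<Prod>j\<leftarrow>js. x j))"
  by (simp add: tensor_form_def meval.hom_sum meval.hom_mult meval.hom_prod_list o_def)

lemma tensor_form_linear:
  "tensor_form n m (\<lambda>js. z * A js - B js) i = mConst z * tensor_form n m A i - tensor_form n m B i"
  by (simp add: tensor_form_def mConst.hom_minus mConst.hom_mult sum_distrib_left
      sum_subtractf left_diff_distrib mult.assoc)

definition eigenvalue :: "nat \<Rightarrow> nat \<Rightarrow> tensor \<Rightarrow> complex \<Rightarrow> bool" where
  "eigenvalue n m T z \<longleftrightarrow> (\<exists>x. (\<exists>i\<in>{1..n}. x i \<noteq> 0) \<and>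
     (\<forall>i\<in>{1..n}. meval x (tensor_form n m (\<lambda>js. z * unit_tensor js - T js) i) = 0))"

text \<open>The coefficients of the forms of \<open>z I - T\<close> are affine in \<open>z\<close>,
  so the determinant is the resultant polynomial restricted to a line.\<close>

lemma poly_tensor_charpoly:
  "poly (tensor_charpoly n m T) z = tensor_det n m (\<lambda>js. z * unit_tensor js - T js)"
proof -
  define R where "R = resultant_poly n (m - 1)"
  define p where "p = line_poly (\<lambda>v. - coeffs_of (tensor_form n m T) v)
    (coeffs_of (tensor_form n m unit_tensor)) R"
  have c: "coeffs_of (tensor_form n m (\<lambda>js. z * unit_tensor js - T js)) =
    (\<lambda>v. - coeffs_of (tensor_form n m T) v + z * coeffs_of (tensor_form n m unit_tensor) v)" for z
    by (auto simp: fun_eq_iff coeffs_of_def tensor_form_linear mcoeff_def lookup_minus lookup_mConst_mult)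
  have p: "poly p z = tensor_det n m (\<lambda>js. z * unit_tensor js - T js)" for z
    unfolding p_def poly_line_poly tensor_det_def form_resultant_def c R_def ..
  have "tensor_charpoly n m T = p"
    unfolding tensor_charpoly_def
    by (rule the_equality) (use p in \<open>auto simp: poly_eq_poly_eq_iff[symmetric]\<close>)
  then show ?thesis using p by simp
qed

text \<open>A single non-eigenvalue \<open>z0\<close> shows that the characteristic polynomial is
  nonzero; \<open>proots\<close> of the zero polynomial would be empty although every number is a
  root.\<close>

theorem in_tensor_spectrum_iff:
  assumes "n \<ge> 1" "m \<ge> 2" "\<not> eigenvalue n m T z0"
  shows "z \<in># tensor_spectrum n m T \<longleftrightarrow> eigenvalue n m T z"
proof -
  have p: "poly (tensor_charpoly n m T) z = 0 \<longleftrightarrow> eigenvalue n m T z" for z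
    unfolding poly_tensor_charpoly tensor_det_def eigenvalue_def
    by (rule form_resultant_eq_0_iff[OF assms(1) _ form_tensor_form]) (use assms(2) in simp)
  then have "tensor_charpoly n m T \<noteq> 0" using assms(3) by force
  then show ?thesis by (simp add: tensor_spectrum_def p)
qed

text \<open>If \<open>z\<close> were no eigenvalue, it would itself be the witness \<open>z0\<close>
  required by \<open>in_tensor_spectrum_iff\<close>.\<close>

lemma tensor_spectrum_eigenvalue:
  assumes "n \<ge> 1" "m \<ge> 2" "z \<in># tensor_spectrum n m T"
  shows "eigenvalue n m T z"
proof (rule ccontr)
  assume "\<not> eigenvalue n m T z"
  then show False using in_tensor_spectrum_iff[OF assms(1,2)] assms(3) by blast
qed

text \<open>The i-th component of A x^(k-1) for the adjacency tensor A. The type is general because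
  the same sum occurs over the reals and over the complex numbers.\<close>

definition neighbor_sum :: "nat set set \<Rightarrow> (nat \<Rightarrow> 'a::comm_semiring_1) \<Rightarrow> nat \<Rightarrow> 'a" where
  "neighbor_sum E x i = (\<Sum>e\<in>{e\<in>E. i \<in> e}. \<Prod>j\<in>e - {i}. x j)"

lemma sum_diag_tensor:
  assumes "i \<in> {1..n}"
  shows "(\<Sum>js\<in>{js. length js = l \<and> set js \<subseteq> {1..n}}. diag_tensor c (i # js) * (\<Prod>j\<leftarrow>js. x j)) = c i * x i ^ l"
proof -
  let ?J = "{js. length js = l \<and> set js \<subseteq> {1..n}}"
  have fin: "finite ?J" using finite_lists_length_eq[of "{1..n}" l] by (simp add: conj_commute)
  have "diag_tensor c (i # js) * (\<Prod>j\<leftarrow>js. x j) = (if js = replicate l i then c i * x i ^ l else 0)"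
    if "js \<in> ?J" for js
  proof (cases "js = replicate l i")
    case True
    then show ?thesis by (auto simp: diag_tensor_def prod_list_replicate)
  next
    case False
    then have "\<not> set js \<subseteq> {i}" using that by (metis (mono_tags, lifting) mem_Collect_eq replicate_eqI singletonD subsetD)
    then show ?thesis using False by (auto simp: diag_tensor_def)
  qed
  then have "(\<Sum>js\<in>?J. diag_tensor c (i # js) * (\<Prod>j\<leftarrow>js. x j)) =
    (\<Sum>js\<in>?J. if js = replicate l i then c i * x i ^ l else 0)" by simp
  also have "\<dots> = c i * x i ^ l" using fin assms by (simp add: set_replicate_conv_if)
  finally show ?thesis .
qed

text \<open>A list of length k whose set is an edge has no repetitions, so the nonzero terms are the
  orderings of \<open>e - {i}\<close>; there are (k-1)! for each edge, which cancels the
  normalization of the entries.\<close>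

lemma sum_adjacency_tensor:
  assumes E: "uniform_hypergraph n k E" and k: "k \<ge> 1"
  shows "(\<Sum>js\<in>{js. length js = k - 1 \<and> set js \<subseteq> {1..n}}. adjacency_tensor k E (i # js) * (\<Prod>j\<leftarrow>js. x j)) =
    neighbor_sum E x i"
proof -
  let ?J = "{js. length js = k - 1 \<and> set js \<subseteq> {1..n}}"
  let ?E = "{e\<in>E. i \<in> e}"
  have fin: "finite ?J" using finite_lists_length_eq[of "{1..n}" "k - 1"] by (simp add: conj_commute)
  have "E \<subseteq> Pow {1..n}" using E by (auto simp: uniform_hypergraph_def)
  then have finE: "finite E" using finite_subset by blast
  have fe: "finite e" "card e = k" "e \<subseteq> {1..n}" if "e \<in> E" for e
    using E that finite_subset[of e "{1..n}"] by (auto simp: uniform_hypergraph_def)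
  have split: "{js\<in>?J. set (i # js) \<in> E} = (\<Union>e\<in>?E. permutations_of_set (e - {i}))"
  proof (intro equalityI subsetI)
    fix js assume js: "js \<in> {js\<in>?J. set (i # js) \<in> E}"
    then have "card (set (i # js)) = length (i # js)" using fe(2) k by auto
    then have "distinct (i # js)" by (rule card_distinct)
    then have "js \<in> permutations_of_set (set (i # js) - {i})" by (auto simp: permutations_of_set_def)
    then show "js \<in> (\<Union>e\<in>?E. permutations_of_set (e - {i}))" using js by auto
  next
    fix js assume "js \<in> (\<Union>e\<in>?E. permutations_of_set (e - {i}))"
    then obtain e where e: "e \<in> E" "i \<in> e" "set js = e - {i}" "distinct js"
      by (auto simp: permutations_of_set_def)
    then have "length js = k - 1" using distinct_card[of js] fe[of e] by simp
    moreover have "set (i # js) = e" using e by auto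
    ultimately show "js \<in> {js\<in>?J. set (i # js) \<in> E}" using e fe[of e] by auto
  qed
  have "(\<Sum>js\<in>?J. adjacency_tensor k E (i # js) * (\<Prod>j\<leftarrow>js. x j)) =
    (\<Sum>js\<in>{js\<in>?J. set (i # js) \<in> E}. 1 / fact (k - 1) * (\<Prod>j\<leftarrow>js. x j))"
    by (rule sum.mono_neutral_cong_right) (use fin in \<open>auto simp: adjacency_tensor_def\<close>)
  also have "\<dots> = (\<Sum>e\<in>?E. \<Sum>js\<in>permutations_of_set (e - {i}). 1 / fact (k - 1) * (\<Prod>j\<leftarrow>js. x j))"
    unfolding split
  proof (rule sum.UNION_disjoint)
    show "finite ?E" using finE by simp
    show "\<forall>e\<in>?E. \<forall>e'\<in>?E. e \<noteq> e' \<longrightarrow> permutations_of_set (e - {i}) \<inter> permutations_of_set (e' - {i}) = {}"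
      by (auto simp: permutations_of_set_def)
  qed (use fe in auto)
  also have "\<dots> = (\<Sum>e\<in>?E. \<Prod>j\<in>e - {i}. x j)"
  proof (rule sum.cong[OF refl])
    fix e assume e: "e \<in> ?E"
    have "(\<Sum>js\<in>permutations_of_set (e - {i}). 1 / fact (k - 1) * (\<Prod>j\<leftarrow>js. x j)) =
      (\<Sum>js\<in>permutations_of_set (e - {i}). 1 / fact (k - 1) * (\<Prod>j\<in>e - {i}. x j))"
      by (intro sum.cong refl) (auto simp: permutations_of_set_def prod.distinct_set_conv_list[symmetric])
    also have "\<dots> = (\<Prod>j\<in>e - {i}. x j)" using e fe[of e] by simp
    finally show "(\<Sum>js\<in>permutations_of_set (e - {i}). 1 / fact (k - 1) * (\<Prod>j\<leftarrow>js. x j)) = (\<Prod>j\<in>e - {i}. x j)" .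
  qed
  finally show ?thesis by (simp add: neighbor_sum_def)
qed

text \<open>The sign \<sigma> treats both tensors at once: 1 for the signless Laplacian, -1 for the
  Laplacian.\<close>

lemma eigenvalue_degree_adjacency_iff:
  assumes E: "uniform_hypergraph n k E" and k: "k \<ge> 1"
    and T: "\<And>js. T js = degree_tensor E js + \<sigma> * adjacency_tensor k E js"
  shows "eigenvalue n k T z \<longleftrightarrow> (\<exists>x. (\<exists>i\<in>{1..n}. x i \<noteq> 0) \<and>
    (\<forall>i\<in>{1..n}. (z - of_nat (vertex_degree E i)) * x i ^ (k - 1) = \<sigma> * neighbor_sum E x i))"
proof -
  have "meval x (tensor_form n k (\<lambda>js. z * unit_tensor js - T js) i) =
    (z - of_nat (vertex_degree E i)) * x i ^ (k - 1) - \<sigma> * neighbor_sum E x i" if "i \<in> {1..n}" for x i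
  proof -
    let ?J = "{js. length js = k - 1 \<and> set js \<subseteq> {1..n}}"
    have d: "z * unit_tensor js - T js = diag_tensor (\<lambda>i. z - of_nat (vertex_degree E i)) js - \<sigma> * adjacency_tensor k E js" for js
      by (simp add: T unit_tensor_def degree_tensor_def diag_tensor_def)
    have "meval x (tensor_form n k (\<lambda>js. z * unit_tensor js - T js) i) =
      (\<Sum>js\<in>?J. diag_tensor (\<lambda>i. z - of_nat (vertex_degree E i)) (i # js) * (\<Prod>j\<leftarrow>js. x j)) -
      \<sigma> * (\<Sum>js\<in>?J. adjacency_tensor k E (i # js) * (\<Prod>j\<leftarrow>js. x j))"
      unfolding meval_tensor_form d by (simp add: sum_subtractf sum_distrib_left left_diff_distrib mult.assoc)
    then show ?thesis unfolding sum_adjacency_tensor[OF E k] sum_diag_tensor[OF that] .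
  qed
  then show ?thesis unfolding eigenvalue_def by (simp cong: conj_cong)
qed

section \<open>The largest signless Laplacian eigenvalue\<close>

lemma sum_update:
  fixes f :: "nat \<Rightarrow> real \<Rightarrow> real"
  assumes "finite A" "i \<in> A"
  shows "(\<Sum>j\<in>A. f j ((x(i := t)) j)) = (\<Sum>j\<in>A. f j (x j)) - f i (x i) + f i t"
proof -
  have "(\<Sum>j\<in>A - {i}. f j ((x(i := t)) j)) = (\<Sum>j\<in>A - {i}. f j (x j))"
    by (intro sum.cong) auto
  then show ?thesis using assms
    by (simp only: sum.remove[OF assms]) simp
qed

text \<open>After multiplication by the conjugate of the sum, the real parts of the terms add up to
  the sum of their norms, so every term is a nonnegative real. The cross-multiplied form also covers
  zero terms and a zero sum.\<close>

lemma equal_phases: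
  fixes f :: "'i \<Rightarrow> complex"
  assumes "finite A" "norm (sum f A) = (\<Sum>a\<in>A. norm (f a))" "a \<in> A"
  shows "norm (sum f A) * f a = norm (f a) * sum f A"
proof (cases "sum f A = 0")
  case True
  then have "(\<Sum>a\<in>A. norm (f a)) = 0" using assms(2) by simp
  then have "f a = 0" using assms by (simp add: sum_nonneg_eq_0_iff)
  then show ?thesis by simp
next
  case False
  define s where "s = sum f A"
  define g where "g b = cnj s * f b" for b
  have s: "norm s \<noteq> 0" using False by (simp add: s_def)
  have cc: "cnj s * s = of_real (norm s * norm s)"
    using complex_norm_square[of s] by (simp add: power2_eq_square mult.commute)
  have "sum g A = cnj s * s" unfolding g_def s_def by (rule sum_distrib_left[symmetric])
  then have "(\<Sum>b\<in>A. Re (g b)) = norm s * norm s"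
    unfolding Re_sum[symmetric] cc by simp
  also have "\<dots> = norm s * (\<Sum>b\<in>A. norm (f b))" using assms(2) by (simp add: s_def)
  also have "\<dots> = (\<Sum>b\<in>A. norm (g b))" by (simp add: g_def norm_mult sum_distrib_left)
  finally have "(\<Sum>b\<in>A. norm (g b) - Re (g b)) = 0" by (simp add: sum_subtractf)
  then have "norm (g a) - Re (g a) = 0"
    using assms(1,3) by (subst (asm) sum_nonneg_eq_0_iff) (auto simp: complex_Re_le_cmod)
  then have "Im (g a) = 0" using cmod_power2[of "g a"] by simp
  then have "g a = of_real (norm (g a))" using \<open>norm (g a) - Re (g a) = 0\<close> by (simp add: complex_eq_iff)
  then have "cnj s * f a = of_real (norm s) * of_real (norm (f a))" by (simp add: g_def norm_mult)
  then have "(cnj s * s) * f a = of_real (norm s) * of_real (norm (f a)) * s" by (simp add: mult_ac)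
  then have "of_real (norm s) * (of_real (norm s) * f a) = of_real (norm s) * (of_real (norm (f a)) * s)"
    unfolding cc by (simp add: mult_ac)
  then show ?thesis using s by (simp add: s_def)
qed

section \<open>The form Q x^k on nonnegative vectors and its maximizer\<close>

locale hypergraph =
  fixes n k :: nat and E :: "nat set set"
  assumes uniform: "uniform_hypergraph n k E" and nonempty: "E \<noteq> {}" and k3: "k \<ge> 3"
begin

abbreviation deg :: "nat \<Rightarrow> real" where "deg i \<equiv> real (vertex_degree E i)"

lemma edge: "e \<in> E \<Longrightarrow> finite e" "e \<in> E \<Longrightarrow> card e = k" "e \<in> E \<Longrightarrow> e \<subseteq> {1..n}"
  using uniform finite_subset[of e "{1..n}"] by (auto simp: uniform_hypergraph_def)

lemma finite_E: "finite E"
proof -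
  have "E \<subseteq> Pow {1..n}" using edge(3) by auto
  then show ?thesis using finite_subset by blast
qed

lemma n_pos: "n \<ge> 1"
proof (rule ccontr)
  assume "\<not> n \<ge> 1"
  with nonempty obtain e where "e \<in> E" "e \<subseteq> {}" using edge(3) by force
  then show False using edge(2)[of e] k3 by auto
qed

text \<open>This is Q x^k: every edge is counted once for each of its k vertices.\<close>

definition energy :: "(nat \<Rightarrow> real) \<Rightarrow> real" where
  "energy x = (\<Sum>i\<in>{1..n}. deg i * x i ^ k) + real k * (\<Sum>e\<in>E. \<Prod>j\<in>e. x j)"

definition mass :: "(nat \<Rightarrow> real) \<Rightarrow> real" where
  "mass x = (\<Sum>i\<in>{1..n}. x i ^ k)"

lemma neighbor_sum_mult:
  fixes x :: "nat \<Rightarrow> 'a::comm_semiring_1"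
  shows "x i * neighbor_sum E x i = (\<Sum>e\<in>{e\<in>E. i \<in> e}. \<Prod>j\<in>e. x j)"
  unfolding neighbor_sum_def sum_distrib_left
  by (intro sum.cong refl) (use edge in \<open>auto simp: prod.remove\<close>)

lemma sum_neighbor_sum:
  fixes x :: "nat \<Rightarrow> real"
  shows "(\<Sum>i\<in>{1..n}. x i * neighbor_sum E x i) = real k * (\<Sum>e\<in>E. \<Prod>j\<in>e. x j)"
proof -
  have "(\<Sum>i\<in>{1..n}. x i * neighbor_sum E x i) = (\<Sum>i\<in>{1..n}. \<Sum>e\<in>E. if i \<in> e then \<Prod>j\<in>e. x j else 0)"
    unfolding neighbor_sum_mult sum.inter_filter[OF finite_E] ..
  also have "\<dots> = (\<Sum>e\<in>E. \<Sum>i\<in>{1..n}. if i \<in> e then \<Prod>j\<in>e. x j else 0)" by (rule sum.swap)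
  also have "\<dots> = (\<Sum>e\<in>E. real k * (\<Prod>j\<in>e. x j))"
  proof (rule sum.cong[OF refl])
    fix e assume e: "e \<in> E"
    have "(\<Sum>i\<in>{1..n}. if i \<in> e then \<Prod>j\<in>e. x j else 0) = (\<Sum>i\<in>{i\<in>{1..n}. i \<in> e}. \<Prod>j\<in>e. x j)"
      by (rule sum.inter_filter[symmetric]) simp
    also have "{i\<in>{1..n}. i \<in> e} = e" using edge(3)[OF e] by auto
    finally show "(\<Sum>i\<in>{1..n}. if i \<in> e then \<Prod>j\<in>e. x j else 0) = real k * (\<Prod>j\<in>e. x j)"
      using edge(2)[OF e] by simp
  qed
  finally show ?thesis by (simp add: sum_distrib_left)
qed

lemma energy_eq: "energy x = (\<Sum>i\<in>{1..n}. x i * (deg i * x i ^ (k - 1) + neighbor_sum E x i))"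
proof -
  have "x i ^ k = x i * x i ^ (k - 1)" for i using k3 by (metis power_eq_if not_numeral_le_zero)
  then show ?thesis
    unfolding energy_def sum_neighbor_sum[symmetric] by (simp add: sum.distrib algebra_simps)
qed

lemma energy_scale: "energy (\<lambda>i. a * x i) = a ^ k * energy x"
proof -
  have "(\<Prod>j\<in>e. a * x j) = a ^ k * (\<Prod>j\<in>e. x j)" if "e \<in> E" for e
    using edge(2)[OF that] by (simp add: prod.distrib)
  then have "(\<Sum>e\<in>E. \<Prod>j\<in>e. a * x j) = a ^ k * (\<Sum>e\<in>E. \<Prod>j\<in>e. x j)"
    by (simp add: sum_distrib_left)
  then show ?thesis
    unfolding energy_def by (simp add: power_mult_distrib algebra_simps sum_distrib_left)
qed

lemma mass_scale: "mass (\<lambda>i. a * x i) = a ^ k * mass x"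
  by (simp add: mass_def power_mult_distrib sum_distrib_left)

text \<open>A maximum exists on the compact set of mass 1. Since \<open>energy\<close> and
  \<open>mass\<close> are homogeneous of the same degree, the bound extends by scaling, and vectors
  of mass 0 have energy 0.\<close>

lemma maximizer_exists:
  "\<exists>x. (\<forall>i. x i \<ge> 0) \<and> mass x = 1 \<and> (\<forall>y. (\<forall>i. y i \<ge> 0) \<longrightarrow> energy y \<le> energy x * mass y)"
proof -
  \<comment> \<open>Vectors are functions on all natural numbers; fixing the coordinates outside
    \<open>{1..n}\<close> at 0 makes the domain compact in the product topology.\<close>
  define K where "K = (\<lambda>i::nat. if i \<in> {1..n} then {0..1::real} else {0})"
  have cont: "continuous_on A (\<lambda>x::nat \<Rightarrow> real. x i)" for A i
    by (rule continuous_on_subset[OF continuous_on_product_coordinates]) auto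
  have "compactin (product_topology (\<lambda>_. euclidean) UNIV) (PiE UNIV K)"
    unfolding compactin_PiE by (auto simp: K_def)
  then have "compact (PiE UNIV K)" by (simp add: euclidean_product_topology)
  moreover have "closed {x. mass x = 1}"
    unfolding mass_def by (intro closed_Collect_eq continuous_intros cont)
  ultimately have comp: "compact (PiE UNIV K \<inter> {x. mass x = 1})" by (rule compact_Int_closed)
  have "(\<lambda>i. if i = 1 then 1 else 0) \<in> PiE UNIV K \<inter> {x. mass x = 1}"
  proof -
    have "mass (\<lambda>i. if i = 1 then 1 else 0) = (\<Sum>i\<in>{1..n}. if i = 1 then 1 else 0)"
      unfolding mass_def using k3 by (intro sum.cong) (auto simp: zero_power)
    then show ?thesis using n_pos by (auto simp: K_def)
  qed
  then have "PiE UNIV K \<inter> {x. mass x = 1} \<noteq> {}" by blast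
  moreover have "continuous_on (PiE UNIV K \<inter> {x. mass x = 1}) energy"
    unfolding energy_def by (intro continuous_intros cont)
  ultimately obtain x where x: "x \<in> PiE UNIV K \<inter> {x. mass x = 1}"
    "\<And>y. y \<in> PiE UNIV K \<inter> {x. mass x = 1} \<Longrightarrow> energy y \<le> energy x"
    using continuous_attains_sup[OF comp] by metis
  have K_nonneg: "t \<ge> 0" if "t \<in> K i" for t i using that by (auto simp: K_def split: if_splits)
  have "energy y \<le> energy x * mass y" if y: "\<forall>i. y i \<ge> 0" for y
  proof -
    define y' where "y' = (\<lambda>i. if i \<in> {1..n} then y i else 0)"
    have e: "energy y' = energy y"
    proof -
      have "(\<Prod>j\<in>e. y' j) = (\<Prod>j\<in>e. y j)" if "e \<in> E" for e
        using edge(3)[OF that] by (intro prod.cong) (auto simp: y'_def)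
      then show ?thesis by (simp add: energy_def y'_def)
    qed
    have m: "mass y' = mass y" by (simp add: mass_def y'_def)
    have "mass y \<ge> 0" unfolding mass_def using y by (intro sum_nonneg) auto
    show ?thesis
    proof (cases "mass y = 0")
      case True
      then have y0: "y i = 0" if "i \<in> {1..n}" for i
        using that y unfolding mass_def by (subst (asm) sum_nonneg_eq_0_iff) auto
      have "(\<Prod>j\<in>e. y j) = 0" if eE: "e \<in> E" for e
      proof -
        obtain j where j: "j \<in> e" using edge(2)[OF eE] k3 by fastforce
        then have "y j = 0" using y0 edge(3)[OF eE] by blast
        then show ?thesis using edge(1)[OF eE] j by (intro prod_zero) auto
      qed
      then have "energy y = 0" using y0 k3 by (simp add: energy_def zero_power)
      then show ?thesis using True by simp
    next
      case False
      with \<open>mass y \<ge> 0\<close> have pos: "mass y > 0" by simp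
      define r where "r = root k (mass y)"
      have r: "r > 0" "r ^ k = mass y" using pos k3 by (auto simp: r_def)
      define u where "u = (\<lambda>i. (1 / r) * y' i)"
      have mu: "mass u = 1" unfolding u_def mass_scale m using r pos by (simp add: power_divide)
      have u0: "u i \<ge> 0" for i using y r by (simp add: u_def y'_def)
      have "u i \<le> 1" if "i \<in> {1..n}" for i
      proof -
        have "u i ^ k \<le> mass u" unfolding mass_def using that u0 by (intro member_le_sum) auto
        then have "u i ^ k \<le> 1 ^ k" using mu by simp
        then show ?thesis using k3 by (intro power_le_imp_le_base[of "u i" "k - 1" 1]) auto
      qed
      moreover have "u i = 0" if "i \<notin> {1..n}" for i using that unfolding u_def y'_def by (simp only: if_False mult_zero_right)
      ultimately have "u i \<in> K i" for i using u0[of i] unfolding K_def by (cases "i \<in> {1..n}") simp_all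
      then have "u \<in> PiE UNIV K" by auto
      then have "energy u \<le> energy x" using x(2) mu by blast
      moreover have "energy u = energy y / mass y"
        unfolding u_def energy_scale e using r by (simp add: power_divide)
      ultimately show ?thesis using pos by (simp add: field_simps)
    qed
  qed
  moreover have "x i \<ge> 0" for i using x(1) K_nonneg[of "x i" i] by (auto simp: PiE_def)
  ultimately show ?thesis using x(1) by blast
qed

definition perron :: "nat \<Rightarrow> real" where
  "perron = (SOME x. (\<forall>i. x i \<ge> 0) \<and> mass x = 1 \<and> (\<forall>y. (\<forall>i. y i \<ge> 0) \<longrightarrow> energy y \<le> energy x * mass y))"

definition rho :: real where "rho = energy perron"

lemma perron: "perron i \<ge> 0" "mass perron = 1"
  and energy_le: "(\<And>i. y i \<ge> 0) \<Longrightarrow> energy y \<le> rho * mass y"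
  using someI_ex[OF maximizer_exists] unfolding perron_def[symmetric] rho_def by blast+

lemma mass_update: "i \<in> {1..n} \<Longrightarrow> mass (x(i := t)) = mass x - x i ^ k + t ^ k"
  unfolding mass_def using sum_update[of "{1..n}" i "\<lambda>_ s. s ^ k"] by blast

text \<open>An edge contains i at most once, so its product is affine in this coordinate.\<close>

lemma energy_update:
  assumes "i \<in> {1..n}"
  shows "energy (x(i := t)) = energy x + deg i * (t ^ k - x i ^ k) + real k * (t - x i) * neighbor_sum E x i"
proof -
  have 1: "(\<Sum>j\<in>{1..n}. deg j * (x(i := t)) j ^ k) = (\<Sum>j\<in>{1..n}. deg j * x j ^ k) + deg i * (t ^ k - x i ^ k)"
    using sum_update[of "{1..n}" i "\<lambda>j s. deg j * s ^ k" x t] assms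
    by (simp only: finite_atLeastAtMost) (simp only: algebra_simps)
  have 2: "(\<Sum>e\<in>E. \<Prod>j\<in>e. (x(i := t)) j) = (\<Sum>e\<in>E. \<Prod>j\<in>e. x j) + (t - x i) * neighbor_sum E x i"
  proof -
    have "(\<Prod>j\<in>e. (x(i := t)) j) = (\<Prod>j\<in>e. x j) + (if i \<in> e then (t - x i) * (\<Prod>j\<in>e - {i}. x j) else 0)"
      if "e \<in> E" for e
    proof (cases "i \<in> e")
      case True
      have "(\<Prod>j\<in>e - {i}. (x(i := t)) j) = (\<Prod>j\<in>e - {i}. x j)" by (intro prod.cong) auto
      then show ?thesis using True edge(1)[OF that] by (simp add: prod.remove[of e i] algebra_simps)
    next
      case False
      then have "(\<Prod>j\<in>e. (x(i := t)) j) = (\<Prod>j\<in>e. x j)" by (intro prod.cong) auto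
      then show ?thesis using False by simp
    qed
    then have "(\<Sum>e\<in>E. \<Prod>j\<in>e. (x(i := t)) j) = (\<Sum>e\<in>E. \<Prod>j\<in>e. x j) +
        (\<Sum>e\<in>E. if i \<in> e then (t - x i) * (\<Prod>j\<in>e - {i}. x j) else 0)"
      by (simp add: sum.distrib)
    also have "(\<Sum>e\<in>E. if i \<in> e then (t - x i) * (\<Prod>j\<in>e - {i}. x j) else 0) = (t - x i) * neighbor_sum E x i"
      unfolding neighbor_sum_def sum.inter_filter[OF finite_E]
      by (auto simp: sum_distrib_left intro!: sum.cong)
    finally show ?thesis .
  qed
  show ?thesis unfolding energy_def 1 2 by (simp add: algebra_simps)
qed

lemma neighbor_sum_nonneg: "(\<And>i. x i \<ge> 0) \<Longrightarrow> neighbor_sum E x i \<ge> (0 :: real)"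
  unfolding neighbor_sum_def by (intro sum_nonneg prod_nonneg) auto

text \<open>\<open>f t\<close> is \<open>rho\<close> times the mass minus the energy after
  coordinate i is changed to t: nonnegative for t \<ge> 0, and 0 at the present value. For a
  positive coordinate this is an interior minimum.\<close>

lemma perron_equation:
  assumes i: "i \<in> {1..n}"
  shows "(rho - deg i) * perron i ^ (k - 1) = neighbor_sum E perron i"
proof -
  let ?x = perron
  define f where "f t = (rho - deg i) * (t ^ k - ?x i ^ k) - real k * (t - ?x i) * neighbor_sum E ?x i" for t
  have f: "f t \<ge> 0" if "t \<ge> 0" for t
  proof -
    have "energy (?x(i := t)) \<le> rho * mass (?x(i := t))"
      by (rule energy_le) (use perron that in auto)
    then show ?thesis
      unfolding energy_update[OF i] mass_update[OF i] using perron(2)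
      by (simp add: f_def algebra_simps flip: rho_def)
  qed
  show ?thesis
  proof (cases "?x i = 0")
    case True
    have "((\<lambda>t. (rho - deg i) * t ^ (k - 1) / real k) \<longlongrightarrow> (rho - deg i) * 0 ^ (k - 1) / real k) (at_right 0)"
      by (intro tendsto_intros) (use k3 in auto)
    moreover have "\<forall>\<^sub>F t in at_right 0. neighbor_sum E ?x i \<le> (rho - deg i) * t ^ (k - 1) / real k"
      using eventually_at_right_less
    proof (rule eventually_mono)
      fix t :: real assume t: "0 < t"
      have "t ^ k = t * t ^ (k - 1)" using k3 by (metis power_eq_if not_numeral_le_zero)
      then have "f t = t * ((rho - deg i) * t ^ (k - 1) - real k * neighbor_sum E ?x i)"
        using True k3 by (simp add: f_def zero_power algebra_simps)
      then have "(rho - deg i) * t ^ (k - 1) - real k * neighbor_sum E ?x i \<ge> 0"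
        using f[of t] t by (simp add: zero_le_mult_iff)
      then show "neighbor_sum E ?x i \<le> (rho - deg i) * t ^ (k - 1) / real k"
        using k3 by (simp add: field_simps)
    qed
    ultimately have "neighbor_sum E ?x i \<le> (rho - deg i) * 0 ^ (k - 1) / real k"
      by (rule tendsto_lowerbound) simp
    then have "neighbor_sum E ?x i \<le> 0" using k3 by (simp add: zero_power)
    then show ?thesis using neighbor_sum_nonneg[of ?x i] perron(1) True k3 by (simp add: zero_power)
  next
    case False
    then have pos: "?x i > 0" using perron(1)[of i] by simp
    have "(f has_real_derivative (rho - deg i) * (real k * ?x i ^ (k - 1)) - real k * neighbor_sum E ?x i) (at (?x i))"
      unfolding f_def by (auto intro!: derivative_eq_intros)
    then have "(rho - deg i) * (real k * ?x i ^ (k - 1)) - real k * neighbor_sum E ?x i = 0"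
    proof (rule DERIV_local_min[OF _ pos], intro allI impI)
      fix t assume "\<bar>?x i - t\<bar> < ?x i"
      then show "f (?x i) \<le> f t" using f[of t] by (simp add: f_def)
    qed
    then have "real k * ((rho - deg i) * ?x i ^ (k - 1)) = real k * neighbor_sum E ?x i"
      by (simp add: algebra_simps)
    then show ?thesis using k3 by simp
  qed
qed

lemma perron_nonzero: "\<exists>i\<in>{1..n}. perron i \<noteq> 0"
proof (rule ccontr)
  assume "\<not> ?thesis"
  then have "mass perron = 0" unfolding mass_def using k3 by (simp add: zero_power)
  then show False using perron(2) by simp
qed

text \<open>The competitor is 1 at a vertex i and 1 / deg i at the other vertices of an edge through i.\<close>

lemma deg_less_rho_of_edge:
  assumes e: "e \<in> E" "i \<in> e"
  shows "deg i < rho"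
proof (rule ccontr)
  assume n: "\<not> deg i < rho"
  have "vertex_degree E i \<noteq> 0"
    using e finite_E by (auto simp: vertex_degree_def card_eq_0_iff)
  then have d1: "deg i \<ge> 1" by simp
  \<comment> \<open>With \<open>deg i * \<epsilon> = 1\<close>, the assumption that
    \<open>rho\<close> is at most \<open>deg i\<close> reduces to k \<epsilon>^(k-1) \<le> (k-1)
    \<epsilon>^(k-1).\<close>
  define \<epsilon> where "\<epsilon> = 1 / deg i"
  have \<epsilon>: "\<epsilon> > 0" "deg i * \<epsilon> = 1" using d1 by (auto simp: \<epsilon>_def)
  define y where "y = (\<lambda>j. if j = i then 1 else if j \<in> e then \<epsilon> else 0)"
  have y0: "y j \<ge> 0" for j using \<epsilon> by (simp add: y_def)
  have i: "i \<in> {1..n}" using e edge by blast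
  have "mass y = 1 + (\<Sum>j\<in>{1..n} - {i}. y j ^ k)"
    unfolding mass_def using i by (simp add: sum.remove[of _ i] y_def)
  also have "(\<Sum>j\<in>{1..n} - {i}. y j ^ k) = (\<Sum>j\<in>e - {i}. \<epsilon> ^ k)"
    by (rule sum.mono_neutral_cong_right) (use edge(3)[OF e(1)] k3 in \<open>auto simp: y_def zero_power\<close>)
  also have "\<dots> = (real k - 1) * \<epsilon> ^ k" using e edge[OF e(1)] k3 by (simp add: of_nat_diff)
  finally have mass: "mass y = 1 + (real k - 1) * \<epsilon> ^ k" .
  have "deg i + real k * \<epsilon> ^ (k - 1) \<le> energy y"
  proof -
    have "deg i * y i ^ k \<le> (\<Sum>j\<in>{1..n}. deg j * y j ^ k)"
      using i y0 by (intro member_le_sum) auto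
    moreover have "(\<Prod>j\<in>e. y j) \<le> (\<Sum>e\<in>E. \<Prod>j\<in>e. y j)"
      using e finite_E y0 by (intro member_le_sum) (auto intro: prod_nonneg)
    moreover have "(\<Prod>j\<in>e. y j) = \<epsilon> ^ (k - 1)"
    proof -
      have "(\<Prod>j\<in>e. y j) = (\<Prod>j\<in>e - {i}. y j)" using e edge[OF e(1)] by (simp add: prod.remove[of _ i] y_def)
      also have "\<dots> = (\<Prod>j\<in>e - {i}. \<epsilon>)" by (intro prod.cong) (auto simp: y_def)
      finally show ?thesis using e edge[OF e(1)] by simp
    qed
    ultimately show ?thesis unfolding energy_def
      by (intro add_mono mult_left_mono) (auto simp: y_def)
  qed
  also have "energy y \<le> rho * mass y" by (rule energy_le) (rule y0)
  also have "\<dots> \<le> deg i * mass y"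
    using n mass \<epsilon> k3 by (intro mult_right_mono) auto
  finally have "real k * \<epsilon> ^ (k - 1) \<le> deg i * ((real k - 1) * \<epsilon> ^ k)"
    unfolding mass by (simp add: algebra_simps)
  also have "\<epsilon> ^ k = \<epsilon> * \<epsilon> ^ (k - 1)" using k3 by (metis power_eq_if not_numeral_le_zero)
  also have "deg i * ((real k - 1) * (\<epsilon> * \<epsilon> ^ (k - 1))) = (deg i * \<epsilon>) * ((real k - 1) * \<epsilon> ^ (k - 1))"
    by (simp only: mult_ac)
  finally have "real k * \<epsilon> ^ (k - 1) \<le> (real k - 1) * \<epsilon> ^ (k - 1)" using \<epsilon> by simp
  then show False using \<epsilon> by (simp add: mult_le_cancel_right)
qed

text \<open>A vertex on no edge has degree 0, and \<open>rho\<close> exceeds the nonnegative degree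
  of a vertex on some edge.\<close>

lemma deg_less_rho: "deg i < rho"
proof (cases "\<exists>e\<in>E. i \<in> e")
  case True
  then show ?thesis using deg_less_rho_of_edge by blast
next
  case False
  then have *: "{e \<in> E. i \<in> e} = {}" by blast
  have "deg i = 0" unfolding vertex_degree_def * by simp
  obtain e where e: "e \<in> E" using nonempty by blast
  then obtain j where "j \<in> e" using edge(2)[OF e] k3 by fastforce
  then show ?thesis using deg_less_rho_of_edge[OF e, of j] \<open>deg i = 0\<close> by simp
qed

section \<open>Complex eigenvectors compared through their absolute values\<close>

lemma energy_norm_ge:
  assumes z: "\<And>i. i \<in> {1..n} \<Longrightarrow> (r - deg i) * norm (z i) ^ (k - 1) \<le> neighbor_sum E (\<lambda>i. norm (z i)) i"
  shows "r * mass (\<lambda>i. norm (z i)) \<le> energy (\<lambda>i. norm (z i :: complex))"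
proof -
  have pw: "norm (z i) ^ k = norm (z i) * norm (z i) ^ (k - 1)" for i
    using k3 by (metis power_eq_if not_numeral_le_zero)
  have "r * mass (\<lambda>i. norm (z i)) = (\<Sum>i\<in>{1..n}. norm (z i) * (r * norm (z i) ^ (k - 1)))"
    unfolding mass_def pw by (simp add: sum_distrib_left mult_ac)
  also have "\<dots> \<le> energy (\<lambda>i. norm (z i))"
    unfolding energy_eq by (intro sum_mono mult_left_mono) (use z in \<open>auto simp: algebra_simps\<close>)
  finally show ?thesis .
qed

lemma norm_neighbor_sum_le:
  fixes z :: "nat \<Rightarrow> complex"
  shows "norm (neighbor_sum E z i) \<le> neighbor_sum E (\<lambda>i. norm (z i)) i"
  unfolding neighbor_sum_def by (rule order.trans[OF norm_sum]) (simp add: prod_norm)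

text \<open>As \<open>r\<close> exceeds every degree, \<open>r - deg i\<close> is a positive real
  and equals its own norm.\<close>

lemma eigen_norm_inequality:
  fixes z :: "nat \<Rightarrow> complex"
  assumes "(of_real r - of_nat (vertex_degree E i)) * z i ^ (k - 1) = \<sigma> * neighbor_sum E z i"
    and "norm \<sigma> = 1" "r \<ge> rho"
  shows "(r - deg i) * norm (z i) ^ (k - 1) = norm (neighbor_sum E z i)"
proof -
  have "norm (of_real r - of_nat (vertex_degree E i) :: complex) = r - deg i"
    using deg_less_rho[of i] assms(3)
    by (metis abs_of_pos diff_gt_0_iff_gt less_le_trans norm_of_real of_real_diff of_real_of_nat_eq)
  then show ?thesis using arg_cong[OF assms(1), of norm] assms(2) by (simp add: norm_mult norm_power)
qed

text \<open>For larger \<open>r\<close> the absolute values of the eigenvector would give r mass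
  \<le> energy \<le> rho mass with positive mass. This supplies the non-eigenvalue that makes the
  characteristic polynomial nonzero.\<close>

lemma eigenvalue_le_rho:
  fixes z :: "nat \<Rightarrow> complex"
  assumes "\<And>i. i \<in> {1..n} \<Longrightarrow> (of_real r - of_nat (vertex_degree E i)) * z i ^ (k - 1) = \<sigma> * neighbor_sum E z i"
    and "norm \<sigma> = 1" and nz: "\<exists>i\<in>{1..n}. z i \<noteq> 0"
  shows "r \<le> rho"
proof (rule ccontr)
  assume r: "\<not> r \<le> rho"
  then have "r * mass (\<lambda>i. norm (z i)) \<le> energy (\<lambda>i. norm (z i))"
    using eigen_norm_inequality[OF assms(1,2)] norm_neighbor_sum_le by (intro energy_norm_ge) auto
  also have "\<dots> \<le> rho * mass (\<lambda>i. norm (z i))" by (rule energy_le) simp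
  finally have "mass (\<lambda>i. norm (z i)) \<le> 0" using r by (simp add: mult_le_cancel_right)
  moreover obtain i where i: "i \<in> {1..n}" "z i \<noteq> 0" using nz by blast
  then have "0 < norm (z i) ^ k" by simp
  also have "norm (z i) ^ k \<le> mass (\<lambda>i. norm (z i))"
    unfolding mass_def using i by (intro member_le_sum) auto
  ultimately show False by simp
qed

lemma rho_signless_eigenvalue:
  "\<exists>x :: nat \<Rightarrow> complex. (\<exists>i\<in>{1..n}. x i \<noteq> 0) \<and>
    (\<forall>i\<in>{1..n}. (of_real rho - of_nat (vertex_degree E i)) * x i ^ (k - 1) = 1 * neighbor_sum E x i)"
proof (intro exI conjI ballI)
  let ?x = "\<lambda>i. complex_of_real (perron i)"
  show "\<exists>i\<in>{1..n}. ?x i \<noteq> 0" using perron_nonzero by simp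
  fix i assume "i \<in> {1..n}"
  from arg_cong[OF perron_equation[OF this], of complex_of_real]
  show "(of_real rho - of_nat (vertex_degree E i)) * ?x i ^ (k - 1) = 1 * neighbor_sum E ?x i"
    by (simp add: neighbor_sum_def)
qed

text \<open>Equality in the triangle inequality at each vertex of an edge e forces
  z^e = - |z^e| z_i^k / |z_i|^k for all i in e; multiplying over i in e gives a contradiction for
  odd k.\<close>

lemma rho_not_laplacian_eigenvalue:
  fixes z :: "nat \<Rightarrow> complex"
  assumes "odd k"
    and eq: "\<And>i. i \<in> {1..n} \<Longrightarrow> (of_real rho - of_nat (vertex_degree E i)) * z i ^ (k - 1) = - 1 * neighbor_sum E z i"
    and nz: "\<exists>i\<in>{1..n}. z i \<noteq> 0"
  shows False
proof -
  have pw: "x ^ k = x * x ^ (k - 1)" for x :: "'a::comm_monoid_mult" using k3 by (metis power_eq_if not_numeral_le_zero)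
  define y where "y = (\<lambda>i. norm (z i))"
  \<comment> \<open>The defect of the triangle inequality at vertex i, weighted by
    \<open>y i\<close>. The defects are nonnegative and add up to
    \<open>energy y - rho * mass y\<close>, which is at most 0, so all of them vanish.\<close>
  define u where "u i = y i * (neighbor_sum E y i - (rho - deg i) * y i ^ (k - 1))" for i
  have norm_eq: "(rho - deg i) * y i ^ (k - 1) = norm (neighbor_sum E z i)" if "i \<in> {1..n}" for i
    unfolding y_def by (rule eigen_norm_inequality[OF eq[OF that]]) auto
  have u0: "u i \<ge> 0" if "i \<in> {1..n}" for i
    unfolding u_def norm_eq[OF that] using norm_neighbor_sum_le[of z i] by (simp add: y_def)
  have "(\<Sum>i\<in>{1..n}. u i) = energy y - rho * mass y"
    unfolding energy_eq mass_def pw u_def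
    by (simp add: sum_distrib_left sum_subtractf[symmetric] algebra_simps)
  also have "\<dots> \<le> 0" using energy_le[of y] by (simp add: y_def)
  finally have "u i = 0" if "i \<in> {1..n}" for i
    using u0 that by (metis finite_atLeastAtMost sum_nonneg sum_nonneg_eq_0_iff antisym)
  then have ns: "y i * neighbor_sum E y i = (rho - deg i) * y i ^ k" if "i \<in> {1..n}" for i
    using that unfolding u_def pw by (simp add: algebra_simps)
  define w where "w e = (\<Prod>j\<in>e. z j)" for e
  have norm_w: "norm (w e) = (\<Prod>j\<in>e. y j)" for e by (simp add: w_def y_def prod_norm)
  have edge_sum: "(\<Sum>e\<in>{e\<in>E. i \<in> e}. w e) = - (of_real rho - of_nat (vertex_degree E i)) * z i ^ k"
    if "i \<in> {1..n}" for i
  proof -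
    have "(\<Sum>e\<in>{e\<in>E. i \<in> e}. w e) = z i * neighbor_sum E z i"
      unfolding w_def by (rule neighbor_sum_mult[symmetric])
    also have "\<dots> = - (z i * ((of_real rho - of_nat (vertex_degree E i)) * z i ^ (k - 1)))"
      unfolding eq[OF that] by simp
    finally show ?thesis by (simp only: pw mult_minus_left mult_minus_right mult_ac)
  qed
  have norm_edge_sum: "norm (\<Sum>e\<in>{e\<in>E. i \<in> e}. w e) = (rho - deg i) * y i ^ k" if "i \<in> {1..n}" for i
  proof -
    have "(\<Sum>e\<in>{e\<in>E. i \<in> e}. w e) = z i * neighbor_sum E z i"
      unfolding w_def by (rule neighbor_sum_mult[symmetric])
    then show ?thesis using norm_eq[OF that] by (simp add: norm_mult y_def pw mult_ac)
  qed
  have sum_norm: "(\<Sum>e\<in>{e\<in>E. i \<in> e}. norm (w e)) = (rho - deg i) * y i ^ k" if "i \<in> {1..n}" for i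
    unfolding norm_w neighbor_sum_mult[symmetric] by (rule ns[OF that])
  have phase: "of_real (y i ^ k) * w e = - (of_real (norm (w e)) * z i ^ k)" if "e \<in> E" "i \<in> e" for e i
  proof -
    have i: "i \<in> {1..n}" using edge(3) that by blast
    define c where "c = rho - deg i"
    have "c \<noteq> 0" using deg_less_rho[of i] by (simp add: c_def)
    have c: "of_real rho - of_nat (vertex_degree E i) = complex_of_real c" by (simp add: c_def)
    have "complex_of_real (c * y i ^ k) * w e = of_real (norm (w e)) * (- complex_of_real c * z i ^ k)"
      using equal_phases[of "{e\<in>E. i \<in> e}" w e] that finite_E norm_edge_sum[OF i] sum_norm[OF i]
      unfolding edge_sum[OF i] c by (simp add: c_def)
    then have "complex_of_real c * (of_real (y i ^ k) * w e) = complex_of_real c * (- (of_real (norm (w e)) * z i ^ k))"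
      by (simp add: mult_ac)
    then show ?thesis by (subst (asm) mult_left_cancel) (use \<open>c \<noteq> 0\<close> in simp)
  qed
  obtain i where i: "i \<in> {1..n}" "z i \<noteq> 0" using nz by blast
  \<comment> \<open>The sum is \<open>(rho - deg i) * y i ^ k\<close>, positive since
    \<open>rho\<close> exceeds the degree; so some edge through i has a nonzero product.\<close>
  have "(\<Sum>e\<in>{e\<in>E. i \<in> e}. norm (w e)) \<noteq> 0"
    unfolding sum_norm[OF i(1)] using i deg_less_rho[of i] by (simp add: y_def)
  then obtain e where e: "e \<in> E" "i \<in> e" "w e \<noteq> 0"
    by (metis (mono_tags, lifting) mem_Collect_eq norm_eq_zero sum.neutral)
  have "(\<Prod>i\<in>e. of_real (y i ^ k) * w e) = (\<Prod>i\<in>e. - (of_real (norm (w e)) * z i ^ k))"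
    using phase e by (intro prod.cong) auto
  moreover have "(\<Prod>i\<in>e. of_real (y i ^ k) * w e) = of_real (norm (w e)) ^ k * w e ^ k"
    using edge(2)[OF e(1)] by (simp add: prod.distrib norm_w prod_power_distrib)
  moreover have "(\<Prod>i\<in>e. - (of_real (norm (w e)) * z i ^ k)) = (- 1) ^ k * (of_real (norm (w e)) ^ k * w e ^ k)"
  proof -
    have "(\<Prod>i\<in>e. - (of_real (norm (w e)) * z i ^ k)) = (\<Prod>i\<in>e. (- of_real (norm (w e))) * z i ^ k)" by simp
    also have "\<dots> = (- of_real (norm (w e))) ^ k * w e ^ k"
      unfolding prod.distrib w_def prod_power_distrib using edge(2)[OF e(1)] by simp
    finally show ?thesis by (subst (asm) power_minus) (simp add: mult.assoc)
  qed
  ultimately have "of_real (norm (w e)) ^ k * w e ^ k = (- 1) ^ k * (of_real (norm (w e)) ^ k * w e ^ k)" by simp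
  then have "of_real (norm (w e)) ^ k * w e ^ k = 0" using \<open>odd k\<close> by simp
  then show False using e by simp
qed

end

theorem theorem3p3:
  fixes n k :: nat and E :: "nat set set"
  assumes "uniform_hypergraph n k E"
    and "E \<noteq> {}"
    and "k \<ge> 3"
    and "odd k"
  shows "tensor_spectrum n k (laplacian_tensor k E)
       \<noteq> tensor_spectrum n k (signless_laplacian_tensor k E)"
proof -
  interpret hypergraph n k E by unfold_locales fact+
  have Q: "eigenvalue n k (signless_laplacian_tensor k E) z \<longleftrightarrow> (\<exists>x. (\<exists>i\<in>{1..n}. x i \<noteq> 0) \<and>
    (\<forall>i\<in>{1..n}. (z - of_nat (vertex_degree E i)) * x i ^ (k - 1) = 1 * neighbor_sum E x i))" for z
    by (rule eigenvalue_degree_adjacency_iff[OF uniform])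
      (use k3 in \<open>auto simp: signless_laplacian_tensor_def\<close>)
  have L: "eigenvalue n k (laplacian_tensor k E) z \<longleftrightarrow> (\<exists>x. (\<exists>i\<in>{1..n}. x i \<noteq> 0) \<and>
    (\<forall>i\<in>{1..n}. (z - of_nat (vertex_degree E i)) * x i ^ (k - 1) = - 1 * neighbor_sum E x i))" for z
    by (rule eigenvalue_degree_adjacency_iff[OF uniform])
      (use k3 in \<open>auto simp: laplacian_tensor_def\<close>)
  have m: "k \<ge> 2" using k3 by simp
  have "eigenvalue n k (signless_laplacian_tensor k E) (of_real rho)"
    unfolding Q by (rule rho_signless_eigenvalue)
  \<comment> \<open>Any real number above \<open>rho\<close> would serve here as the witness that
    the characteristic polynomial is nonzero.\<close>
  moreover have "\<not> eigenvalue n k (signless_laplacian_tensor k E) (of_real (rho + 1))"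
    unfolding Q using eigenvalue_le_rho[of "rho + 1" _ 1]
    by (metis add_le_same_cancel1 norm_one not_one_le_zero)
  ultimately have "of_real rho \<in># tensor_spectrum n k (signless_laplacian_tensor k E)"
    by (subst in_tensor_spectrum_iff[OF n_pos m])
  moreover have "\<not> eigenvalue n k (laplacian_tensor k E) (of_real rho)"
    unfolding L using rho_not_laplacian_eigenvalue[OF \<open>odd k\<close>] by blast
  then have "of_real rho \<notin># tensor_spectrum n k (laplacian_tensor k E)"
    using tensor_spectrum_eigenvalue[OF n_pos m] by blast
  ultimately show ?thesis by metis
qed

end
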